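(* Let $X=X(\Sigma)$ be a smooth complete toric variety of Picard number $r\leq 3$ (hence $X$ is projective, by a result of Kleinschmidt and Sturmfels), and let $\gamma_\Sigma=\mathrm{Nef}(X)\subset \mathrm{Cl}(X)\otimes\mathbb{R}$ be the associated chamber of the secondary fan. Then $\Sigma$ admits a nef primitive collection $\mathcal{P}$ such that $\gamma_\Sigma$ is a bordering chamber with respect to the support hyperplane $H_P$ of $\mathcal{P}$, i.e. $H_P$ cuts out a facet of the pseudo-effective cone $\overline{\mathrm{Eff}}(X)$ and $\dim(\mathrm{Nef}(X)\cap H_P)\geq 1$. In particular $X$ admits a non-trivial nef and non-big divisor.
   Context: Let $\Sigma$ be a complete regular fan in $N_{\mathbb{R}}$, with primitive ray generators $\mathbf{v}_1,\dots,\mathbf{v}_{n+r}$ and corresponding torus-invariant prime divisors $D_1,\dots,D_{n+r}$ on the $n$-dimensional variety $X$; $r$ is the Picard number (also called rank). The pseudo-effective cone $\overline{\mathrm{Eff}}(X)$ is the cone in $\mathrm{Cl}(X)\otimes\mathbb{R}\cong\mathbb{R}^r$ generated by the classes $[D_j]$. The secondary fan (GKZ decomposition) is a fan with support $\overline{\mathrm{Eff}}(X)$; its $r$-dimensional cones are called chambers, and the chamber $\gamma_\Sigma$ associated with $\Sigma$ is $\mathrm{Nef}(X)$; it is contained in the closed movable cone of $X$. A subset $\mathcal{P}=\{\langle\mathbf{v}_j\rangle : j\in P\}$ of $\Sigma(1)$, $P\subseteq\{1,\dots,n+r\}$, is a \emph{primitive collection} for $\Sigma$ if it is not contained in the set of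 rays of a single cone of $\Sigma$ but every proper subset is. The vector $\sum_{j\in P}\mathbf{v}_j$ lies in the relative interior of a unique cone $\sigma\in\Sigma$, and there is a unique relation $\sum_{j\in P}\mathbf{v}_j-\sum_{\rho\in\sigma(1)}c_\rho\mathbf{v}_\rho=0$ with all $c_\rho>0$ (the \emph{primitive relation}), where $\mathbf{v}_\rho$ is the primitive generator of $\rho$. Let $b_j$ be the total coefficient of $\mathbf{v}_j$ in this relation. There is a unique linear functional $\mathbf{n}_P$ on $\mathrm{Cl}(X)\otimes\mathbb{R}$ with $\mathbf{n}_P([D_j])=b_j$ for all $j$. The \emph{support} of $\mathcal{P}$ is the hyperplane $H_P=\ker\mathbf{n}_P\subset\mathrm{Cl}(X)\otimes\mathbb{R}$. The primitive collection $\mathcal{P}$ is \emph{nef} if $b_j\geq 0$ for all $j$. A chamber $\gamma$ is \emph{bordering with respect to} a hyperplane $H$ if $H$ cuts out a facet of $\overline{\mathrm{Eff}}(X)$ and $\dim(\gamma\cap H)\geq 1$.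
   Formalization: For r = 1 (projective space) the claim fails: H_P = {0}, so dim(Nef(X) ∩ H_P) = 0, and every non-trivial nef divisor is big; there only a nef primitive collection whose H_P cuts out a facet of Eff(X) is claimed. For r = 2, 3 the full statement is proved. *)

theory Defs
  imports "HOL-Analysis.Analysis"
begin

section \<open>Fans\<close>

definition lattice_points :: "(real^'n) set" where
  "lattice_points = {x. \<forall>i. x $ i \<in> \<int>}"

definition lattice_basis :: "(real^'n) set \<Rightarrow> bool" where
  "lattice_basis B \<longleftrightarrow> finite B \<and> independent B \<and>
     lattice_points = {\<Sum>b\<in>B. of_int (k b) *\<^sub>R b | k :: real^'n \<Rightarrow> int. True}"

definition strongly_convex_rational_cone :: "(real^'n) set \<Rightarrow> bool" where
  "strongly_convex_rational_cone \<sigma> \<longleftrightarrow>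
     (\<exists>S. finite S \<and> S \<subseteq> lattice_points \<and> \<sigma> = convex_cone hull S) \<and> \<sigma> \<inter> uminus ` \<sigma> = {0}"

text \<open>The library counts the empty set as a face of every convex set; faces of cones are
  the nonempty ones.\<close>

definition is_fan :: "(real^'n) set set \<Rightarrow> bool" where
  "is_fan \<Delta> \<longleftrightarrow> finite \<Delta> \<and>
     (\<forall>\<sigma>\<in>\<Delta>. strongly_convex_rational_cone \<sigma>) \<and>
     (\<forall>\<sigma>\<in>\<Delta>. \<forall>\<tau>. \<tau> face_of \<sigma> \<and> \<tau> \<noteq> {} \<longrightarrow> \<tau> \<in> \<Delta>) \<and>
     (\<forall>\<sigma>\<in>\<Delta>. \<forall>\<tau>\<in>\<Delta>. (\<sigma> \<inter> \<tau>) face_of \<sigma> \<and> (\<sigma> \<inter> \<tau>) face_of \<tau>)"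

definition complete_fan :: "(real^'n) set set \<Rightarrow> bool" where
  "complete_fan \<Delta> \<longleftrightarrow> is_fan \<Delta> \<and> \<Union>\<Delta> = UNIV"

definition regular_fan :: "(real^'n) set set \<Rightarrow> bool" where
  "regular_fan \<Delta> \<longleftrightarrow> is_fan \<Delta> \<and>
     (\<forall>\<sigma>\<in>\<Delta>. \<exists>B S. lattice_basis B \<and> S \<subseteq> B \<and> \<sigma> = convex_cone hull S)"

definition rays :: "(real^'n) set set \<Rightarrow> (real^'n) set set" where
  "rays \<Delta> = {\<rho> \<in> \<Delta>. dim \<rho> = 1}"

definition cone_rays :: "(real^'n) set \<Rightarrow> (real^'n) set set" where
  "cone_rays \<sigma> = {\<rho>. \<rho> face_of \<sigma> \<and> dim \<rho> = 1}"

definition prim_gen :: "(real^'n) set \<Rightarrow> real^'n" where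
  "prim_gen \<rho> = (THE v. v \<noteq> 0 \<and> \<rho> \<inter> lattice_points = {of_nat k *\<^sub>R v | k :: nat. True})"


section \<open>Divisors and divisor classes\<close>

text \<open>A torus-invariant divisor is given by its coefficients on the rays (values elsewhere are
  ignored). A model of \<open>Cl(X) \<otimes> \<real>\<close> as \<open>\<real>\<^sup>r\<close> is given by the images \<open>q \<rho>\<close> of the classes
  of the prime divisors: they span, and the linear relations among them are exactly the
  \<open>\<real>\<close>-combinations of principal divisors. Such a \<open>q\<close> exists exactly if \<open>r\<close> is the
  Picard number, and it is then unique up to a linear automorphism of \<open>\<real>\<^sup>r\<close>.\<close>

definition class_map :: "(real^'n) set set \<Rightarrow> ((real^'n) set \<Rightarrow> real^'r) \<Rightarrow> bool" where
  "class_map \<Delta> q \<longleftrightarrow> span (q ` rays \<Delta>) = UNIV \<and>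
     (\<forall>a. (\<Sum>\<rho>\<in>rays \<Delta>. a \<rho> *\<^sub>R q \<rho>) = 0 \<longleftrightarrow> (\<exists>m. \<forall>\<rho>\<in>rays \<Delta>. a \<rho> = m \<bullet> prim_gen \<rho>))"

definition divisor_class ::
  "(real^'n) set set \<Rightarrow> ((real^'n) set \<Rightarrow> real^'r) \<Rightarrow> ((real^'n) set \<Rightarrow> real) \<Rightarrow> real^'r" where
  "divisor_class \<Delta> q a = (\<Sum>\<rho>\<in>rays \<Delta>. a \<rho> *\<^sub>R q \<rho>)"

definition principal_divisor :: "(real^'n) set set \<Rightarrow> ((real^'n) set \<Rightarrow> int) \<Rightarrow> bool" where
  "principal_divisor \<Delta> D \<longleftrightarrow>
     (\<exists>m\<in>lattice_points. \<forall>\<rho>\<in>rays \<Delta>. of_int (D \<rho>) = m \<bullet> prim_gen \<rho>)"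

definition Eff_cone :: "(real^'n) set set \<Rightarrow> ((real^'n) set \<Rightarrow> real^'r) \<Rightarrow> (real^'r) set" where
  "Eff_cone \<Delta> q = convex_cone hull (q ` rays \<Delta>)"

text \<open>On a complete toric variety a divisor is nef iff its support function is convex. Here
  \<open>\<psi>\<close> is the support function with the sign for which it takes the values \<open>a \<rho>\<close> (not
  \<open>- a \<rho>\<close>) on the primitive generators, so that ``convex'' has the usual meaning.
  The classes of these divisors form the cone of the secondary fan associated with \<open>\<Delta>\<close>.\<close>

definition nef_divisor :: "(real^'n) set set \<Rightarrow> ((real^'n) set \<Rightarrow> real) \<Rightarrow> bool" where
  "nef_divisor \<Delta> a \<longleftrightarrow>
     (\<exists>\<psi> :: real^'n \<Rightarrow> real. (\<forall>\<sigma>\<in>\<Delta>. \<exists>m. \<forall>u\<in>\<sigma>. \<psi> u = m \<bullet> u) \<and>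
          (\<forall>\<rho>\<in>rays \<Delta>. \<psi> (prim_gen \<rho>) = a \<rho>) \<and> convex_on UNIV \<psi>)"

definition Nef_cone :: "(real^'n) set set \<Rightarrow> ((real^'n) set \<Rightarrow> real^'r) \<Rightarrow> (real^'r) set" where
  "Nef_cone \<Delta> q = divisor_class \<Delta> q ` {a. nef_divisor \<Delta> a}"

text \<open>\<open>H\<^sup>0(X, O(D))\<close> has as a basis the characters \<open>m\<close> with \<open>div(m) + D \<ge> 0\<close>;
  \<open>D\<close> is big iff its volume is positive.\<close>

definition h0 :: "(real^'n) set set \<Rightarrow> ((real^'n) set \<Rightarrow> int) \<Rightarrow> nat" where
  "h0 \<Delta> D = card {m \<in> lattice_points. \<forall>\<rho>\<in>rays \<Delta>. m \<bullet> prim_gen \<rho> + of_int (D \<rho>) \<ge> 0}"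

definition big_divisor :: "(real^'n) set set \<Rightarrow> ((real^'n) set \<Rightarrow> int) \<Rightarrow> bool" where
  "big_divisor \<Delta> D \<longleftrightarrow>
     limsup (\<lambda>k. ereal (real (h0 \<Delta> (\<lambda>\<rho>. int k * D \<rho>)) / real k ^ CARD('n))) > 0"


section \<open>Primitive collections\<close>

definition primitive_collection :: "(real^'n) set set \<Rightarrow> (real^'n) set set \<Rightarrow> bool" where
  "primitive_collection \<Delta> P \<longleftrightarrow> P \<subseteq> rays \<Delta> \<and>
     \<not> (\<exists>\<sigma>\<in>\<Delta>. P \<subseteq> cone_rays \<sigma>) \<and> (\<forall>Q. Q \<subset> P \<longrightarrow> (\<exists>\<sigma>\<in>\<Delta>. Q \<subseteq> cone_rays \<sigma>))"

text \<open>\<open>b\<close> collects the total coefficients of the primitive relation of \<open>P\<close>.\<close>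

definition primitive_relation ::
  "(real^'n) set set \<Rightarrow> (real^'n) set set \<Rightarrow> ((real^'n) set \<Rightarrow> real) \<Rightarrow> bool" where
  "primitive_relation \<Delta> P b \<longleftrightarrow>
     (\<exists>\<sigma>\<in>\<Delta>. \<exists>c. (\<Sum>\<rho>\<in>P. prim_gen \<rho>) \<in> rel_interior \<sigma> \<and>
        (\<forall>\<rho>\<in>cone_rays \<sigma>. c \<rho> > 0) \<and>
        (\<Sum>\<rho>\<in>P. prim_gen \<rho>) - (\<Sum>\<rho>\<in>cone_rays \<sigma>. c \<rho> *\<^sub>R prim_gen \<rho>) = 0 \<and>
        b = (\<lambda>\<rho>. (if \<rho> \<in> P then 1 else 0) - (if \<rho> \<in> cone_rays \<sigma> then c \<rho> else 0)))"

definition prim_coeff ::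
  "(real^'n) set set \<Rightarrow> (real^'n) set set \<Rightarrow> (real^'n) set \<Rightarrow> real" where
  "prim_coeff \<Delta> P = (THE b. primitive_relation \<Delta> P b)"

definition nef_primitive_collection :: "(real^'n) set set \<Rightarrow> (real^'n) set set \<Rightarrow> bool" where
  "nef_primitive_collection \<Delta> P \<longleftrightarrow>
     primitive_collection \<Delta> P \<and> (\<forall>\<rho>\<in>rays \<Delta>. prim_coeff \<Delta> P \<rho> \<ge> 0)"

definition prim_functional ::
  "(real^'n) set set \<Rightarrow> ((real^'n) set \<Rightarrow> real^'r) \<Rightarrow> (real^'n) set set \<Rightarrow> real^'r \<Rightarrow> real" where
  "prim_functional \<Delta> q P = (THE f. linear f \<and> (\<forall>\<rho>\<in>rays \<Delta>. f (q \<rho>) = prim_coeff \<Delta> P \<rho>))"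

definition prim_support ::
  "(real^'n) set set \<Rightarrow> ((real^'n) set \<Rightarrow> real^'r) \<Rightarrow> (real^'n) set set \<Rightarrow> (real^'r) set" where
  "prim_support \<Delta> q P = {x. prim_functional \<Delta> q P x = 0}"

definition cuts_out_facet :: "(real^'r) set \<Rightarrow> (real^'r) set \<Rightarrow> bool" where
  "cuts_out_facet H E \<longleftrightarrow> (H \<inter> E) facet_of E"

text \<open>For a set containing \<open>0\<close>, such as a cone, \<^const>\<open>dim\<close> is the dimension of its affine hull.
  If \<open>r = 1\<close> the only facet of \<open>E\<close> is \<open>{0}\<close>, so no chamber is bordering: on projective space
  every nontrivial nef divisor is big.\<close>

definition bordering :: "(real^'r) set \<Rightarrow> (real^'r) set \<Rightarrow> (real^'r) set \<Rightarrow> bool" where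
  "bordering \<gamma> H E \<longleftrightarrow> cuts_out_facet H E \<and> dim (\<gamma> \<inter> H) \<ge> 1"

end

theory Submission
  imports Defs
begin

text \<open>
  Work with the Gale dual vectors \<open>q \<rho>\<close> and the set \<open>B\<close> of complements of the ray sets of the maximal
  cones. In these terms smoothness says that neighbouring members \<open>T\<close> and \<open>T - t + i\<close> of \<open>B\<close> satisfy
  \<open>q i - q t \<in> span (q ` (T - t))\<close>, a primitive collection is a minimal set meeting every \<open>T \<in> B\<close>,
  and its primitive relation has sum zero as soon as the \<open>q\<close>s outside it do not span.

  For \<open>r = 3\<close> and a primitive collection \<open>P\<close>, every \<open>a \<in> P\<close> cuts the complement of \<open>P\<close> into two sides
  \<open>L\<close>, \<open>R\<close> such that \<open>{a, l, r} \<in> B\<close> exactly for \<open>l\<close>, \<open>r\<close> on different sides. All these triples have the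
  same determinant, so one of the sides is constant modulo \<open>q a\<close>. The sides \<open>L\<close> form a chain. Three
  different cuts give seven vectors arranged like a regular heptagon, where the constancy statements
  produce a cycle \<open>x\<^sub>3 = x\<^sub>4 + x\<^sub>1, x\<^sub>1 = x\<^sub>2 + x\<^sub>6, \<dots>\<close> of decompositions, which is impossible in a pointed
  cone. So there are one or two cuts, and \<open>B\<close> contains all triples of a triangle or pentagon of classes;
  in both cases the classes outside some primitive collection are coplanar.

  Given a primitive collection with sum zero, the same dichotomy of cuts exhibits a ray \<open>j\<close> outside \<open>P\<close> with
  \<open>q j\<close> in the cones over all \<open>T \<in> B\<close>. Its divisor is nef and lies on the facet defined by \<open>P\<close>; it is not
  big, because the sections of its multiples are characters orthogonal to \<open>P\<close>.
\<close>

section \<open>Vectors in three-space with equal determinants\<close>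

text \<open>Equal determinants and orientation alone do not settle the pentagon. Unless three
  consecutive classes are coplanar, every class shrinks to a single vector, and the five normalized
  determinants of consecutive vectors satisfy c_i = 1 - c_(i-1) c_(i+1). This system has the
  positive real solution with all c_i = (sqrt 5 - 1) / 2. Integrality of coordinates, a second use
  of smoothness besides the equality of determinants, excludes it: nonzero integers would need a
  sign pattern of period 3 on a cycle of length 5. So one determinant vanishes.

  The primitive collection chosen at the start only serves to find the classes and need not have sum
  zero itself. The collection that does is what remains outside the coplanar part: one class of the
  triangle, or two adjacent classes of the pentagon. A coplanar complement is the kernel of a
  functional equal to 1 on the collection, and by Gale duality the values of a functional on the
  classes are the coefficients of a relation among the ray generators.\<close>

lemma cyclic_sign_pattern:
  fixes c0 c1 c2 c3 c4 :: int
  assumes eq: "c0 = 1 - c4 * c1" "c1 = 1 - c0 * c2" "c2 = 1 - c1 * c3" "c3 = 1 - c2 * c4" "c4 = 1 - c3 * c0"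
    and pos: "c0 > 0 \<or> c1 > 0" "c1 > 0 \<or> c2 > 0" "c2 > 0 \<or> c3 > 0" "c3 > 0 \<or> c4 > 0" "c4 > 0 \<or> c0 > 0"
  shows "c0 = 0 \<or> c1 = 0 \<or> c2 = 0 \<or> c3 = 0 \<or> c4 = 0"
proof (rule ccontr)
  assume nz: "\<not> ?thesis"
  \<comment> \<open>A positive entry has neighbours of opposite sign: equal signs would make their
    integer product at least 1 and the entry at most 0.\<close>
  have *: "c < 0 \<or> (a < 0) \<noteq> (b < 0)" if "c = 1 - a * b" "a \<noteq> 0" "b \<noteq> 0" "c \<noteq> 0" for a b c :: int
  proof (rule ccontr)
    assume "\<not> ?thesis"
    then have "a * b > 0" "c > 0" using that by (auto simp: zero_less_mult_iff)
    then show False using that by linarith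
  qed
  \<comment> \<open>By \<open>pos\<close> a negative entry has two positive neighbours, and by the
    claim a positive one has exactly one negative neighbour. So there would be twice as many
    positive as negative entries, and 5 would be divisible by 3.\<close>
  show False
    using *[OF eq(1)] *[OF eq(2)] *[OF eq(3)] *[OF eq(4)] *[OF eq(5)] pos nz
    by (metis less_asym)
qed

locale volume_form =
  fixes D :: "'v::real_vector \<Rightarrow> 'v \<Rightarrow> 'v \<Rightarrow> real"
  assumes add: "D (x + y) u v = D x u v + D y u v"
    and scale: "D (c *\<^sub>R x) u v = c * D x u v"
    and cyclic: "D x y z = D y z x"
    and swap: "D y x z = - D x y z"
    and cramer: "D u v w *\<^sub>R y = D y v w *\<^sub>R u + D u y w *\<^sub>R v + D u v y *\<^sub>R w"
begin

lemma add2: "D u (x + y) v = D u x v + D u y v"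
  by (metis add cyclic)

lemma add3: "D u v (x + y) = D u v x + D u v y"
  by (metis add cyclic)

lemma scale2: "D u (c *\<^sub>R x) v = c * D u x v"
  by (metis scale cyclic)

lemma scale3: "D u v (c *\<^sub>R x) = c * D u v x"
  by (metis scale cyclic)

lemma zero: "D 0 u v = 0" "D u 0 v = 0" "D u v 0 = 0"
  using scale[of 0 0] scale2[of _ 0 0] scale3[of _ _ 0 0] by auto

lemma rep: "D x x z = 0" "D x z x = 0" "D z x x = 0"
proof -
  show "D x x z = 0" for x z using swap[of x x z] by simp
  then show "D x z x = 0" "D z x x = 0" by (metis cyclic)+
qed

lemma swap23: "D x z y = - D x y z"
  by (metis cyclic swap)

lemma diff: "D (x - y) u v = D x u v - D y u v" "D u (x - y) v = D u x v - D u y v"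
    "D u v (x - y) = D u v x - D u v y"
  using add[of "x - y" y u v] add2[of u "x - y" y v] add3[of u v "x - y" y] by auto

lemmas expand = add add2 add3 scale scale2 scale3 diff rep zero

lemma coordinates:
  assumes "D u v w \<noteq> 0"
  shows "y = (D y v w / D u v w) *\<^sub>R u + (D u y w / D u v w) *\<^sub>R v + (D u v y / D u v w) *\<^sub>R w"
proof -
  have "y = (1 / D u v w) *\<^sub>R (D u v w *\<^sub>R y)" using assms by simp
  also have "\<dots> = (D y v w / D u v w) *\<^sub>R u + (D u y w / D u v w) *\<^sub>R v + (D u v y / D u v w) *\<^sub>R w"
    by (subst cramer) (simp add: scaleR_add_right)
  finally show ?thesis .
qed

text \<open>For an independent triple of determinant 0, \<open>cramer\<close> is a vanishing
  combination, so its coefficients are 0. Replacing the members one after another by arbitrary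
  vectors then shows that \<open>D\<close> vanishes identically.\<close>

lemma degenerate_imp_dependent:
  assumes "D u v w = 0" and "D x y z \<noteq> 0"
  obtains a b c where "a *\<^sub>R u + b *\<^sub>R v + c *\<^sub>R w = 0" "a \<noteq> 0 \<or> b \<noteq> 0 \<or> c \<noteq> 0"
proof (rule ccontr)
  note dependent = that
  assume "\<not> thesis"
  then have ind: "a = 0 \<and> b = 0 \<and> c = 0" if "a *\<^sub>R u + b *\<^sub>R v + c *\<^sub>R w = 0" for a b c
    using dependent that by metis
  have 1: "D y v w = 0" for y using cramer[of u v w y] assms(1) ind[of "D y v w"] by simp
  have 2: "D y y' w = 0" for y y'
    using cramer[of y v w y'] 1 ind[of 0 "D y y' w" "D y v y'"] by simp
  have "D y y' y'' = 0" for y y' y''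
    using cramer[of y y' w y''] 2 ind[of 0 0 "D y y' y''"] by simp
  then show False using assms(2) by blast
qed

text \<open>Modulo \<open>x\<close> the form becomes an area form on a plane. If neither set were
  constant there, suitable pairs would satisfy y' = y + \<eta> z and z' = z + \<eta>' y with both
  factors nonzero, and the area of y', z' would be \<delta> (1 - \<eta> \<eta>') instead of
  \<delta>.\<close>

lemma const_mod:
  assumes "\<And>y z. y \<in> Y \<Longrightarrow> z \<in> Z \<Longrightarrow> D x y z = \<delta>" and "\<delta> \<noteq> 0"
  shows "(\<forall>y\<in>Y. \<forall>y'\<in>Y. \<exists>\<kappa>. y' = y + \<kappa> *\<^sub>R x) \<or> (\<forall>z\<in>Z. \<forall>z'\<in>Z. \<exists>\<kappa>. z' = z + \<kappa> *\<^sub>R x)"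
proof (rule disjCI, intro ballI)
  fix y y' assume y: "y \<in> Y" "y' \<in> Y"
  assume "\<not> (\<forall>z\<in>Z. \<forall>z'\<in>Z. \<exists>\<kappa>. z' = z + \<kappa> *\<^sub>R x)"
  then obtain z z' where z: "z \<in> Z" "z' \<in> Z" and nz: "\<And>\<kappa>. z' \<noteq> z + \<kappa> *\<^sub>R x" by blast
  have d: "D x y z = \<delta>" "D x y' z = \<delta>" "D x y z' = \<delta>" "D x y' z' = \<delta>"
    using assms(1) y z by auto
  define \<eta> \<eta>' where "\<eta> = D x y y' / \<delta>" and "\<eta>' = D x z' z / \<delta>"
  have y': "y' = (D y' y z / \<delta>) *\<^sub>R x + y + \<eta> *\<^sub>R z"
    using coordinates[of x y z y'] d assms(2) by (simp add: \<eta>_def)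
  have z': "z' = (D z' y z / \<delta>) *\<^sub>R x + \<eta>' *\<^sub>R y + z"
    using coordinates[of x y z z'] d assms(2) by (simp add: \<eta>'_def)
  have "D x y' z' = D x (y + \<eta> *\<^sub>R z) (\<eta>' *\<^sub>R y + z)"
    by (subst y', subst z') (simp add: expand)
  also have "\<dots> = \<delta> - \<eta> * \<eta>' * \<delta>"
    by (simp add: expand d swap23[of x z y] algebra_simps)
  finally have "\<eta> * \<eta>' = 0" using d assms(2) by simp
  moreover have "\<eta>' \<noteq> 0" using nz[of "D z' y z / \<delta>"] z' by (auto simp: add.commute)
  ultimately have "\<eta> = 0" by simp
  then show "\<exists>\<kappa>. y' = y + \<kappa> *\<^sub>R x" using y' by (metis add.commute add_0_right scaleR_zero_left)
qed

definition flat :: "'v set \<Rightarrow> bool" where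
  "flat S \<longleftrightarrow> (\<forall>u\<in>S. \<forall>v\<in>S. \<forall>w\<in>S. D u v w = 0)"

lemma flatI:
  assumes "\<And>v. v \<in> S \<Longrightarrow> \<exists>\<alpha> \<beta>. v = \<alpha> *\<^sub>R x + \<beta> *\<^sub>R y"
  shows "flat S"
  unfolding flat_def
proof (intro ballI)
  fix u v w assume "u \<in> S" "v \<in> S" "w \<in> S"
  then obtain a b c d e f where "u = a *\<^sub>R x + b *\<^sub>R y" "v = c *\<^sub>R x + d *\<^sub>R y" "w = e *\<^sub>R x + f *\<^sub>R y"
    using assms by meson
  then show "D u v w = 0" by (simp add: expand)
qed

text \<open>By \<open>const_mod\<close> every member of \<open>X\<close> is parallel to
  \<open>y' - y\<close> or to \<open>z' - z\<close>. Two members on the line of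
  \<open>y' - y\<close> would coincide, since the common determinant fixes the scalar.\<close>

lemma triangle_aux:
  assumes D: "\<And>x y z. x \<in> X \<Longrightarrow> y \<in> Y \<Longrightarrow> z \<in> Z \<Longrightarrow> D x y z = \<delta>" and \<delta>: "\<delta> \<noteq> 0"
    and y: "y \<in> Y" "y' \<in> Y" "y \<noteq> y'" and z: "z \<in> Z" "z' \<in> Z" "z \<noteq> z'"
    and x: "x \<in> X" "x' \<in> X" "x \<noteq> x'"
  shows "\<exists>x\<in>X. \<exists>\<kappa>. x = \<kappa> *\<^sub>R (z' - z)"
proof -
  have par: "(\<exists>\<kappa>. t = \<kappa> *\<^sub>R (y' - y)) \<or> (\<exists>\<kappa>. t = \<kappa> *\<^sub>R (z' - z))" if "t \<in> X" for t
  proof -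
    have inv: "\<exists>\<kappa>. t = \<kappa> *\<^sub>R (b - a)" if "b = a + \<kappa> *\<^sub>R t" "a \<noteq> b" for \<kappa> a b
    proof -
      have "\<kappa> \<noteq> 0" using that by auto
      then have "t = (1/\<kappa>) *\<^sub>R (b - a)" using that by simp
      then show ?thesis by blast
    qed
    show ?thesis using const_mod[of Y Z t \<delta>, OF D[OF that] \<delta>] y z inv by meson
  qed
  show ?thesis
  proof (rule ccontr)
    assume "\<not> ?thesis"
    then obtain \<kappa> \<kappa>' where k: "x = \<kappa> *\<^sub>R (y' - y)" "x' = \<kappa>' *\<^sub>R (y' - y)" using par x by meson
    have "D x y z = \<kappa> * D (y' - y) y z" "D x' y z = \<kappa>' * D (y' - y) y z" using k by (simp_all add: expand)
    then have "\<kappa> = \<kappa>'" using D x y z \<delta> by (metis mult_cancel_right mult_eq_0_iff)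
    then show False using k x by simp
  qed
qed

text \<open>If every class had two different members, \<open>triangle_aux\<close> would put a member
  of \<open>X\<close> and a member of \<open>Y\<close> on one line. So some class is a single
  vector, and constancy of another class modulo that vector makes the two coplanar.\<close>

lemma triangle:
  assumes D: "\<And>x y z. x \<in> X \<Longrightarrow> y \<in> Y \<Longrightarrow> z \<in> Z \<Longrightarrow> D x y z = \<delta>" and \<delta>: "\<delta> \<noteq> 0"
    and ne: "X \<noteq> {}" "Y \<noteq> {}" "Z \<noteq> {}"
  shows "flat (X \<union> Y) \<or>
         flat (Y \<union> Z) \<or>
         flat (Z \<union> X)"
proof -
  have D1: "D y z x = \<delta>" if "y \<in> Y" "z \<in> Z" "x \<in> X" for x y z
    using D[OF that(3,1,2)] by (metis cyclic)
  have D2: "D z x y = \<delta>" if "z \<in> Z" "x \<in> X" "y \<in> Y" for x y z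
    using D[OF that(2,3,1)] by (metis cyclic)
  have flat: "flat (X \<union> Y) \<or> flat (Z \<union> X)"
    if const: "\<And>x x'. x \<in> X \<Longrightarrow> x' \<in> X \<Longrightarrow> x = x'"
      and D: "\<And>x y z. x \<in> X \<Longrightarrow> y \<in> Y \<Longrightarrow> z \<in> Z \<Longrightarrow> D x y z = \<delta>"
      and ne: "X \<noteq> {}" "Y \<noteq> {}" "Z \<noteq> {}" for X Y Z
  proof -
    obtain x where x: "X = {x}" using const ne by blast
    obtain y z where yz: "y \<in> Y" "z \<in> Z" using ne by blast
    have *: "flat S"
      if S: "S \<subseteq> insert x W" and W: "\<And>w. w \<in> W \<Longrightarrow> \<exists>\<kappa>. w = y + \<kappa> *\<^sub>R x" for S y W
    proof -
      have pl: "\<exists>\<alpha> \<beta>. v = \<alpha> *\<^sub>R x + \<beta> *\<^sub>R y" if v: "v \<in> S" for v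
      proof (cases "v = x")
        case True
        then have "v = 1 *\<^sub>R x + 0 *\<^sub>R y" by simp
        then show ?thesis by blast
      next
        case False
        then have "v \<in> W" using v S by blast
        then obtain \<kappa> where "v = y + \<kappa> *\<^sub>R x" using W by blast
        then have "v = \<kappa> *\<^sub>R x + 1 *\<^sub>R y" by simp
        then show ?thesis by blast
      qed
      show ?thesis by (rule flatI[OF pl])
    qed
    consider "\<forall>y\<in>Y. \<forall>y'\<in>Y. \<exists>\<kappa>. y' = y + \<kappa> *\<^sub>R x" | "\<forall>z\<in>Z. \<forall>z'\<in>Z. \<exists>\<kappa>. z' = z + \<kappa> *\<^sub>R x"
      using const_mod[of Y Z x \<delta>, OF D \<delta>] x by auto
    then show ?thesis
    proof cases
      case 1 then show ?thesis using *[of "X \<union> Y" Y y] x yz by simp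
    next
      case 2 then show ?thesis using *[of "Z \<union> X" Z z] x yz by simp
    qed
  qed
  show ?thesis
  proof (cases "(\<exists>x\<in>X. \<exists>x'\<in>X. x \<noteq> x') \<and> (\<exists>x\<in>Y. \<exists>x'\<in>Y. x \<noteq> x') \<and> (\<exists>x\<in>Z. \<exists>x'\<in>Z. x \<noteq> x')")
    case True
    then obtain x x' y y' z z' where xyz: "x \<in> X" "x' \<in> X" "x \<noteq> x'" "y \<in> Y" "y' \<in> Y" "y \<noteq> y'"
       "z \<in> Z" "z' \<in> Z" "z \<noteq> z'" by blast
    obtain x'' \<kappa> where x'': "x'' \<in> X" "x'' = \<kappa> *\<^sub>R (z' - z)"
      using triangle_aux[of X Y Z \<delta> y y' z z' x x'] D \<delta> xyz by blast
    \<comment> \<open>Exchanging the roles of \<open>X\<close> and \<open>Y\<close> reverses the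
      orientation.\<close>
    have m: "D y' x' z' = - \<delta>" if "y' \<in> Y" "x' \<in> X" "z' \<in> Z" for x' y' z' using D swap that by metis
    obtain y'' \<mu> where y'': "y'' \<in> Y" "y'' = \<mu> *\<^sub>R (z' - z)"
      using triangle_aux[of Y X Z "-\<delta>" x x' z z' y y'] m \<delta> xyz by auto
    have "D x'' y'' z = 0" using x'' y'' by (simp add: expand)
    then show ?thesis using D x'' y'' xyz \<delta> by metis
  next
    case False
    then consider "\<And>x x'. x \<in> X \<Longrightarrow> x' \<in> X \<Longrightarrow> x = x'" | "\<And>x x'. x \<in> Y \<Longrightarrow> x' \<in> Y \<Longrightarrow> x = x'"
      | "\<And>x x'. x \<in> Z \<Longrightarrow> x' \<in> Z \<Longrightarrow> x = x'" by metis
    then show ?thesis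
    proof cases
      case 1 show ?thesis using flat[OF 1 D ne] by blast
    next
      case 2 show ?thesis using flat[OF 2 D1 ne(2,3,1)] by blast
    next
      case 3 show ?thesis using flat[OF 3 D2 ne(3,1,2)] by blast
    qed
  qed
qed

text \<open>The triples are those whose triangle contains the centre when \<open>x\<^sub>0, \<dots>, x\<^sub>6\<close> are placed at the
  vertices of a regular heptagon; likewise for the classes of a pentagon below.\<close>

definition heptagon :: "real \<Rightarrow> 'v \<Rightarrow> 'v \<Rightarrow> 'v \<Rightarrow> 'v \<Rightarrow> 'v \<Rightarrow> 'v \<Rightarrow> 'v \<Rightarrow> bool" where
  "heptagon \<delta> x0 x1 x2 x3 x4 x5 x6 \<longleftrightarrow> \<delta> \<noteq> 0 \<and>
     D x0 x3 x4 = \<delta> \<and> D x0 x3 x5 = \<delta> \<and> D x0 x3 x6 = \<delta> \<and>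
     D x1 x3 x5 = \<delta> \<and> D x1 x3 x6 = \<delta> \<and> D x1 x4 x5 = \<delta> \<and> D x1 x4 x6 = \<delta> \<and>
     D x2 x3 x6 = \<delta> \<and> D x2 x4 x6 = \<delta> \<and> D x2 x5 x6 = \<delta> \<and>
     D x0 x1 x4 = \<delta> \<and> D x0 x2 x4 = \<delta> \<and> D x0 x2 x5 = \<delta> \<and> D x1 x2 x5 = \<delta>"

lemma heptagon_rotate:
  assumes "heptagon \<delta> x0 x1 x2 x3 x4 x5 x6" shows "heptagon \<delta> x1 x2 x3 x4 x5 x6 x0"
  using assms unfolding heptagon_def by (simp add: cyclic[of x0, symmetric])

text \<open>The reflection i -> 2 - i modulo 7 fixes the vertex of \<open>x1\<close> and reverses
  the orientation.\<close>

lemma heptagon_mirror: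
  assumes "heptagon \<delta> x0 x1 x2 x3 x4 x5 x6" shows "heptagon (-\<delta>) x2 x1 x0 x6 x5 x4 x3"
  using assms unfolding heptagon_def
  by (simp add: swap23[of _ x3 x4] swap23[of _ x3 x5] swap23[of _ x3 x6] swap23[of _ x4 x5] swap23[of _ x4 x6]
    swap23[of _ x5 x6] swap[of x0 x1] swap[of x0 x2] swap[of x1 x2])

text \<open>Seen from \<open>x1\<close>, each of \<open>x3\<close>, \<open>x4\<close> has volume
  \<open>\<delta>\<close> with each of \<open>x5\<close>, \<open>x6\<close>, so
  \<open>const_mod\<close> makes one of the two pairs differ by a multiple of \<open>x1\<close>. A
  triple with a further vertex, \<open>x0\<close> or \<open>x2\<close>, fixes the multiple as
  1.\<close>

lemma heptagon_alternative:
  assumes h: "heptagon \<delta> x0 x1 x2 x3 x4 x5 x6"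
  shows "x3 = x4 + x1 \<or> x6 = x5 + x1"
proof -
  have \<delta>: "\<delta> \<noteq> 0" using h by (simp add: heptagon_def)
  have "(\<forall>y\<in>{x3,x4}. \<forall>y'\<in>{x3,x4}. \<exists>\<kappa>. y' = y + \<kappa> *\<^sub>R x1) \<or> (\<forall>z\<in>{x5,x6}. \<forall>z'\<in>{x5,x6}. \<exists>\<kappa>. z' = z + \<kappa> *\<^sub>R x1)"
    by (rule const_mod[OF _ \<delta>]) (use h in \<open>auto simp: heptagon_def\<close>)
  then consider \<mu> where "x3 = x4 + \<mu> *\<^sub>R x1" | \<mu> where "x6 = x5 + \<mu> *\<^sub>R x1" by blast
  then show ?thesis
  proof cases
    case 1
    then have "D x0 x3 x4 = \<mu> * D x0 x1 x4" by (simp add: expand)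
    moreover have "D x0 x3 x4 = \<delta>" "D x0 x1 x4 = \<delta>" using h by (simp_all add: heptagon_def)
    ultimately have "\<mu> = 1" using \<delta> by simp
    then show ?thesis using 1 by simp
  next
    case 2
    then have "D x2 x5 x6 = \<mu> * D x2 x5 x1" by (simp add: expand)
    moreover have "D x2 x5 x6 = \<delta>" "D x2 x5 x1 = \<delta>"
      using h cyclic[of x1 x2 x5] by (simp_all add: heptagon_def)
    ultimately have "\<mu> = 1" using \<delta> by simp
    then show ?thesis using 2 by simp
  qed
qed

text \<open>Subtracting two triples that share \<open>x2\<close> and \<open>x6\<close> puts
  \<open>x1\<close> into their plane, and two more determinants fix both coefficients as 1. The
  conclusion is the hypothesis rotated by five places, so the step can be iterated.\<close>

lemma heptagon_step:
  assumes h: "heptagon \<delta> x0 x1 x2 x3 x4 x5 x6" and eq: "x3 = x4 + x1"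
  shows "x1 = x2 + x6"
proof -
  have \<delta>: "\<delta> \<noteq> 0" using h by (simp add: heptagon_def)
  have "D x2 x1 x6 = D x2 x3 x6 - D x2 x4 x6" using eq by (simp add: expand)
  then have 0: "D x2 x1 x6 = 0" using h by (simp add: heptagon_def)
  have x1: "x1 = x2 + (D x2 x3 x1 / \<delta>) *\<^sub>R x6"
    using coordinates[of x2 x3 x6 x1] 0 h \<delta> by (simp add: heptagon_def)
  have "D x1 x2 x5 = (D x2 x3 x1 / \<delta>) * D x6 x2 x5"
    using arg_cong[OF x1, of "\<lambda>x. D x x2 x5"] by (simp add: expand)
  moreover have "D x6 x2 x5 = \<delta>" using h cyclic[of x6 x2 x5] by (simp add: heptagon_def)
  moreover have "D x1 x2 x5 = \<delta>" using h by (simp add: heptagon_def)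
  ultimately have "D x2 x3 x1 / \<delta> = 1" using \<delta> by (metis mult_cancel_right2)
  then show ?thesis using x1 by simp
qed

text \<open>Since 5 is prime to 7, iterating \<open>heptagon_step\<close> yields all seven rotations
  of the decomposition. In their total every vector occurs once as a sum and twice as a summand,
  which a strictly positive functional forbids.\<close>

lemma heptagon_no_left:
  assumes h: "heptagon \<delta> x0 x1 x2 x3 x4 x5 x6" and eq: "x3 = x4 + x1"
    and lin: "linear f" and pos: "f x0 > 0" "f x1 > 0" "f x2 > 0" "f x3 > 0" "f x4 > 0" "f x5 > (0::real)" "f x6 > 0"
  shows False
proof -
  note r = heptagon_rotate
  have h1: "heptagon \<delta> x5 x6 x0 x1 x2 x3 x4" using h r by meson
  have h2: "heptagon \<delta> x3 x4 x5 x6 x0 x1 x2" using h1 r by meson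
  have h3: "heptagon \<delta> x1 x2 x3 x4 x5 x6 x0" using h2 r by meson
  have h4: "heptagon \<delta> x6 x0 x1 x2 x3 x4 x5" using h3 r by meson
  have h5: "heptagon \<delta> x4 x5 x6 x0 x1 x2 x3" using h4 r by meson
  note e1 = heptagon_step[OF h eq]
  note e2 = heptagon_step[OF h1 e1]
  note e3 = heptagon_step[OF h2 e2]
  note e4 = heptagon_step[OF h3 e3]
  note e5 = heptagon_step[OF h4 e4]
  note e6 = heptagon_step[OF h5 e5]
  have "f x3 = f x4 + f x1" "f x1 = f x2 + f x6" "f x6 = f x0 + f x4" "f x4 = f x5 + f x2"
    "f x2 = f x3 + f x0" "f x0 = f x1 + f x5" "f x5 = f x6 + f x3"
    using linear_add[OF lin] eq e1 e2 e3 e4 e5 e6 by metis+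
  then show False using pos by linarith
qed

lemma no_heptagon:
  assumes h: "heptagon \<delta> x0 x1 x2 x3 x4 x5 x6"
    and lin: "linear f" and pos: "f x0 > 0" "f x1 > 0" "f x2 > 0" "f x3 > 0" "f x4 > 0" "f x5 > (0::real)" "f x6 > 0"
  shows False
  using heptagon_alternative[OF h] heptagon_no_left[OF h _ lin pos]
    heptagon_no_left[OF heptagon_mirror[OF h] _ lin pos(3,2,1,7,6,5,4)] by blast

lemma flat_triple:
  assumes "D u v w = 0"
  shows "flat {u, v, w}"
proof -
  have "D v w u = 0" "D w u v = 0" using assms by (metis cyclic)+
  moreover have "D v u w = 0" "D u w v = 0" "D w v u = 0" using assms calculation swap by (metis neg_equal_0_iff_equal)+
  ultimately show ?thesis using assms by (simp add: flat_def rep)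
qed

section \<open>Five classes of vectors arranged like a pentagon\<close>

definition pentagon :: "real \<Rightarrow> 'v set \<Rightarrow> 'v set \<Rightarrow> 'v set \<Rightarrow> 'v set \<Rightarrow> 'v set \<Rightarrow> bool" where
  "pentagon \<delta> X0 X1 X2 X3 X4 \<longleftrightarrow> \<delta> \<noteq> 0 \<and>
     X0 \<noteq> {} \<and> X1 \<noteq> {} \<and> X2 \<noteq> {} \<and> X3 \<noteq> {} \<and> X4 \<noteq> {} \<and>
     (\<forall>x0\<in>X0. \<forall>x1\<in>X1. \<forall>x3\<in>X3. D x0 x1 x3 = \<delta>) \<and>
     (\<forall>x1\<in>X1. \<forall>x2\<in>X2. \<forall>x4\<in>X4. D x1 x2 x4 = \<delta>) \<and>
     (\<forall>x0\<in>X0. \<forall>x2\<in>X2. \<forall>x3\<in>X3. D x0 x2 x3 = \<delta>) \<and>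
     (\<forall>x1\<in>X1. \<forall>x3\<in>X3. \<forall>x4\<in>X4. D x1 x3 x4 = \<delta>) \<and>
     (\<forall>x0\<in>X0. \<forall>x2\<in>X2. \<forall>x4\<in>X4. D x0 x2 x4 = \<delta>)"

definition some_consecutive_flat :: "'v set \<Rightarrow> 'v set \<Rightarrow> 'v set \<Rightarrow> 'v set \<Rightarrow> 'v set \<Rightarrow> bool" where
  "some_consecutive_flat X0 X1 X2 X3 X4 \<longleftrightarrow>
     flat (X0 \<union> X1 \<union> X2) \<or> flat (X1 \<union> X2 \<union> X3) \<or> flat (X2 \<union> X3 \<union> X4) \<or> flat (X3 \<union> X4 \<union> X0) \<or> flat (X4 \<union> X0 \<union> X1)"

lemma pentagon_rotate:
  assumes "pentagon \<delta> X0 X1 X2 X3 X4" shows "pentagon \<delta> X1 X2 X3 X4 X0"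
proof -
  have "D y z x = \<delta>" if "D x y z = \<delta>" for x y z
    using that by (metis cyclic)
  with assms show ?thesis unfolding pentagon_def by blast
qed

lemma pentagon_mirror:
  assumes "pentagon \<delta> X0 X1 X2 X3 X4" shows "pentagon (-\<delta>) X0 X4 X3 X2 X1"
proof -
  have reverse: "D z y x = - D x y z" for x y z
    using cyclic[of x y z] swap[of z y x] by simp
  note p = assms[unfolded pentagon_def]
  have "D x0 x4 x2 = - \<delta>" if "x0 \<in> X0" "x4 \<in> X4" "x2 \<in> X2" for x0 x4 x2
    using p that swap23[of x0 x2 x4] by simp
  moreover have "D x4 x3 x1 = - \<delta>" if "x4 \<in> X4" "x3 \<in> X3" "x1 \<in> X1" for x4 x3 x1
    using p that reverse[of x1 x3 x4] by simp
  moreover have "D x0 x3 x2 = - \<delta>" if "x0 \<in> X0" "x3 \<in> X3" "x2 \<in> X2" for x0 x3 x2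
    using p that swap23[of x0 x2 x3] by simp
  moreover have "D x4 x2 x1 = - \<delta>" if "x4 \<in> X4" "x2 \<in> X2" "x1 \<in> X1" for x4 x2 x1
    using p that reverse[of x1 x2 x4] by simp
  moreover have "D x0 x3 x1 = - \<delta>" if "x0 \<in> X0" "x3 \<in> X3" "x1 \<in> X1" for x0 x3 x1
    using p that swap23[of x0 x1 x3] by simp
  moreover have "- \<delta> \<noteq> 0" using p by simp
  ultimately show ?thesis using p unfolding pentagon_def by simp
qed

lemma some_consecutive_flat_rotate:
  "some_consecutive_flat X1 X2 X3 X4 X0 = some_consecutive_flat X0 X1 X2 X3 X4"
  unfolding some_consecutive_flat_def by satx

text \<open>\<open>const_mod\<close> compares \<open>X2\<close> with the union of \<open>X3\<close>
  and \<open>X4\<close>. If the union is the constant side, a triple with a vertex in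
  \<open>X1\<close> shows that the multiple of \<open>a\<close> between \<open>X3\<close> and
  \<open>X4\<close> is 1.\<close>

lemma pentagon_alternative:
  assumes p: "pentagon \<delta> X0 X1 X2 X3 X4" and a: "a \<in> X0"
  shows "(\<forall>y\<in>X2. \<forall>y'\<in>X2. \<exists>\<kappa>. y' = y + \<kappa> *\<^sub>R a) \<or> (\<forall>y\<in>X3. \<forall>y'\<in>X4. y' = y + a)"
proof (rule disjCI)
  assume "\<not> (\<forall>y\<in>X3. \<forall>y'\<in>X4. y' = y + a)"
  then obtain y y' where y: "y \<in> X3" "y' \<in> X4" "y' \<noteq> y + a" by blast
  obtain b where b: "b \<in> X1" using p by (auto simp: pentagon_def)
  have \<delta>: "\<delta> \<noteq> 0" using p by (simp add: pentagon_def)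
  have "D a u v = \<delta>" if "u \<in> X2" "v \<in> X3 \<union> X4" for u v
    using p a that unfolding pentagon_def by blast
  from const_mod[of X2 "X3 \<union> X4" a \<delta>, OF this \<delta>]
  consider "\<forall>y\<in>X2. \<forall>y'\<in>X2. \<exists>\<kappa>. y' = y + \<kappa> *\<^sub>R a"
    | "\<forall>y\<in>X3 \<union> X4. \<forall>y'\<in>X3 \<union> X4. \<exists>\<kappa>. y' = y + \<kappa> *\<^sub>R a" by blast
  then show "\<forall>y\<in>X2. \<forall>y'\<in>X2. \<exists>\<kappa>. y' = y + \<kappa> *\<^sub>R a"
  proof cases
    case 2
    then obtain \<kappa> where \<kappa>: "y' = y + \<kappa> *\<^sub>R a" using y by blast
    have "D b y y' = \<kappa> * D a b y" using \<kappa> by (simp add: expand cyclic[of a b y, symmetric] cyclic[of b y a])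
    moreover have "D b y y' = \<delta>" "D a b y = \<delta>" using p a b y unfolding pentagon_def by blast+
    ultimately have "\<kappa> = 1" using \<delta> by simp
    then show ?thesis using \<kappa> y by simp
  qed
qed

lemma pentagon_alternative':
  assumes p: "pentagon \<delta> X0 X1 X2 X3 X4" and a: "a \<in> X0"
  shows "(\<forall>y\<in>X3. \<forall>y'\<in>X3. \<exists>\<kappa>. y' = y + \<kappa> *\<^sub>R a) \<or> (\<forall>y\<in>X2. \<forall>y'\<in>X1. y' = y + a)"
  using pentagon_alternative[OF pentagon_mirror[OF p] a] .

text \<open>The hypothesis makes \<open>X2\<close> and \<open>X1\<close> single vectors u and u + a.
  If \<open>X0\<close> is single as well, these three classes are coplanar. Otherwise two members of
  \<open>X0\<close> differ in the direction of \<open>y\<close> from \<open>X3\<close>, so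
  \<open>X0\<close> is not constant modulo u, and the dichotomy seen from u makes \<open>X4\<close>
  and \<open>X3\<close> single vectors w and w + u.\<close>

lemma pentagon_sum_flat:
  assumes p: "pentagon \<delta> X0 X1 X2 X3 X4" and a: "a \<in> X0" and sum: "\<forall>y\<in>X2. \<forall>y'\<in>X1. y' = y + a"
  shows "flat (X0 \<union> X1 \<union> X2) \<or> flat (X2 \<union> X3 \<union> X4)"
proof -
  obtain u u' y where u: "u \<in> X2" "u' \<in> X1" "y \<in> X3" using p by (auto simp: pentagon_def)
  have \<delta>: "\<delta> \<noteq> 0" using p by (simp add: pentagon_def)
  have X1: "v = u + a" if "v \<in> X1" for v using sum that u by blast
  have X2: "v = u" if "v \<in> X2" for v using sum that u by (metis add_right_cancel)
  have au: "D a u y = \<delta>" using p a u unfolding pentagon_def by blast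
  have X0: "\<exists>\<kappa>. a' = a + \<kappa> *\<^sub>R y" if a': "a' \<in> X0" for a'
  proof -
    have "D a' u y = \<delta>" "D a' u' y = \<delta>" using p a' u unfolding pentagon_def by blast+
    moreover have "D a' u' y = D a' u y + D a' a y" using X1[OF u(2)] by (simp add: expand)
    ultimately have "D a a' y = 0" "D a' u y = \<delta>" using swap[of a a' y] by auto
    then have "a' = a + (D a u a' / \<delta>) *\<^sub>R y" using coordinates[of a u y a'] au \<delta> by simp
    then show ?thesis by blast
  qed
  show ?thesis
  proof (cases "X0 \<subseteq> {a}")
    case True
    have "flat (X0 \<union> X1 \<union> X2)"
    proof (rule flatI)
      fix v assume "v \<in> X0 \<union> X1 \<union> X2"
      then consider "v = 0 *\<^sub>R u + 1 *\<^sub>R a" | "v = 1 *\<^sub>R u + 1 *\<^sub>R a" | "v = 1 *\<^sub>R u + 0 *\<^sub>R a"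
        using True X1 X2 by fastforce
      then show "\<exists>\<alpha> \<beta>. v = \<alpha> *\<^sub>R u + \<beta> *\<^sub>R a" by cases blast+
    qed
    then show ?thesis ..
  next
    case False
    then obtain a' \<kappa> where a': "a' \<in> X0" "a' \<noteq> a" "a' = a + \<kappa> *\<^sub>R y" using X0 by blast
    have "pentagon \<delta> X2 X3 X4 X0 X1" using p pentagon_rotate by blast
    from pentagon_alternative'[OF this u(1)] have "\<forall>w\<in>X4. \<forall>w'\<in>X3. w' = w + u"
    proof
      assume "\<forall>z\<in>X0. \<forall>z'\<in>X0. \<exists>\<kappa>. z' = z + \<kappa> *\<^sub>R u"
      then obtain \<kappa>' where "a' = a + \<kappa>' *\<^sub>R u" using a a' by blast
      then have "\<kappa> *\<^sub>R y = \<kappa>' *\<^sub>R u" using a' by simp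
      then have "D a u (\<kappa> *\<^sub>R y) = D a u (\<kappa>' *\<^sub>R u)" by simp
      then have "\<kappa> = 0" using au \<delta> by (simp add: expand)
      then show ?thesis using a' by simp
    qed
    moreover obtain w where w: "w \<in> X4" using p by (auto simp: pentagon_def)
    ultimately have 34: "v = w + u" if "v \<in> X3" for v using that by blast
    have 4: "v = w" if "v \<in> X4" for v
      using \<open>\<forall>w\<in>X4. \<forall>w'\<in>X3. w' = w + u\<close> w u that by (metis add_right_cancel)
    have "flat (X2 \<union> X3 \<union> X4)"
    proof (rule flatI)
      fix v assume "v \<in> X2 \<union> X3 \<union> X4"
      then consider "v = 0 *\<^sub>R w + 1 *\<^sub>R u" | "v = 1 *\<^sub>R w + 1 *\<^sub>R u" | "v = 1 *\<^sub>R w + 0 *\<^sub>R u"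
        using 34 4 X2 by fastforce
      then show "\<exists>\<alpha> \<beta>. v = \<alpha> *\<^sub>R w + \<beta> *\<^sub>R u" by cases blast+
    qed
    then show ?thesis ..
  qed
qed

lemma pentagon_const_mod:
  assumes p: "pentagon \<delta> X0 X1 X2 X3 X4" and nf: "\<not> some_consecutive_flat X0 X1 X2 X3 X4" and a: "a \<in> X0"
  shows "(\<forall>y\<in>X2. \<forall>y'\<in>X2. \<exists>\<kappa>. y' = y + \<kappa> *\<^sub>R a) \<and> (\<forall>y\<in>X3. \<forall>y'\<in>X3. \<exists>\<kappa>. y' = y + \<kappa> *\<^sub>R a)"
proof -
  have "\<not> flat (X0 \<union> X1 \<union> X2) \<and> \<not> flat (X2 \<union> X3 \<union> X4)"
    "\<not> flat (X0 \<union> X4 \<union> X3) \<and> \<not> flat (X3 \<union> X2 \<union> X1)"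
    using nf unfolding some_consecutive_flat_def by (auto simp: Un_ac)
  then show ?thesis
    using pentagon_alternative[OF p a] pentagon_alternative'[OF p a] pentagon_sum_flat[OF p a]
      pentagon_sum_flat[OF pentagon_mirror[OF p] a] by satx
qed

text \<open>\<open>X2\<close> is constant modulo a vector of \<open>X0\<close> and also modulo one
  of \<open>X4\<close>, and these two directions are independent.\<close>

lemma pentagon_const:
  assumes p: "pentagon \<delta> X0 X1 X2 X3 X4" and nf: "\<not> some_consecutive_flat X0 X1 X2 X3 X4"
  shows "\<exists>x. X2 = {x}"
proof -
  have "y' = y" if y: "y \<in> X2" "y' \<in> X2" for y y'
  proof -
    obtain a b where ab: "a \<in> X0" "b \<in> X4" using p by (auto simp: pentagon_def)
    have p4: "pentagon \<delta> X4 X0 X1 X2 X3" using p pentagon_rotate by blast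
    have nf4: "\<not> some_consecutive_flat X4 X0 X1 X2 X3" using nf some_consecutive_flat_rotate by metis
    obtain \<kappa> where \<kappa>: "y' = y + \<kappa> *\<^sub>R a" using pentagon_const_mod[OF p nf ab(1)] y by blast
    obtain \<kappa>' where \<kappa>': "y' = y + \<kappa>' *\<^sub>R b" using pentagon_const_mod[OF p4 nf4 ab(2)] y by blast
    have "D (\<kappa> *\<^sub>R a) y b = D (\<kappa>' *\<^sub>R b) y b" using \<kappa> \<kappa>' by simp
    moreover have "D a y b = \<delta>" "\<delta> \<noteq> 0" using p ab y unfolding pentagon_def by blast+
    ultimately have "\<kappa> = 0" by (simp add: expand)
    then show ?thesis using \<kappa> by simp
  qed
  moreover obtain x where "x \<in> X2" using p by (auto simp: pentagon_def)
  ultimately show ?thesis by blast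
qed

text \<open>Expand \<open>x1\<close> in the basis \<open>x0\<close>, \<open>x2\<close>,
  \<open>x3\<close> and take the determinant with \<open>x2\<close>, \<open>x4\<close>. After
  changing all signs this is the pentagon recurrence, in which the product of the two neighbours of
  an entry is one more than the entry.\<close>

lemma pentagon_relation:
  assumes "pentagon \<delta> {x0} {x1} {x2} {x3} {x4}"
  shows "D x1 x2 x3 / \<delta> = 1 - (D x0 x1 x2 / \<delta>) * (D x2 x3 x4 / \<delta>)"
proof -
  have d: "\<delta> \<noteq> 0" "D x0 x1 x3 = \<delta>" "D x1 x2 x4 = \<delta>" "D x0 x2 x3 = \<delta>" "D x0 x2 x4 = \<delta>"
    using assms unfolding pentagon_def by auto
  have "x1 = (D x1 x2 x3 / \<delta>) *\<^sub>R x0 + x2 - (D x0 x1 x2 / \<delta>) *\<^sub>R x3"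
    using coordinates[of x0 x2 x3 x1] d by (simp add: swap23[of x0 x1 x2])
  from arg_cong[OF this, of "\<lambda>x. D x x2 x4"]
  have "\<delta> = (D x1 x2 x3 / \<delta>) * \<delta> + (D x0 x1 x2 / \<delta>) * D x2 x3 x4"
    using d by (simp add: expand swap[of x2 x3 x4])
  moreover have "p / d = 1 - (c / d) * (s / d)" if "d = p / d * d + c / d * s" "d \<noteq> 0" for p c s d :: real
  proof -
    have "c / d * s = d - p" using that by simp
    then have "(c / d) * (s / d) = (d - p) / d" by (metis times_divide_eq_right)
    then show ?thesis using that(2) by (simp add: diff_divide_distrib)
  qed
  ultimately show ?thesis using d(1) by blast
qed

text \<open>The input for \<open>cyclic_sign_pattern\<close>: integrality will come from smoothness,
  positivity from \<open>separation\<close>.\<close>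

definition admissible :: "real \<Rightarrow> 'v \<Rightarrow> 'v \<Rightarrow> 'v \<Rightarrow> 'v \<Rightarrow> bool" where
  "admissible \<delta> x1 x2 x3 x4 \<longleftrightarrow> D x1 x2 x3 / \<delta> \<in> \<int> \<and> (D x1 x2 x3 / \<delta> > 0 \<or> D x2 x3 x4 / \<delta> > 0)"

lemma pentagon_flat:
  assumes p: "pentagon \<delta> X0 X1 X2 X3 X4"
    and adm: "\<And>x0 x1 x2 x3 x4. x0 \<in> X0 \<Longrightarrow> x1 \<in> X1 \<Longrightarrow> x2 \<in> X2 \<Longrightarrow> x3 \<in> X3 \<Longrightarrow> x4 \<in> X4 \<Longrightarrow>
       admissible \<delta> x0 x1 x2 x3 \<and> admissible \<delta> x1 x2 x3 x4 \<and> admissible \<delta> x2 x3 x4 x0 \<and>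
       admissible \<delta> x3 x4 x0 x1 \<and> admissible \<delta> x4 x0 x1 x2"
  shows "some_consecutive_flat X0 X1 X2 X3 X4"
proof (rule ccontr)
  assume nf: "\<not> ?thesis"
  have p1: "pentagon \<delta> X1 X2 X3 X4 X0" and p2: "pentagon \<delta> X2 X3 X4 X0 X1" and p3: "pentagon \<delta> X3 X4 X0 X1 X2"
    and p4: "pentagon \<delta> X4 X0 X1 X2 X3" using p pentagon_rotate by blast+
  obtain x0 x1 x2 x3 x4 where x: "X0 = {x0}" "X1 = {x1}" "X2 = {x2}" "X3 = {x3}" "X4 = {x4}"
    using pentagon_const[OF p nf] pentagon_const[OF p1] pentagon_const[OF p2] pentagon_const[OF p3]
      pentagon_const[OF p4] nf some_consecutive_flat_rotate by metis
  note r = pentagon_relation[OF p[unfolded x]] pentagon_relation[OF p1[unfolded x]]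
    pentagon_relation[OF p2[unfolded x]] pentagon_relation[OF p3[unfolded x]] pentagon_relation[OF p4[unfolded x]]
  obtain c0 c1 c2 c3 c4 :: int where c: "D x0 x1 x2 / \<delta> = of_int c0" "D x1 x2 x3 / \<delta> = of_int c1"
    "D x2 x3 x4 / \<delta> = of_int c2" "D x3 x4 x0 / \<delta> = of_int c3" "D x4 x0 x1 / \<delta> = of_int c4"
    using adm[of x0 x1 x2 x3 x4] x unfolding admissible_def Ints_def by auto
  have e: "of_int c1 = (of_int (1 - c0 * c2) :: real)" "of_int c2 = (of_int (1 - c1 * c3) :: real)"
     "of_int c3 = (of_int (1 - c2 * c4) :: real)" "of_int c4 = (of_int (1 - c3 * c0) :: real)"
     "of_int c0 = (of_int (1 - c4 * c1) :: real)"
    using r unfolding c of_int_diff of_int_mult of_int_1 by blast+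
  have "c0 = 0 \<or> c1 = 0 \<or> c2 = 0 \<or> c3 = 0 \<or> c4 = 0"
  proof (rule cyclic_sign_pattern)
    show "c0 = 1 - c4 * c1" "c1 = 1 - c0 * c2" "c2 = 1 - c1 * c3" "c3 = 1 - c2 * c4" "c4 = 1 - c3 * c0"
      using e unfolding of_int_eq_iff by blast+
    show "c0 > 0 \<or> c1 > 0" "c1 > 0 \<or> c2 > 0" "c2 > 0 \<or> c3 > 0" "c3 > 0 \<or> c4 > 0" "c4 > 0 \<or> c0 > 0"
      using adm[of x0 x1 x2 x3 x4] x unfolding admissible_def c by auto
  qed
  moreover have "\<delta> \<noteq> 0" using p by (simp add: pentagon_def)
  ultimately have "D x0 x1 x2 = 0 \<or> D x1 x2 x3 = 0 \<or> D x2 x3 x4 = 0 \<or> D x3 x4 x0 = 0 \<or> D x4 x0 x1 = 0"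
    using c by (metis divide_eq_0_iff of_int_0)
  moreover have "{u} \<union> {v} \<union> {w} = {u, v, w}" for u v w :: 'v by blast
  ultimately have "some_consecutive_flat X0 X1 X2 X3 X4"
    unfolding some_consecutive_flat_def x using flat_triple by metis
  then show False using nf by simp
qed

end

section \<open>Complements of maximal cones in the Gale dual\<close>

text \<open>The axioms \<open>flip\<close> and \<open>wall\<close> express that walls separate two maximal cones and that the two generators
  opposite to a wall have their sum in its span. \<open>separation\<close> is dual to the uniqueness of the cone containing
  a given point in its relative interior.\<close>

locale bunch =
  fixes E :: "'a set" and q :: "'a \<Rightarrow> 'v::euclidean_space" and B :: "'a set set"
  assumes finite_E: "finite E" and B_nonempty: "B \<noteq> {}" and B_subset: "T \<in> B \<Longrightarrow> T \<subseteq> E"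
    and card_B: "T \<in> B \<Longrightarrow> card T = DIM('v)"
    and indep: "T \<in> B \<Longrightarrow> (\<Sum>t\<in>T. c t *\<^sub>R q t) = 0 \<Longrightarrow> t \<in> T \<Longrightarrow> c t = 0"
    and flip: "T \<in> B \<Longrightarrow> i \<in> E \<Longrightarrow> i \<notin> T \<Longrightarrow> \<exists>t\<in>T. insert i (T - {t}) \<in> B"
    and wall: "T \<in> B \<Longrightarrow> t \<in> T \<Longrightarrow> i \<notin> T \<Longrightarrow> insert i (T - {t}) \<in> B \<Longrightarrow> q i - q t \<in> span (q ` (T - {t}))"
    and integral: "T \<in> B \<Longrightarrow> i \<in> E \<Longrightarrow> \<exists>c. (\<forall>t\<in>T. c t \<in> \<int>) \<and> q i = (\<Sum>t\<in>T. c t *\<^sub>R q t)"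
    and separation: "T \<in> B \<Longrightarrow> T' \<in> B \<Longrightarrow> linear f \<Longrightarrow> (\<And>t. t \<in> T \<Longrightarrow> f (q t) \<le> 0) \<Longrightarrow>
      (\<And>t. t \<in> T' \<Longrightarrow> f (q t) \<ge> (0::real)) \<Longrightarrow> f x = 0"
    and pointed: "\<exists>h. linear h \<and> (\<forall>j\<in>E. h (q j) > (0::real))"
begin

text \<open>Minimality is recorded by witnesses: a \<open>T\<close> meeting \<open>P\<close> only in
  \<open>a\<close> is the complement of a maximal cone that contains all other rays of
  \<open>P\<close>.\<close>

definition primitive :: "'a set \<Rightarrow> bool" where
  "primitive P \<longleftrightarrow> P \<subseteq> E \<and> (\<forall>T\<in>B. T \<inter> P \<noteq> {}) \<and> (\<forall>a\<in>P. \<exists>T\<in>B. T \<inter> P = {a})"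

text \<open>\<open>E\<close> itself meets every \<open>T\<close>, and a set of least cardinality
  with this property has the required witnesses.\<close>

lemma ex_primitive: "\<exists>P. primitive P"
proof -
  define hit where "hit P \<longleftrightarrow> P \<subseteq> E \<and> (\<forall>T\<in>B. T \<inter> P \<noteq> {})" for P
  have "T \<inter> E \<noteq> {}" if "T \<in> B" for T
    using card_B[OF that] B_subset[OF that] DIM_positive[where 'a='v] by (metis card.empty inf.absorb1 less_irrefl)
  then have "hit E" by (simp add: hit_def)
  then obtain P where P: "hit P" and min: "\<And>Q. hit Q \<Longrightarrow> card P \<le> card Q"
    using ex_has_least_nat[of hit E card] by blast
  have finP: "finite P" using P finite_E finite_subset by (auto simp: hit_def)
  have "\<exists>T\<in>B. T \<inter> P = {a}" if "a \<in> P" for a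
  proof -
    have "\<not> hit (P - {a})" using min[of "P - {a}"] finP that by (metis card_Diff1_less not_le)
    then obtain T where "T \<in> B" "T \<inter> (P - {a}) = {}" using P by (auto simp: hit_def)
    moreover have "T \<inter> P \<noteq> {}" using P calculation by (auto simp: hit_def)
    ultimately have "T \<inter> P = {a}" by blast
    then show ?thesis using \<open>T \<in> B\<close> by blast
  qed
  then show ?thesis using P by (auto simp: primitive_def hit_def)
qed

lemma finite_B: "T \<in> B \<Longrightarrow> finite T"
  using B_subset finite_E finite_subset by blast

text \<open>The nef cone is the intersection of the cones over the classes in \<open>T\<close>,
  taken over all \<open>T\<close> in \<open>B\<close>; the condition says that the class of
  \<open>j\<close> belongs to it.\<close>

definition in_all_cones :: "'a \<Rightarrow> bool" where
  "in_all_cones j \<longleftrightarrow> (\<forall>T\<in>B. \<exists>x. (\<forall>t\<in>T. x t \<ge> (0::real)) \<and> q j = (\<Sum>t\<in>T. x t *\<^sub>R q t))"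

lemma in_all_conesI:
  assumes "\<And>T. T \<in> B \<Longrightarrow> (\<exists>t\<in>T. q j = q t) \<or> (\<exists>t\<in>T. \<exists>t'\<in>T. t \<noteq> t' \<and> q j = q t + q t')"
  shows "in_all_cones j"
  unfolding in_all_cones_def
proof
  fix T assume T: "T \<in> B"
  have fin: "finite T" using finite_B T .
  consider t where "t \<in> T" "q j = q t" | t t' where "t \<in> T" "t' \<in> T" "t \<noteq> t'" "q j = q t + q t'"
    using assms[OF T] by blast
  then show "\<exists>x. (\<forall>t\<in>T. x t \<ge> (0::real)) \<and> q j = (\<Sum>t\<in>T. x t *\<^sub>R q t)"
  proof cases
    case (1 t)
    then have "q j = (\<Sum>s\<in>T. (if s = t then 1 else 0) *\<^sub>R q s)"
      using fin by (simp add: if_distrib[of "\<lambda>c. c *\<^sub>R _"] cong: if_cong)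
    then show ?thesis by (intro exI[of _ "\<lambda>s. if s = t then 1 else 0"]) simp
  next
    case (2 t t')
    then have "q j = (\<Sum>s\<in>T. (if s = t then 1 else 0) *\<^sub>R q s) + (\<Sum>s\<in>T. (if s = t' then 1 else 0) *\<^sub>R q s)"
      using fin by (simp add: if_distrib[of "\<lambda>c. c *\<^sub>R _"] cong: if_cong)
    then have "q j = (\<Sum>s\<in>T. ((if s = t then 1 else 0) + (if s = t' then 1 else 0)) *\<^sub>R q s)"
      by (simp only: scaleR_add_left sum.distrib)
    then show ?thesis by (intro exI[of _ "\<lambda>s. (if s = t then 1 else 0) + (if s = t' then 1 else 0)"]) simp
  qed
qed

end

section \<open>Picard number three: the cuts seen from a primitive collection\<close>

locale bunch3 = bunch E q B + volume_form D
  for E :: "'a set" and q :: "'a \<Rightarrow> 'v::euclidean_space" and B and D :: "'v \<Rightarrow> 'v \<Rightarrow> 'v \<Rightarrow> real" +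
  assumes dim3: "DIM('v) = 3" and nondegenerate: "\<exists>x y z. D x y z \<noteq> 0"
begin

abbreviation d :: "'a \<Rightarrow> 'a \<Rightarrow> 'a \<Rightarrow> real" where
  "d i j k \<equiv> D (q i) (q j) (q k)"

lemma triple:
  assumes "T \<in> B" obtains i j k where "T = {i, j, k}" "i \<noteq> j" "i \<noteq> k" "j \<noteq> k"
  using card_B[OF assms] that unfolding dim3 card_3_iff by blast

lemma triple_with:
  assumes "T \<in> B" "i \<in> T" obtains j k where "T = {i, j, k}" "i \<noteq> j" "i \<noteq> k" "j \<noteq> k"
proof -
  obtain a b c where "T = {a, b, c}" "a \<noteq> b" "a \<noteq> c" "b \<noteq> c" using assms(1) by (rule triple)
  then show ?thesis using assms(2) that by (metis (no_types, lifting) insert_commute insert_iff singletonD)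
qed

lemma triple_with2:
  assumes "T \<in> B" "i \<in> T" "j \<in> T" "i \<noteq> j" obtains k where "T = {i, j, k}" "i \<noteq> k" "j \<noteq> k"
proof -
  obtain b c where "T = {i, b, c}" "i \<noteq> b" "i \<noteq> c" "b \<noteq> c" using assms(1,2) by (rule triple_with)
  then show ?thesis using assms(3,4) that by (metis insert_commute insert_iff singletonD)
qed

lemma distinct:
  assumes "{i, j, k} \<in> B" shows "i \<noteq> j" "i \<noteq> k" "j \<noteq> k"
proof -
  have "card {i, j, k} = 3" using card_B[OF assms] dim3 by simp
  then show "i \<noteq> j" "i \<noteq> k" "j \<noteq> k" by (auto simp: card_insert_if split: if_splits)
qed

lemma perm: assumes "{i, j, k} \<in> B"
  shows "{j, i, k} \<in> B" "{i, k, j} \<in> B" "{k, j, i} \<in> B" "{j, k, i} \<in> B" "{k, i, j} \<in> B"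
  using assms by (simp_all add: insert_commute)

lemma nonzero: assumes "{i, j, k} \<in> B" shows "d i j k \<noteq> 0"
proof
  assume "d i j k = 0"
  moreover obtain x y z where "D x y z \<noteq> 0" using nondegenerate by blast
  ultimately obtain a b c where 0: "a *\<^sub>R q i + b *\<^sub>R q j + c *\<^sub>R q k = 0" and nz: "a \<noteq> 0 \<or> b \<noteq> 0 \<or> c \<noteq> 0"
    by (rule degenerate_imp_dependent)
  note ds = distinct[OF assms]
  let ?c = "\<lambda>t. if t = i then a else if t = j then b else c"
  have "(\<Sum>t\<in>{i, j, k}. ?c t *\<^sub>R q t) = 0" using 0 ds by (simp add: add.assoc)
  from indep[OF assms this] have "?c i = 0" "?c j = 0" "?c k = 0" by blast+
  then show False using nz ds by auto
qed

text \<open>By \<open>wall\<close> the classes \<open>q i\<close> and \<open>q i'\<close> differ by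
  a vector in the plane of \<open>q j\<close> and \<open>q k\<close>.\<close>

lemma exchange:
  assumes "{i, j, k} \<in> B" "{i', j, k} \<in> B" shows "d i j k = d i' j k"
proof (cases "i = i'")
  case False
  note ds = distinct[OF assms(1)] distinct[OF assms(2)]
  have eq: "{i, j, k} - {i} = {j, k}" using ds by auto
  have "q i' - q i \<in> span (q ` ({i, j, k} - {i}))"
    by (rule wall) (use assms ds False in \<open>auto simp: eq\<close>)
  then have "q i' - q i \<in> span {q j, q k}" unfolding eq by simp
  then obtain \<alpha> where "q i' - q i - \<alpha> *\<^sub>R q j \<in> span {q k}" by (auto simp: span_breakdown_eq)
  then obtain \<beta> where "q i' - q i - \<alpha> *\<^sub>R q j = \<beta> *\<^sub>R q k" by (auto simp: span_breakdown_eq)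
  then have "q i' = q i + \<alpha> *\<^sub>R q j + \<beta> *\<^sub>R q k" by (simp add: algebra_simps)
  then show ?thesis by (simp add: expand)
qed simp

lemma exchange2:
  assumes "{i, j, k} \<in> B" "{i, j', k} \<in> B" shows "d i j k = d i j' k"
  using exchange[OF perm(1)[OF assms(1)] perm(1)[OF assms(2)]] swap[of "q i"] by simp

lemma exchange3:
  assumes "{i, j, k} \<in> B" "{i, j, k'} \<in> B" shows "d i j k = d i j k'"
  using exchange2[OF perm(2)[OF assms(1)] perm(2)[OF assms(2)]] swap23[of "q i" "q j"] by simp

lemma flip3:
  assumes "{i, j, k} \<in> B" "x \<in> E" "x \<notin> {i, j, k}"
  shows "{x, j, k} \<in> B \<or> {i, x, k} \<in> B \<or> {i, j, x} \<in> B"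
proof -
  note ds = distinct[OF assms(1)]
  obtain t where t: "t \<in> {i, j, k}" "insert x ({i, j, k} - {t}) \<in> B" using flip[OF assms] by blast
  have "{i, j, k} - {i} = {j, k}" "{i, j, k} - {j} = {i, k}" "{i, j, k} - {k} = {i, j}" using ds by auto
  then have "insert x {j, k} \<in> B \<or> insert x {i, k} \<in> B \<or> insert x {i, j} \<in> B" using t by force
  moreover have "{i, x, k} = {x, i, k}" "{i, j, x} = {x, i, j}" by blast+
  ultimately show ?thesis by metis
qed

text \<open>Going round a triangle x, y, z in the link of \<open>u\<close> replaces one vertex at a
  time and keeps the determinant, but it ends at the reversed orientation.\<close>

lemma no_triangle:
  assumes "{u, x, y} \<in> B" "{u, y, z} \<in> B" "{u, x, z} \<in> B" shows False
proof -
  have "d u x y = d u x z" using exchange3 assms by blast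
  moreover have "d u x z = d u y z" using exchange2 assms by blast
  moreover have "d u y z = d u y x" using exchange3[OF assms(2) perm(2)[OF assms(1)]] .
  moreover have "d u y x = - d u x y" by (rule swap23)
  ultimately show False using nonzero[OF assms(1)] by simp
qed

text \<open>Call x and y outside \<open>P\<close> adjacent if \<open>{a, x, y}\<close> is in
  \<open>B\<close>. Flipping a third element z into such a triple must keep \<open>a\<close>,
  because every member of \<open>B\<close> meets \<open>P\<close>; so z is adjacent to x or to y.
  Hence non-adjacency is an equivalence relation, and as there are no triangles it has just two
  classes.\<close>

lemma cut:
  assumes P: "primitive P" and a: "a \<in> P"
  shows "\<exists>L. L \<subseteq> E - P \<and> L \<noteq> {} \<and> L \<noteq> E - P \<and>
    (\<forall>x\<in>E - P. \<forall>y\<in>E - P. {a, x, y} \<in> B \<longleftrightarrow> (x \<in> L) \<noteq> (y \<in> L)) \<and>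
    (\<exists>\<delta>>0. \<forall>l\<in>L. \<forall>r\<in>E - P - L. d a l r = \<delta>)"
proof -
  obtain T where T: "T \<in> B" "T \<inter> P = {a}" using P a by (auto simp: primitive_def)
  then have "a \<in> T" by blast
  obtain x y where xy: "T = {a, x, y}" "a \<noteq> x" "a \<noteq> y" using \<open>T \<in> B\<close> \<open>a \<in> T\<close> by (rule triple_with)
  \<comment> \<open>Ordering the edge by the sign of its determinant decides which side becomes
    \<open>L\<close>.\<close>
  have "\<exists>l r. {a, l, r} \<in> B \<and> l \<in> E - P \<and> r \<in> E - P \<and> d a l r > 0"
  proof -
    have *: "{a, x, y} \<in> B" "{a, y, x} \<in> B" "x \<in> E - P" "y \<in> E - P"
      using T xy B_subset[OF T(1)] by (auto simp: insert_commute)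
    have "d a x y > 0 \<or> d a y x > 0" using nonzero[OF *(1)] swap23[of "q a" "q x" "q y"] by auto
    then show ?thesis using * by blast
  qed
  then obtain l0 r0 where lr: "{a, l0, r0} \<in> B" "l0 \<in> E - P" "r0 \<in> E - P" "d a l0 r0 > 0" by blast
  have miss: "{x, y, z} \<notin> B" if "x \<in> E - P" "y \<in> E - P" "z \<in> E - P" for x y z
    using that P by (auto simp: primitive_def)
  have step: "{a, x, z} \<in> B \<or> {a, y, z} \<in> B" if "{a, x, y} \<in> B" "x \<in> E - P" "y \<in> E - P" "z \<in> E - P" for x y z
  proof (cases "z \<in> {x, y}")
    case True then show ?thesis using that by (auto simp: insert_commute)
  next
    case False
    then have "z \<notin> {a, x, y}" using that a by blast
    from flip3[OF that(1) _ this] show ?thesis using that miss[of z x y] by (auto simp: insert_commute)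
  qed
  define L where "L = {x \<in> E - P. {a, r0, x} \<in> B}"
  have l0: "l0 \<in> L" using lr perm(2)[OF lr(1)] by (simp add: L_def)
  have r0: "r0 \<notin> L" using distinct[of a r0 r0] by (auto simp: L_def)
  have R: "{a, l0, x} \<in> B" if "x \<in> E - P" "x \<notin> L" for x
    using step[OF lr(1-3) that(1)] that by (auto simp: L_def)
  have same: "{a, x, y} \<notin> B" if xy: "x \<in> E - P" "y \<in> E - P" "(x \<in> L) = (y \<in> L)" for x y
  proof
    assume B: "{a, x, y} \<in> B"
    show False
    proof (cases "x \<in> L")
      case True
      then have "{a, x, r0} \<in> B" "{a, y, r0} \<in> B" using xy perm(2)[of a r0 x] perm(2)[of a r0 y] by (simp_all add: L_def)
      then show False using no_triangle[OF B] by blast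
    next
      case False
      then have "{a, x, l0} \<in> B" "{a, y, l0} \<in> B" 
        using R[of x] R[of y] xy perm(2)[of a l0 x] perm(2)[of a l0 y] by simp_all
      then show False using no_triangle[OF B] by blast
    qed
  qed
  have diff: "{a, x, y} \<in> B" if xy: "x \<in> E - P" "y \<in> E - P" "x \<in> L" "y \<notin> L" for x y
  proof -
    have "{a, r0, x} \<in> B" using xy by (simp add: L_def)
    then show ?thesis using step[OF _ lr(3) xy(1,2)] xy(2,4) by (auto simp: L_def insert_commute)
  qed
  have edge: "{a, x, y} \<in> B \<longleftrightarrow> (x \<in> L) \<noteq> (y \<in> L)" if "x \<in> E - P" "y \<in> E - P" for x y
    using same[OF that] diff[OF that] diff[of y x] that by (auto simp: insert_commute)
  have "d a l r = d a l0 r0" if "l \<in> L" "r \<in> E - P - L" for l r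
  proof -
    have "l \<in> E - P" using that by (simp add: L_def)
    then have "{a, l, r} \<in> B" "{a, l, r0} \<in> B" using diff that lr r0 by blast+
    then show ?thesis using exchange3 exchange2 lr(1) by metis
  qed
  then have "\<exists>\<delta>>0. \<forall>l\<in>L. \<forall>r\<in>E - P - L. d a l r = \<delta>" using lr(4) by blast
  moreover have "L \<subseteq> E - P" by (auto simp: L_def)
  ultimately show ?thesis using edge l0 r0 lr(3) by blast
qed

text \<open>For a primitive \<open>P\<close> and \<open>a \<in> P\<close>, \<open>lower P a\<close> is one side of the cut of \<open>E - P\<close> seen from \<open>a\<close>.
  The side is chosen by orientation, which makes the cuts of all \<open>a \<in> P\<close> comparable.\<close>

definition lower :: "'a set \<Rightarrow> 'a \<Rightarrow> 'a set" where
  "lower P a = (SOME L. L \<subseteq> E - P \<and> L \<noteq> {} \<and> L \<noteq> E - P \<and>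
    (\<forall>x\<in>E - P. \<forall>y\<in>E - P. {a, x, y} \<in> B \<longleftrightarrow> (x \<in> L) \<noteq> (y \<in> L)) \<and>
    (\<exists>\<delta>>0. \<forall>l\<in>L. \<forall>r\<in>E - P - L. d a l r = \<delta>))"

lemma lower:
  assumes "primitive P" "a \<in> P"
  shows "lower P a \<subseteq> E - P" "lower P a \<noteq> {}" "lower P a \<noteq> E - P"
    "\<And>x y. x \<in> E - P \<Longrightarrow> y \<in> E - P \<Longrightarrow> {a, x, y} \<in> B \<longleftrightarrow> (x \<in> lower P a) \<noteq> (y \<in> lower P a)"
    "\<exists>\<delta>>0. \<forall>l\<in>lower P a. \<forall>r\<in>E - P - lower P a. d a l r = \<delta>"
  using someI_ex[OF cut[OF assms], folded lower_def] by blast+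

text \<open>If \<open>x\<close> and \<open>y\<close> crossed the two cuts in opposite directions,
  \<open>exchange\<close> would equate \<open>d a x y\<close> and \<open>d b x y\<close>, whereas
  the orientation of the cuts gives them opposite signs.\<close>

lemma lower_chain:
  assumes P: "primitive P" and a: "a \<in> P" and b: "b \<in> P"
  shows "lower P a \<subseteq> lower P b \<or> lower P b \<subseteq> lower P a"
proof (rule ccontr)
  assume "\<not> ?thesis"
  then obtain x y where x: "x \<in> lower P a" "x \<notin> lower P b" and y: "y \<in> lower P b" "y \<notin> lower P a" by blast
  have xy: "x \<in> E - P" "y \<in> E - P" using x y lower(1)[OF P] a b by blast+
  have "{a, x, y} \<in> B" "{b, x, y} \<in> B" using lower(4)[OF P _ xy] a b x y by auto
  then have "d a x y = d b x y" by (rule exchange)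
  moreover have "d a x y > 0" using lower(5)[OF P a] x y xy by fastforce
  moreover have "d b y x > 0" using lower(5)[OF P b] x y xy by fastforce
  ultimately show False using swap23[of "q b" "q x" "q y"] by simp
qed

lemma least_greatest:
  assumes P: "primitive P"
  obtains a b where "a \<in> P" "b \<in> P" "\<And>c. c \<in> P \<Longrightarrow> lower P a \<subseteq> lower P c" "\<And>c. c \<in> P \<Longrightarrow> lower P c \<subseteq> lower P b"
proof -
  have "finite P" "P \<noteq> {}" using P finite_E finite_subset B_nonempty by (auto simp: primitive_def)
  have fin: "finite (lower P c)" if "c \<in> P" for c
    using lower(1)[OF P that] finite_E by (meson finite_Diff finite_subset)
  obtain a where a: "a \<in> P" "\<And>c. c \<in> P \<Longrightarrow> card (lower P a) \<le> card (lower P c)"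
    using \<open>finite P\<close> \<open>P \<noteq> {}\<close> by (meson arg_min_if_finite(1) arg_min_least)
  obtain b where b: "b \<in> P" "\<And>c. c \<in> P \<Longrightarrow> card (lower P c) \<le> card (lower P b)"
  proof -
    let ?M = "Max ((\<lambda>c. card (lower P c)) ` P)"
    have "?M \<in> (\<lambda>c. card (lower P c)) ` P" using \<open>finite P\<close> \<open>P \<noteq> {}\<close> by (intro Max_in) auto
    then obtain b where "b \<in> P" "card (lower P b) = ?M" by auto
    moreover have "card (lower P c) \<le> ?M" if "c \<in> P" for c using \<open>finite P\<close> that by (intro Max_ge) auto
    ultimately show ?thesis using that by metis
  qed
  show ?thesis
  proof (rule that[OF a(1) b(1)])
    show "lower P a \<subseteq> lower P c" if "c \<in> P" for c
      using lower_chain[OF P a(1) that] a(2)[OF that] fin[OF a(1)] by (metis card_seteq order_refl)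
    show "lower P c \<subseteq> lower P b" if "c \<in> P" for c
      using lower_chain[OF P b(1) that] b(2)[OF that] fin[OF that] by (metis card_seteq order_refl)
  qed
qed

text \<open>An \<open>l\<close> in the least lower side and an \<open>r\<close> beyond the greatest
  are separated by every cut. So all triples \<open>{c, l, r}\<close> are in \<open>B\<close>, and
  \<open>exchange\<close> links the constants of the individual cuts.\<close>

lemma volume:
  assumes P: "primitive P"
  obtains \<delta> where "\<delta> > 0" "\<And>a l r. a \<in> P \<Longrightarrow> l \<in> lower P a \<Longrightarrow> r \<in> E - P - lower P a \<Longrightarrow> d a l r = \<delta>"
proof -
  obtain a b where ab: "a \<in> P" "b \<in> P" "\<And>c. c \<in> P \<Longrightarrow> lower P a \<subseteq> lower P c" "\<And>c. c \<in> P \<Longrightarrow> lower P c \<subseteq> lower P b"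
    using least_greatest[OF P] by metis
  obtain l r where lr: "l \<in> lower P a" "r \<in> E - P - lower P b"
    using lower(1,2)[OF P ab(1)] lower(1,3)[OF P ab(2)] by blast
  have lrc: "{c, l, r} \<in> B" "l \<in> lower P c" "r \<in> E - P - lower P c" if "c \<in> P" for c
    using lr ab(3,4)[OF that] lower(4)[OF P that, of l r] lower(1)[OF P that] by blast+
  have "d c l' r' = d a l r" if "c \<in> P" "l' \<in> lower P c" "r' \<in> E - P - lower P c" for c l' r'
  proof -
    have "d c l' r' = d c l r" using lower(5)[OF P that(1)] that lrc[OF that(1)] by metis
    also have "\<dots> = d a l r" using exchange lrc(1) ab(1) that(1) by blast
    finally show ?thesis .
  qed
  moreover have "d a l r > 0" using lower(5)[OF P ab(1)] lrc[OF ab(1)] by metis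
  ultimately show ?thesis using that by blast
qed

text \<open>Otherwise \<open>a\<close>, \<open>b\<close>, \<open>g\<close> would form a triangle in
  the link of \<open>k\<close>.\<close>

lemma opposite:
  assumes P: "primitive P" and "a \<in> P" "b \<in> P" "{a, b, k} \<in> B" and g: "g \<in> E - P" and k: "k \<in> E - P"
    and "(k \<in> lower P a) \<noteq> (g \<in> lower P a)" "(k \<in> lower P b) \<noteq> (g \<in> lower P b)"
  shows False
proof -
  have "{a, k, g} \<in> B" "{b, k, g} \<in> B" using lower(4)[OF P _ k g] assms by blast+
  then show False using no_triangle[of k a b g] assms(4) perm by blast
qed

text \<open>Take \<open>l\<close> below both cuts and flip \<open>b\<close> into
  \<open>{a, l, m}\<close>. The outcome \<open>{b, l, m}\<close> is excluded because
  \<open>l\<close> and \<open>m\<close> are on one side for \<open>b\<close>, and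
  \<open>{a, b, l}\<close> is excluded by \<open>opposite\<close>.\<close>

lemma middle:
  assumes P: "primitive P" and a: "a \<in> P" and b: "b \<in> P" and sub: "lower P a \<subseteq> lower P b"
    and m: "m \<in> lower P b - lower P a"
  shows "{a, b, m} \<in> B"
proof -
  obtain l where l: "l \<in> lower P a" using lower(2)[OF P a] by blast
  obtain r where r: "r \<in> E - P - lower P b" using lower(1,3)[OF P b] by blast
  have lm: "l \<in> E - P" "m \<in> E - P" "l \<in> lower P b" using l m sub lower(1)[OF P] a b by blast+
  have B: "{a, l, m} \<in> B" using lower(4)[OF P a lm(1,2)] l m by blast
  have nB: "{b, l, m} \<notin> B" using lower(4)[OF P b lm(1,2)] lm m by blast
  have "b \<noteq> a" using m by blast
  then have "b \<notin> {a, l, m}" "b \<in> E" using lm b P by (auto simp: primitive_def)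
  from flip3[OF B this(2,1)] nB have "{a, b, m} \<in> B \<or> {a, b, l} \<in> B" by (auto simp: insert_commute)
  moreover have "{a, b, l} \<notin> B" using opposite[OF P a b, of l r] l r sub lm by blast
  ultimately show ?thesis by blast
qed

lemma middle_volume:
  assumes P: "primitive P" and a: "a \<in> P" and b: "b \<in> P" and sub: "lower P a \<subseteq> lower P b"
    and m: "m \<in> lower P b - lower P a"
    and vol: "\<And>a l r. a \<in> P \<Longrightarrow> l \<in> lower P a \<Longrightarrow> r \<in> E - P - lower P a \<Longrightarrow> d a l r = \<delta>"
  shows "d a b m = \<delta>"
proof -
  obtain l where l: "l \<in> lower P a" using lower(2)[OF P a] by blast
  have lm: "l \<in> E - P" "m \<in> E - P" using l m lower(1)[OF P] a b by blast+
  have "{a, l, m} \<in> B" using lower(4)[OF P a lm] l m by blast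
  from exchange2[OF this middle[OF P a b sub m]] show ?thesis using vol[OF a l, of m] m lm by simp
qed

lemma no_three_cuts:
  assumes P: "primitive P" and abc: "a \<in> P" "b \<in> P" "c \<in> P" and "lower P a \<subset> lower P b" "lower P b \<subset> lower P c"
  shows False
proof -
  obtain \<delta> where \<delta>: "\<delta> > 0" and
    vol: "\<And>a l r. a \<in> P \<Longrightarrow> l \<in> lower P a \<Longrightarrow> r \<in> E - P - lower P a \<Longrightarrow> d a l r = \<delta>"
    using volume[OF P] by metis
  note mid = middle_volume[OF P _ _ _ _ vol]
  obtain h where h: "linear h" "\<And>j. j \<in> E \<Longrightarrow> h (q j) > (0::real)" using pointed by blast
  obtain l where l: "l \<in> lower P a" using lower(2)[OF P abc(1)] by blast
  obtain m where m: "m \<in> lower P b - lower P a" using assms by blast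
  obtain m' where m': "m' \<in> lower P c - lower P b" using assms by blast
  obtain r where r: "r \<in> E - P - lower P c" using lower(1,3)[OF P abc(3)] by blast
  have E: "l \<in> E - P" "m \<in> E - P" "m' \<in> E - P" using l m m' lower(1)[OF P] abc by blast+
  have "d a l m = \<delta>" "d a l m' = \<delta>" "d a l r = \<delta>"
    by (rule vol; use l m m' r E abc assms(5,6) in blast)+
  moreover have "d b l m' = \<delta>" "d b l r = \<delta>" "d b m m' = \<delta>" "d b m r = \<delta>"
    by (rule vol; use l m m' r E abc assms(5,6) in blast)+
  moreover have "d c l r = \<delta>" "d c m r = \<delta>" "d c m' r = \<delta>"
    by (rule vol; use l m m' r E abc assms(5,6) in blast)+
  moreover have "d a b m = \<delta>" "d a c m = \<delta>" "d a c m' = \<delta>" "d b c m' = \<delta>"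
    by (rule mid; use m m' abc assms(5,6) in blast)+
  \<comment> \<open>The order is that of the three cuts followed by the four pieces they leave, from
    lowest to highest. Triples with one element of \<open>P\<close> come from \<open>vol\<close>,
    those with two from \<open>mid\<close>.\<close>
  ultimately have "heptagon \<delta> (q a) (q b) (q c) (q l) (q m) (q m') (q r)"
    using \<delta> by (simp add: heptagon_def)
  moreover have "a \<in> E" "b \<in> E" "c \<in> E" using P abc by (auto simp: primitive_def)
  ultimately show False using no_heptagon[OF _ h(1)] h(2) E r by (metis DiffD1)
qed

text \<open>Three elements of \<open>P\<close> cannot form a triple: flipping in an \<open>l\<close>
  below all cuts would leave two of them together with \<open>l\<close>, which is on the same side
  for both. The list serves to check that a class lies in all cones.\<close>

lemma meets_primitive:
  assumes P: "primitive P" and T: "T \<in> B"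
  shows "(\<exists>a l r. a \<in> P \<and> l \<in> lower P a \<and> r \<in> E - P - lower P a \<and> T = {a, l, r}) \<or>
         (\<exists>a b k. a \<in> P \<and> b \<in> P \<and> k \<in> E - P \<and> T = {a, b, k} \<and> (k \<in> lower P a) \<noteq> (k \<in> lower P b))"
proof -
  obtain a0 b0 where ab: "a0 \<in> P" "b0 \<in> P" "\<And>c. c \<in> P \<Longrightarrow> lower P a0 \<subseteq> lower P c" "\<And>c. c \<in> P \<Longrightarrow> lower P c \<subseteq> lower P b0"
    using least_greatest[OF P] by metis
  obtain l where l: "\<And>c. c \<in> P \<Longrightarrow> l \<in> lower P c" "l \<in> E - P"
    using lower(1,2)[OF P ab(1)] ab(3) by blast
  obtain r where r: "\<And>c. c \<in> P \<Longrightarrow> r \<notin> lower P c" "r \<in> E - P"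
    using lower(1,3)[OF P ab(2)] ab(4) by blast
  have two: "(k \<in> lower P a) \<noteq> (k \<in> lower P b)" if "{a, b, k} \<in> B" "a \<in> P" "b \<in> P" "k \<in> E - P" for a b k
    using opposite[OF P that(2,3,1) _ that(4), of l] opposite[OF P that(2,3,1) _ that(4), of r] l r that by blast
  obtain a where a: "a \<in> T" "a \<in> P" using P T unfolding primitive_def by blast
  show ?thesis
  proof (cases "T \<inter> P = {a}")
    case True
    obtain x y where xy: "T = {a, x, y}" "a \<noteq> x" "a \<noteq> y" "x \<noteq> y" using T a(1) by (rule triple_with)
    have "x \<in> T" "y \<in> T" using xy by auto
    then have E: "x \<in> E - P" "y \<in> E - P" using True xy(2,3) B_subset[OF T] by auto
    have "(x \<in> lower P a) \<noteq> (y \<in> lower P a)" using lower(4)[OF P a(2) E] T unfolding xy(1) by simp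
    moreover have "T = {a, y, x}" using xy(1) by auto
    ultimately show ?thesis using xy(1) a(2) E by (metis DiffI)
  next
    case False
    then obtain b where b: "b \<in> T" "b \<in> P" "a \<noteq> b" using a by blast
    obtain k where k: "T = {a, b, k}" "a \<noteq> k" "b \<noteq> k" using T a(1) b(1,3) by (rule triple_with2)
    have "k \<notin> P"
    proof
      assume kP: "k \<in> P"
      have "l \<notin> {a, b, k}" using l a b kP by blast
      moreover have "{a, b, k} \<in> B" "l \<in> E" using T k(1) l(2) by auto
      ultimately have "{l, b, k} \<in> B \<or> {a, l, k} \<in> B \<or> {a, b, l} \<in> B" using flip3 by blast
      then have "{b, k, l} \<in> B \<or> {a, k, l} \<in> B \<or> {a, b, l} \<in> B" using perm(4)[of l b k] perm(2)[of a l k] by blast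
      then show False using two[of _ _ l] l a b kP by blast
    qed
    then have kE: "k \<in> E - P" using k(1) B_subset[OF T] by auto
    have "(k \<in> lower P a) \<noteq> (k \<in> lower P b)" using two[OF _ a(2) b(2) kE] T unfolding k(1) by blast
    then show ?thesis using k(1) a(2) b(2) kE by blast
  qed
qed

text \<open>A triple in \<open>B\<close> is independent, so it cannot lie inside the coplanar
  complement of \<open>Q\<close>.\<close>

lemma primitiveI:
  assumes "Q \<subseteq> E" "flat (q ` (E - Q))" "\<And>a. a \<in> Q \<Longrightarrow> \<exists>T\<in>B. T \<inter> Q = {a}"
  shows "primitive Q"
proof -
  have "T \<inter> Q \<noteq> {}" if T: "T \<in> B" for T
  proof
    assume "T \<inter> Q = {}"
    obtain i j k where ijk: "T = {i, j, k}" using triple[OF T] by metis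
    then have "i \<in> E - Q" "j \<in> E - Q" "k \<in> E - Q" using \<open>T \<inter> Q = {}\<close> B_subset[OF T] by blast+
    then have "d i j k = 0" using assms(2) by (simp add: flat_def)
    then show False using nonzero T ijk by blast
  qed
  then show ?thesis using assms by (auto simp: primitive_def)
qed

lemma coefficient_integral:
  assumes B: "{i, j, k} \<in> B" and x: "x \<in> E" shows "d x j k / d i j k \<in> \<int>"
proof -
  obtain c where c: "\<forall>t\<in>{i, j, k}. c t \<in> \<int>" "q x = (\<Sum>t\<in>{i, j, k}. c t *\<^sub>R q t)" using integral[OF B x] by blast
  have "q x = c i *\<^sub>R q i + c j *\<^sub>R q j + c k *\<^sub>R q k" using c(2) distinct[OF B] by (simp add: add.assoc)
  then have "d x j k = c i * d i j k" by (simp add: expand)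
  then show ?thesis using nonzero[OF B] c(1) by simp
qed

text \<open>The coordinate along \<open>q x0\<close> is 1, 0, 0 on the first triple. If both
  determinants were nonpositive after division by \<open>\<delta>\<close>, it would be nonpositive
  on the second triple, against \<open>separation\<close>.\<close>

lemma coefficient_positive:
  assumes B: "{x0, x2, x3} \<in> B" "{x1, x2, x4} \<in> B" and \<delta>: "d x0 x2 x3 = \<delta>"
  shows "d x1 x2 x3 / \<delta> > 0 \<or> d x2 x3 x4 / \<delta> > 0"
proof (rule ccontr)
  assume neg: "\<not> ?thesis"
  have \<delta>0: "\<delta> \<noteq> 0" using nonzero[OF B(1)] \<delta> by simp
  let ?f = "\<lambda>x. - (D x (q x2) (q x3) / \<delta>)"
  have "linear ?f" by (rule linearI) (auto simp: expand add_divide_distrib)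
  moreover have "?f (q t) \<le> 0" if "t \<in> {x0, x2, x3}" for t using that \<delta> \<delta>0 by (auto simp: rep)
  moreover have "?f (q t) \<ge> 0" if "t \<in> {x1, x2, x4}" for t
    using that neg cyclic[of "q x4" "q x2" "q x3"] by (auto simp: rep)
  ultimately have "?f (q x0) = 0" using separation[OF B(1,2)] by blast
  then show False using \<delta> \<delta>0 by simp
qed

section \<open>From cuts to a primitive collection with coplanar complement\<close>

definition index_pentagon :: "real \<Rightarrow> 'a set \<Rightarrow> 'a set \<Rightarrow> 'a set \<Rightarrow> 'a set \<Rightarrow> 'a set \<Rightarrow> bool" where
  "index_pentagon \<delta> Y0 Y1 Y2 Y3 Y4 \<longleftrightarrow> \<delta> \<noteq> 0 \<and> E = Y0 \<union> Y1 \<union> Y2 \<union> Y3 \<union> Y4 \<and>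
     Y0 \<noteq> {} \<and> Y1 \<noteq> {} \<and> Y2 \<noteq> {} \<and> Y3 \<noteq> {} \<and> Y4 \<noteq> {} \<and>
     (\<forall>y0\<in>Y0. \<forall>y1\<in>Y1. \<forall>y3\<in>Y3. {y0, y1, y3} \<in> B \<and> d y0 y1 y3 = \<delta>) \<and>
     (\<forall>y1\<in>Y1. \<forall>y2\<in>Y2. \<forall>y4\<in>Y4. {y1, y2, y4} \<in> B \<and> d y1 y2 y4 = \<delta>) \<and>
     (\<forall>y0\<in>Y0. \<forall>y2\<in>Y2. \<forall>y3\<in>Y3. {y0, y2, y3} \<in> B \<and> d y0 y2 y3 = \<delta>) \<and>
     (\<forall>y1\<in>Y1. \<forall>y3\<in>Y3. \<forall>y4\<in>Y4. {y1, y3, y4} \<in> B \<and> d y1 y3 y4 = \<delta>) \<and>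
     (\<forall>y0\<in>Y0. \<forall>y2\<in>Y2. \<forall>y4\<in>Y4. {y0, y2, y4} \<in> B \<and> d y0 y2 y4 = \<delta>)"

lemma index_pentagon_rotate:
  assumes "index_pentagon \<delta> Y0 Y1 Y2 Y3 Y4" shows "index_pentagon \<delta> Y1 Y2 Y3 Y4 Y0"
proof -
  note p = assms[unfolded index_pentagon_def]
  have rot: "{y, z, x} \<in> B \<and> d y z x = \<delta>" if "{x, y, z} \<in> B \<and> d x y z = \<delta>" for x y z
    using that perm(4)[of x y z] cyclic[of "q x" "q y" "q z"] by simp
  have 1: "{y2, y3, y0} \<in> B \<and> d y2 y3 y0 = \<delta>" if "y2 \<in> Y2" "y3 \<in> Y3" "y0 \<in> Y0" for y0 y2 y3 using rot p that by blast
  have 2: "{y2, y4, y0} \<in> B \<and> d y2 y4 y0 = \<delta>" if "y2 \<in> Y2" "y4 \<in> Y4" "y0 \<in> Y0" for y0 y2 y4 using rot p that by blast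
  have 3: "{y1, y3, y0} \<in> B \<and> d y1 y3 y0 = \<delta>" if "y1 \<in> Y1" "y3 \<in> Y3" "y0 \<in> Y0" for y0 y1 y3 using rot p that by blast
  have 4: "Y0 \<union> Y1 \<union> Y2 \<union> Y3 \<union> Y4 = Y1 \<union> Y2 \<union> Y3 \<union> Y4 \<union> Y0" by blast
  show ?thesis using p 1 2 3 4 unfolding index_pentagon_def by simp
qed

text \<open>Members of \<open>Y3\<close> and of \<open>Y4\<close> alike complete a pair from
  \<open>Y0\<close> and \<open>Y2\<close> to a triple in \<open>B\<close>, which gives the
  minimality witnesses for the union of \<open>Y3\<close> and \<open>Y4\<close>.\<close>

lemma index_pentagon_primitive:
  assumes pent: "index_pentagon \<delta> Y0 Y1 Y2 Y3 Y4" and flat: "flat (q ` Y0 \<union> q ` Y1 \<union> q ` Y2)"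
  shows "\<exists>Q. primitive Q \<and> flat (q ` (E - Q))"
proof -
  note p = pent[unfolded index_pentagon_def]
  obtain y0 y1 y2 y3 y4 where y: "y0 \<in> Y0" "y1 \<in> Y1" "y2 \<in> Y2" "y3 \<in> Y3" "y4 \<in> Y4" using p by blast
  have disj: "x \<noteq> z" if "x \<in> Y0 \<union> Y1 \<union> Y2" "z \<in> Y3 \<union> Y4" for x z
  proof -
    have "{x, y1, z} \<in> B" if "x \<in> Y0" "z \<in> Y3" using p that y by blast
    moreover have "{x, y2, z} \<in> B" if "x \<in> Y0 \<union> Y1" "z \<in> Y4" using p that y by blast
    moreover have "{y0, x, z} \<in> B" if "x \<in> Y1 \<union> Y2" "z \<in> Y3" using p that y by blast
    moreover have "{y0, x, z} \<in> B" if "x \<in> Y2" "z \<in> Y4" using p that y by blast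
    ultimately show ?thesis using that distinct(2,3) by (metis Un_iff)
  qed
  then have EQ: "E - (Y3 \<union> Y4) = Y0 \<union> Y1 \<union> Y2" using p by blast
  have "\<exists>T\<in>B. T \<inter> (Y3 \<union> Y4) = {a}" if a: "a \<in> Y3 \<union> Y4" for a
  proof -
    have "{y0, y2, a} \<in> B" using a p y by blast
    moreover have "{y0, y2, a} \<inter> (Y3 \<union> Y4) = {a}" using a disj y by blast
    ultimately show ?thesis by blast
  qed
  then have "primitive (Y3 \<union> Y4)" using primitiveI[of "Y3 \<union> Y4"] EQ flat p by (auto simp: image_Un)
  then show ?thesis using EQ flat by (intro exI[of _ "Y3 \<union> Y4"]) (simp add: image_Un)
qed

lemma index_pentagon_admissible:
  assumes pent: "index_pentagon \<delta> Y0 Y1 Y2 Y3 Y4" and y: "y0 \<in> Y0" "y1 \<in> Y1" "y2 \<in> Y2" "y3 \<in> Y3" "y4 \<in> Y4"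
  shows "admissible \<delta> (q y1) (q y2) (q y3) (q y4)"
proof -
  have B: "{y0, y2, y3} \<in> B" "{y1, y2, y4} \<in> B" "d y0 y2 y3 = \<delta>" using pent y unfolding index_pentagon_def by blast+
  have "y1 \<in> E" using pent y by (simp add: index_pentagon_def)
  then have "d y1 y2 y3 / \<delta> \<in> \<int>" using coefficient_integral[OF B(1)] B(3) by blast
  then show ?thesis using coefficient_positive[OF B] by (simp add: admissible_def)
qed

lemma index_pentagon_flat:
  assumes p: "index_pentagon \<delta> Y0 Y1 Y2 Y3 Y4" shows "\<exists>Q. primitive Q \<and> flat (q ` (E - Q))"
proof -
  note r = index_pentagon_rotate
  note p1 = r[OF p] note p2 = r[OF p1] note p3 = r[OF p2] note p4 = r[OF p3]
  have "pentagon \<delta> (q ` Y0) (q ` Y1) (q ` Y2) (q ` Y3) (q ` Y4)"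
    using p unfolding index_pentagon_def pentagon_def by simp
  then have "some_consecutive_flat (q ` Y0) (q ` Y1) (q ` Y2) (q ` Y3) (q ` Y4)"
  proof (rule pentagon_flat)
    fix x0 x1 x2 x3 x4
    assume "x0 \<in> q ` Y0" "x1 \<in> q ` Y1" "x2 \<in> q ` Y2" "x3 \<in> q ` Y3" "x4 \<in> q ` Y4"
    then obtain y0 y1 y2 y3 y4 where y: "y0 \<in> Y0" "y1 \<in> Y1" "y2 \<in> Y2" "y3 \<in> Y3" "y4 \<in> Y4"
      and x: "x0 = q y0" "x1 = q y1" "x2 = q y2" "x3 = q y3" "x4 = q y4" by blast
    show "admissible \<delta> x0 x1 x2 x3 \<and> admissible \<delta> x1 x2 x3 x4 \<and> admissible \<delta> x2 x3 x4 x0 \<and>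
      admissible \<delta> x3 x4 x0 x1 \<and> admissible \<delta> x4 x0 x1 x2"
      unfolding x using index_pentagon_admissible[OF p y] index_pentagon_admissible[OF p1 y(2,3,4,5,1)]
        index_pentagon_admissible[OF p2 y(3,4,5,1,2)] index_pentagon_admissible[OF p3 y(4,5,1,2,3)]
        index_pentagon_admissible[OF p4 y(5,1,2,3,4)] by blast
  qed
  then show ?thesis
    using index_pentagon_primitive[OF p] index_pentagon_primitive[OF p1] index_pentagon_primitive[OF p2]
      index_pentagon_primitive[OF p3] index_pentagon_primitive[OF p4]
    unfolding some_consecutive_flat_def by blast
qed

lemma two_cuts:
  assumes P: "primitive P" and ab: "a \<in> P" "b \<in> P" and sub: "lower P a \<subset> lower P b" and c: "c \<in> P"
  shows "lower P c = lower P a \<or> lower P c = lower P b"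
  using no_three_cuts[OF P, of a c b] no_three_cuts[OF P, of c a b] no_three_cuts[OF P, of a b c]
    lower_chain[OF P, of c a] lower_chain[OF P, of c b] ab c sub by blast

lemma ex_flat_primitive: "\<exists>P. primitive P \<and> flat (q ` (E - P))"
proof -
  obtain P where P: "primitive P" using ex_primitive by blast
  obtain \<delta> where \<delta>: "\<delta> > 0" and
    vol: "\<And>a l r. a \<in> P \<Longrightarrow> l \<in> lower P a \<Longrightarrow> r \<in> E - P - lower P a \<Longrightarrow> d a l r = \<delta>"
    using volume[OF P] by metis
  obtain a b where ab: "a \<in> P" "b \<in> P" "\<And>c. c \<in> P \<Longrightarrow> lower P a \<subseteq> lower P c" "\<And>c. c \<in> P \<Longrightarrow> lower P c \<subseteq> lower P b"
    using least_greatest[OF P] by metis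
  have PE: "P \<subseteq> E" using P by (simp add: primitive_def)
  have B: "{c, l, r} \<in> B" if "c \<in> P" "l \<in> lower P c" "r \<in> E - P - lower P c" for c l r
    using lower(4)[OF P that(1), of l r] lower(1)[OF P that(1)] that by blast
  show ?thesis
  proof (cases "lower P a = lower P b")
    case True
    \<comment> \<open>With a single cut every choice from \<open>P\<close>, \<open>L\<close>,
      \<open>R\<close> is in \<open>B\<close>. The class left out of the coplanar pair becomes the
      primitive collection.\<close>
    define L R where "L = lower P a" and "R = E - P - L"
    have L: "lower P c = L" if "c \<in> P" for c using ab(3,4)[OF that] True by (simp add: L_def)
    have LR: "L \<subseteq> E - P" "L \<noteq> {}" "R \<noteq> {}" using lower(1-3)[OF P ab(1)] by (auto simp: L_def R_def)
    obtain l r where lr: "l \<in> L" "r \<in> R" using LR by blast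
    have B: "{c, l, r} \<in> B" if "c \<in> P" "l \<in> L" "r \<in> R" for c l r using B[of c l r] L that by (auto simp: R_def)
    have "D x y z = \<delta>" if xyz: "x \<in> q ` P" "y \<in> q ` L" "z \<in> q ` R" for x y z
    proof -
      obtain c l r where "c \<in> P" "l \<in> L" "r \<in> R" "x = q c" "y = q l" "z = q r" using xyz by blast
      then show ?thesis using vol[of c l r] L by (simp add: R_def)
    qed
    then have "flat (q ` P \<union> q ` L) \<or> flat (q ` L \<union> q ` R) \<or> flat (q ` R \<union> q ` P)"
      by (rule triangle) (use \<delta> ab(1) lr in auto)
    then consider "flat (q ` P \<union> q ` L)" | "flat (q ` L \<union> q ` R)" | "flat (q ` R \<union> q ` P)" by blast
    then show ?thesis
    proof cases
      case 1
      have "E - R = P \<union> L" using PE LR by (auto simp: R_def)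
      moreover have "\<exists>T\<in>B. T \<inter> R = {x}" if "x \<in> R" for x
      proof -
        have "{a, l, x} \<inter> R = {x}" using ab(1) lr that by (auto simp: R_def)
        then show ?thesis using B[OF ab(1) lr(1) that] by blast
      qed
      ultimately have "primitive R" "flat (q ` (E - R))" using primitiveI[of R] 1 by (auto simp: R_def image_Un)
      then show ?thesis by blast
    next
      case 2
      moreover have "E - P = L \<union> R" using LR by (auto simp: R_def)
      ultimately show ?thesis using P by (metis image_Un)
    next
      case 3
      have "E - L = R \<union> P" using PE LR by (auto simp: R_def)
      moreover have "\<exists>T\<in>B. T \<inter> L = {x}" if "x \<in> L" for x
      proof -
        have "{a, x, r} \<inter> L = {x}" using ab(1) lr that LR by (auto simp: R_def)
        then show ?thesis using B[OF ab(1) that lr(2)] by blast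
      qed
      ultimately have "primitive L" "flat (q ` (E - L))" using primitiveI[of L] 3 LR by (auto simp: image_Un)
      then show ?thesis by blast
    qed
  next
    case False
    then have sub: "lower P a \<subset> lower P b" using ab by blast
    \<comment> \<open>Elements of \<open>P\<close> are grouped by their cut, the remaining ones by
      their position relative to the two cuts; in this cyclic order the classes form a
      pentagon.\<close>
    define Y0 Y1 Y2 Y3 Y4 where Y: "Y0 = {c \<in> P. lower P c = lower P a}" "Y1 = {c \<in> P. lower P c = lower P b}"
      "Y2 = lower P a" "Y3 = lower P b - lower P a" "Y4 = E - P - lower P b"
    have subs: "lower P a \<subseteq> E - P" "lower P b \<subseteq> E - P" using lower(1)[OF P] ab by blast+
    have P01: "P = Y0 \<union> Y1" using two_cuts[OF P ab(1,2) sub] by (auto simp: Y)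
    have side: "{c, l, r} \<in> B \<and> d c l r = \<delta>" if "c \<in> P" "l \<in> lower P c" "r \<in> E - P - lower P c" for c l r
      using B vol that by blast
    have "index_pentagon \<delta> Y0 Y1 Y2 Y3 Y4"
      unfolding index_pentagon_def
    proof (intro conjI ballI)
      show "\<delta> \<noteq> 0" using \<delta> by simp
      show "E = Y0 \<union> Y1 \<union> Y2 \<union> Y3 \<union> Y4" using P01 PE subs sub unfolding Y(3,4,5) by blast
      show "Y0 \<noteq> {}" "Y1 \<noteq> {}" using ab by (auto simp: Y)
      show "Y2 \<noteq> {}" "Y3 \<noteq> {}" "Y4 \<noteq> {}" using lower(2)[OF P ab(1)] sub lower(1,3)[OF P ab(2)] by (auto simp: Y)
      fix y0 y1 y3 assume "y0 \<in> Y0" "y1 \<in> Y1" "y3 \<in> Y3"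
      then have *: "y0 \<in> P" "y1 \<in> P" "lower P y0 \<subseteq> lower P y1" "y3 \<in> lower P y1 - lower P y0" using sub by (auto simp: Y)
      show "{y0, y1, y3} \<in> B" using middle[OF P *] .
      show "d y0 y1 y3 = \<delta>" using middle_volume[OF P * vol] .
    next
      fix y1 y2 y4 assume "y1 \<in> Y1" "y2 \<in> Y2" "y4 \<in> Y4"
      then show "{y1, y2, y4} \<in> B" "d y1 y2 y4 = \<delta>" using side[of y1 y2 y4] sub subs by (auto simp: Y)
    next
      fix y1 y2 y4 assume "y1 \<in> Y0" "y2 \<in> Y2" "y4 \<in> Y3"
      then show "{y1, y2, y4} \<in> B" "d y1 y2 y4 = \<delta>" using side[of y1 y2 y4] sub subs by (auto simp: Y)
    next
      fix y1 y2 y4 assume "y1 \<in> Y1" "y2 \<in> Y3" "y4 \<in> Y4"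
      then show "{y1, y2, y4} \<in> B" "d y1 y2 y4 = \<delta>" using side[of y1 y2 y4] sub subs by (auto simp: Y)
    next
      fix y1 y2 y4 assume "y1 \<in> Y0" "y2 \<in> Y2" "y4 \<in> Y4"
      then show "{y1, y2, y4} \<in> B" "d y1 y2 y4 = \<delta>" using side[of y1 y2 y4] sub subs by (auto simp: Y)
    qed
    then show ?thesis by (rule index_pentagon_flat)
  qed
qed

lemma flat_functional:
  assumes P: "primitive P" and flat: "flat (q ` (E - P))"
  shows "\<exists>f. linear f \<and> (\<forall>j\<in>E. f (q j) = (if j \<in> P then 1 else 0 :: real))"
proof -
  obtain \<delta> where \<delta>: "\<delta> > 0" and
    vol: "\<And>a l r. a \<in> P \<Longrightarrow> l \<in> lower P a \<Longrightarrow> r \<in> E - P - lower P a \<Longrightarrow> d a l r = \<delta>"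
    using volume[OF P] by metis
  obtain a b where ab: "a \<in> P" "b \<in> P" "\<And>c. c \<in> P \<Longrightarrow> lower P a \<subseteq> lower P c" "\<And>c. c \<in> P \<Longrightarrow> lower P c \<subseteq> lower P b"
    using least_greatest[OF P] by metis
  obtain l r where lr: "l \<in> lower P a" "r \<in> E - P - lower P b" "l \<in> E - P"
    using lower(1,2)[OF P ab(1)] lower(1,3)[OF P ab(2)] by blast
  \<comment> \<open>On \<open>P\<close> the value is 1 because every cut separates \<open>l\<close>
    from \<open>r\<close>; off \<open>P\<close> it is 0 by coplanarity.\<close>
  let ?f = "\<lambda>x. D x (q l) (q r) / \<delta>"
  have "linear ?f" by (rule linearI) (auto simp: expand add_divide_distrib)
  moreover have "?f (q j) = 1" if "j \<in> P" for j using vol[OF that, of l r] lr ab(3,4)[OF that] \<delta> by auto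
  moreover have "?f (q j) = 0" if "j \<in> E - P" for j using flat that lr by (simp add: flat_def)
  ultimately show ?thesis by (intro exI[of _ ?f]) auto
qed

text \<open>A functional that is 1 on \<open>P\<close> and 0 outside sharpens constancy modulo
  \<open>q c\<close> to equality of classes. With one cut, a constant side meets every
  \<open>T\<close>. With two cuts, a class between them is the sum of one below and one above, and
  every \<open>T\<close> contains a middle element or one element of each outer piece.\<close>

lemma ex_in_all_cones:
  assumes P: "primitive P" and flat: "flat (q ` (E - P))"
  shows "\<exists>j\<in>E - P. in_all_cones j"
proof -
  obtain \<delta> where \<delta>: "\<delta> > 0" and
    vol: "\<And>a l r. a \<in> P \<Longrightarrow> l \<in> lower P a \<Longrightarrow> r \<in> E - P - lower P a \<Longrightarrow> d a l r = \<delta>"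
    using volume[OF P] by metis
  obtain f :: "'v \<Rightarrow> real" where f: "linear f" "\<And>j. j \<in> E \<Longrightarrow> f (q j) = (if j \<in> P then 1 else 0)"
    using flat_functional[OF P flat] by blast
  have PE: "P \<subseteq> E" using P by (simp add: primitive_def)
  obtain a b where ab: "a \<in> P" "b \<in> P" "\<And>c. c \<in> P \<Longrightarrow> lower P a \<subseteq> lower P c" "\<And>c. c \<in> P \<Longrightarrow> lower P c \<subseteq> lower P b"
    using least_greatest[OF P] by metis
  have mod: "q y = q x" if "q y = q x + \<kappa> *\<^sub>R q c" "x \<in> E - P" "y \<in> E - P" "c \<in> P" for x y c \<kappa>
  proof -
    have "f (q y) = f (q x) + \<kappa> * f (q c)" using that(1) f(1) by (simp add: linear_add linear_scale)
    then have "\<kappa> = 0" using f(2)[of x] f(2)[of y] f(2)[of c] that PE by (auto split: if_splits)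
    then show ?thesis using that by simp
  qed
  have const: "(\<forall>x\<in>lower P c. \<forall>y\<in>lower P c. q y = q x) \<or> (\<forall>x\<in>E - P - lower P c. \<forall>y\<in>E - P - lower P c. q y = q x)"
    if c: "c \<in> P" for c
  proof -
    have sub: "lower P c \<subseteq> E - P" using lower(1)[OF P c] .
    have "D (q c) y z = \<delta>" if "y \<in> q ` lower P c" "z \<in> q ` (E - P - lower P c)" for y z
      using that vol[OF c] by blast
    from const_mod[OF this] \<delta> consider "\<forall>y\<in>q ` lower P c. \<forall>y'\<in>q ` lower P c. \<exists>\<kappa>. y' = y + \<kappa> *\<^sub>R q c"
      | "\<forall>y\<in>q ` (E - P - lower P c). \<forall>y'\<in>q ` (E - P - lower P c). \<exists>\<kappa>. y' = y + \<kappa> *\<^sub>R q c"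
      by (metis less_irrefl)
    then show ?thesis
    proof cases
      case 1 then show ?thesis using mod c sub by (meson imageI subsetD)
    next
      case 2 then show ?thesis using mod c by (metis DiffD1 imageI)
    qed
  qed
  show ?thesis
  proof (cases "lower P a = lower P b")
    case True
    have L: "lower P c = lower P a" if "c \<in> P" for c using ab(3,4)[OF that] True by simp
    have T: "\<exists>c l r. T = {c, l, r} \<and> l \<in> lower P a \<and> r \<in> E - P - lower P a" if "T \<in> B" for T
      using meets_primitive[OF P that] L by metis
    have "lower P a \<subseteq> E - P" "lower P a \<noteq> {}" "E - P - lower P a \<noteq> {}" using lower(1-3)[OF P ab(1)] by blast+
    then obtain S where S: "S \<subseteq> E - P" "S \<noteq> {}" "\<forall>x\<in>S. \<forall>y\<in>S. q y = q x" "S = lower P a \<or> S = E - P - lower P a"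
      using const[OF ab(1)] by blast
    then obtain j where j: "j \<in> S" by blast
    have "\<exists>t\<in>U. q j = q t" if U: "U \<in> B" for U
    proof -
      obtain c l r where "U = {c, l, r}" "l \<in> lower P a" "r \<in> E - P - lower P a" using T[OF U] by blast
      then obtain t where "t \<in> U" "t \<in> S" using S(4) by auto
      then show ?thesis using S(3) j by blast
    qed
    then have "in_all_cones j" by (intro in_all_conesI disjI1)
    then show ?thesis using j S(1) by blast
  next
    case False
    then have sub: "lower P a \<subset> lower P b" using ab by blast
    have subs: "lower P a \<subseteq> E - P" "lower P b \<subseteq> E - P" using lower(1)[OF P] ab by blast+
    have cuts: "lower P c = lower P a \<or> lower P c = lower P b" if "c \<in> P" for c using two_cuts[OF P ab(1,2) sub that] .
    have sum: "q m = q l + q r" if m: "m \<in> lower P b - lower P a" and l: "l \<in> lower P a" and r: "r \<in> E - P - lower P b" for l m r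
    proof -
      have 1: "d a l m = \<delta>" "d a l r = \<delta>" using vol[OF ab(1) l] m r sub subs by blast+
      have 2: "d b m r = \<delta>" "d b l r = \<delta>" using vol[OF ab(2)] l m r sub by blast+
      \<comment> \<open>Coplanarity kills the coordinate along \<open>q a\<close>; the determinants
        at \<open>a\<close> and \<open>b\<close> fix the other two as 1.\<close>
      have "D (q m) (q l) (q r) = 0" using flat l m r subs unfolding flat_def by blast
      then have m': "q m = (d a m r / \<delta>) *\<^sub>R q l + q r" using coordinates[of "q a" "q l" "q r" "q m"] 1 \<delta> by simp
      from arg_cong[OF this, of "\<lambda>x. D (q b) x (q r)"] have "d b m r = (d a m r / \<delta>) * d b l r" by (simp add: expand)
      then have "d a m r / \<delta> = 1" using 2 \<delta> by (metis less_irrefl mult_cancel_right2)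
      then show ?thesis using m' by simp
    qed
    obtain l where l: "l \<in> lower P a" using lower(2)[OF P ab(1)] by blast
    obtain r where r: "r \<in> E - P - lower P b" using lower(1,3)[OF P ab(2)] by blast
    obtain m where m: "m \<in> lower P b - lower P a" using sub by blast
    have "q l \<noteq> q m"
    proof
      assume "q l = q m"
      then have "d a l m = 0" by (simp add: rep)
      then show False using vol[OF ab(1) l, of m] m subs \<delta> by auto
    qed
    \<comment> \<open>The lower side of \<open>b\<close> contains \<open>l\<close> and
      \<open>m\<close>, whose classes differ, so the other side is the constant one.\<close>
    then have Rb: "\<forall>x\<in>E - P - lower P b. \<forall>y\<in>E - P - lower P b. q y = q x" using const[OF ab(2)] l m sub by blast
    have "q m \<noteq> q r"
    proof
      assume "q m = q r"
      then have "d b m r = 0" by (simp add: rep)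
      then show False using vol[OF ab(2), of m r] m r \<delta> by auto
    qed
    then have La: "\<forall>x\<in>lower P a. \<forall>y\<in>lower P a. q y = q x" using const[OF ab(1)] m r sub subs by blast
    have M: "q x = q m" if "x \<in> lower P b - lower P a" for x using sum[OF that l r] sum[OF m l r] by simp
    have LR: "q m = q x + q y" if "x \<in> lower P a" "y \<in> E - P - lower P b" for x y using sum[OF m that] .
    have "in_all_cones m"
    proof (rule in_all_conesI)
      fix T assume T: "T \<in> B"
      from meets_primitive[OF P T]
      show "(\<exists>t\<in>T. q m = q t) \<or> (\<exists>t\<in>T. \<exists>t'\<in>T. t \<noteq> t' \<and> q m = q t + q t')"
      proof (elim disjE exE conjE)
        fix c l' r' assume c: "c \<in> P" "l' \<in> lower P c" "r' \<in> E - P - lower P c" "T = {c, l', r'}"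
        show ?thesis
        proof (cases "l' \<in> lower P b - lower P a \<or> r' \<in> lower P b - lower P a")
          case True
          then show ?thesis using c(4) M by (metis insertCI)
        next
          case False
          then have "l' \<in> lower P a" "r' \<in> E - P - lower P b" using cuts[OF c(1)] c(2,3) sub by blast+
          moreover then have "l' \<noteq> r'" using sub by blast
          ultimately show ?thesis using LR[of l' r'] c(4) by blast
        qed
      next
        fix c c' k assume c: "c \<in> P" "c' \<in> P" "T = {c, c', k}" "(k \<in> lower P c) \<noteq> (k \<in> lower P c')"
        then have "k \<in> lower P b - lower P a" using cuts[OF c(1)] cuts[OF c(2)] sub by blast
        then show ?thesis using c(3) M by (metis insertCI)
      qed
    qed
    then show ?thesis using m subs by blast
  qed
qed

end

lemma ex_volume_form:
  assumes "DIM('v::euclidean_space) = 3"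
  shows "\<exists>D :: 'v \<Rightarrow> 'v \<Rightarrow> 'v \<Rightarrow> real. volume_form D \<and> (\<exists>x y z. D x y z \<noteq> 0)"
proof -
  obtain a b c :: 'v where basis: "Basis = {a, b, c}" and ds: "a \<noteq> b" "a \<noteq> c" "b \<noteq> c"
    using assms card_3_iff[of "Basis :: 'v set"] by blast
  define D where "D x y z = (x \<bullet> a) * ((y \<bullet> b) * (z \<bullet> c) - (y \<bullet> c) * (z \<bullet> b))
     - (x \<bullet> b) * ((y \<bullet> a) * (z \<bullet> c) - (y \<bullet> c) * (z \<bullet> a))
     + (x \<bullet> c) * ((y \<bullet> a) * (z \<bullet> b) - (y \<bullet> b) * (z \<bullet> a))" for x y z :: 'v
  have "volume_form D"
  proof
    fix x y z u v w :: 'v and r :: real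
    show "D (x + y) u v = D x u v + D y u v" by (simp add: D_def inner_add_left algebra_simps)
    show "D (r *\<^sub>R x) u v = r * D x u v" by (simp add: D_def algebra_simps)
    show "D x y z = D y z x" by (simp add: D_def algebra_simps)
    show "D y x z = - D x y z" by (simp add: D_def algebra_simps)
    show "D u v w *\<^sub>R y = D y v w *\<^sub>R u + D u y w *\<^sub>R v + D u v y *\<^sub>R w"
    proof (rule euclidean_eqI)
      fix i :: 'v assume "i \<in> Basis"
      then have i: "i = a \<or> i = b \<or> i = c" using basis by blast
      have "D u v w * (y \<bullet> i) = D y v w * (u \<bullet> i) + D u y w * (v \<bullet> i) + D u v y * (w \<bullet> i)"
        using i unfolding D_def by (auto simp: algebra_simps)
      then show "(D u v w *\<^sub>R y) \<bullet> i = (D y v w *\<^sub>R u + D u y w *\<^sub>R v + D u v y *\<^sub>R w) \<bullet> i"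
        by (simp add: inner_add_left)
    qed
  qed
  moreover have "a \<in> Basis" "b \<in> Basis" "c \<in> Basis" using basis by blast+
  then have "D a b c = 1" using ds by (simp add: D_def inner_Basis)
  ultimately show ?thesis by (metis zero_neq_one)
qed

context bunch
begin

lemma ex_dependent_primitive_3:
  assumes "DIM('v) = 3"
  shows "\<exists>P. primitive P \<and> (\<exists>f. linear f \<and> (\<forall>j\<in>E. f (q j) = (if j \<in> P then 1 else 0 :: real))) \<and>
    (\<exists>j\<in>E - P. in_all_cones j)"
proof -
  obtain D :: "'v \<Rightarrow> 'v \<Rightarrow> 'v \<Rightarrow> real" where D: "volume_form D" "\<exists>x y z. D x y z \<noteq> 0"
    using ex_volume_form[OF assms] by blast
  interpret volume_form D by (fact D(1))
  interpret bunch3 E q B D by unfold_locales (rule assms, rule D(2))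
  show ?thesis using ex_flat_primitive flat_functional ex_in_all_cones by blast
qed

section \<open>Picard numbers two and one\<close>

lemma span_singleton_diff:
  assumes "{x, y} \<in> B" "x \<noteq> y" "{z, y} \<in> B" "z \<notin> {x, y}"
  shows "\<exists>\<kappa>. q z = q x + \<kappa> *\<^sub>R q y"
proof -
  have "{x, y} - {x} = {y}" using assms by blast
  then have "q z - q x \<in> span {q y}" using wall[OF assms(1), of x z] assms by simp
  then obtain \<kappa> where "q z - q x = \<kappa> *\<^sub>R q y" by (auto simp: span_singleton)
  then show ?thesis by (intro exI[of _ \<kappa>]) (simp add: algebra_simps)
qed

lemma pair_indep:
  assumes "{x, y} \<in> B" "x \<noteq> y" "\<alpha> *\<^sub>R q x + \<beta> *\<^sub>R q y = 0" shows "\<alpha> = 0" "\<beta> = 0"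
proof -
  let ?c = "\<lambda>t. if t = x then \<alpha> else \<beta>"
  have "(\<Sum>t\<in>{x, y}. ?c t *\<^sub>R q t) = 0" using assms by simp
  from indep[OF assms(1) this, of x] indep[OF assms(1) this, of y] assms(2) show "\<alpha> = 0" "\<beta> = 0" by auto
qed

lemma primitive_nonempty:
  assumes "primitive P" shows "P \<noteq> {}"
proof -
  obtain T where "T \<in> B" using B_nonempty by blast
  then have "T \<inter> P \<noteq> {}" using assms unfolding primitive_def by blast
  then show ?thesis by blast
qed

text \<open>Flipping \<open>l\<close> into a pair that meets \<open>P\<close> only in
  \<open>a\<close> must keep \<open>a\<close>, since the other outcome would miss
  \<open>P\<close>.\<close>

lemma primitive_pairs:
  assumes dim: "DIM('v) = 2" and P: "primitive P" and a: "a \<in> P" and l: "l \<in> E - P"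
  shows "{a, l} \<in> B"
proof -
  obtain T where T: "T \<in> B" "T \<inter> P = {a}" using P a unfolding primitive_def by blast
  obtain x y where "T = {x, y}" "x \<noteq> y" using card_B[OF T(1)] dim by (metis card_2_iff)
  then obtain k where k: "T = {a, k}" "a \<noteq> k" using T(2) by (metis Int_iff insertI1 insert_commute insertE singletonD)
  show ?thesis
  proof (cases "l \<in> T")
    case True then show ?thesis using k T a l by auto
  next
    case False
    obtain t where t: "t \<in> T" "insert l (T - {t}) \<in> B" using flip[OF T(1) _ False] l by blast
    have "t \<noteq> a"
    proof
      assume "t = a"
      then have "{l, k} \<in> B" using t k by (simp add: insert_Diff_if)
      then have "{l, k} \<inter> P \<noteq> {}" using P unfolding primitive_def by blast
      moreover have "k \<notin> P" using T(2) k(2) unfolding k(1) by auto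
      ultimately show False using l by blast
    qed
    then have "{l, a} \<in> B" using t k by (simp add: insert_Diff_if)
    then show ?thesis by (simp add: insert_commute)
  qed
qed

text \<open>All pairs with one element in \<open>P\<close> and one outside are in \<open>B\<close>.
  Different classes on both sides would contradict the independence of such a pair, so the classes
  are constant outside \<open>P\<close> or on \<open>P\<close>; in the latter case the complement of
  \<open>P\<close> takes its place.\<close>

lemma ex_dependent_primitive_2:
  assumes dim: "DIM('v) = 2"
  shows "\<exists>P. primitive P \<and> (\<exists>f. linear f \<and> (\<forall>j\<in>E. f (q j) = (if j \<in> P then 1 else 0 :: real))) \<and>
    (\<exists>j\<in>E - P. in_all_cones j)"
proof -
  have pair: "\<exists>x y. T = {x, y} \<and> x \<noteq> y" if "T \<in> B" for T using card_B[OF that] dim by (metis card_2_iff)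
  have compl: "E - P \<noteq> {}" if P: "primitive P" for P
  proof -
    obtain a where "a \<in> P" using primitive_nonempty[OF P] by blast
    then obtain T where T: "T \<in> B" "T \<inter> P = {a}" using P unfolding primitive_def by blast
    have "\<not> T \<subseteq> P"
    proof
      assume "T \<subseteq> P"
      then have "T = {a}" using T(2) by blast
      then show False using pair[OF T(1)] by auto
    qed
    then show ?thesis using B_subset[OF T(1)] by blast
  qed
  have "\<exists>P. primitive P \<and> (\<forall>l\<in>E - P. \<forall>l'\<in>E - P. q l = q l')"
  proof -
    obtain P where P: "primitive P" using ex_primitive by blast
    show ?thesis
    proof (cases "\<forall>l\<in>E - P. \<forall>l'\<in>E - P. q l = q l'")
      case False
      then obtain l l' where l: "l \<in> E - P" "l' \<in> E - P" "q l \<noteq> q l'" by blast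
      have PE: "P \<subseteq> E" using P by (simp add: primitive_def)
      have const: "q a = q a'" if a: "a \<in> P" "a' \<in> P" for a a'
      proof (rule ccontr)
        assume ne: "q a \<noteq> q a'"
        have ll: "\<exists>\<kappa>. q l' = q l + \<kappa> *\<^sub>R q a"
        proof (rule span_singleton_diff)
          show "{l, a} \<in> B" "{l', a} \<in> B"
            using primitive_pairs[OF dim P a(1) l(1)] primitive_pairs[OF dim P a(1) l(2)] by (simp_all add: insert_commute)
          show "l \<noteq> a" "l' \<notin> {l, a}" using l a by auto
        qed
        then obtain \<kappa> where \<kappa>: "q l' = q l + \<kappa> *\<^sub>R q a" by blast
        have "\<exists>\<kappa>. q a' = q a + \<kappa> *\<^sub>R q k" if k: "k \<in> E - P" for k
          by (rule span_singleton_diff[OF primitive_pairs[OF dim P a(1) k] _ primitive_pairs[OF dim P a(2) k]])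
            (use k a ne in auto)
        then obtain \<mu> \<mu>' where \<mu>: "q a' = q a + \<mu> *\<^sub>R q l" "q a' = q a + \<mu>' *\<^sub>R q l'" using l by meson
        then have "(\<mu>' * \<kappa>) *\<^sub>R q a + (\<mu>' - \<mu>) *\<^sub>R q l = 0" using \<kappa> by (simp add: algebra_simps)
        then have "\<mu>' * \<kappa> = 0" "\<mu>' - \<mu> = 0" using pair_indep[OF primitive_pairs[OF dim P a(1) l(1)]] a l by blast+
        then show False using \<kappa> \<mu> l ne by auto
      qed
      have "T \<inter> (E - P) \<noteq> {}" if T: "T \<in> B" for T
      proof
        assume "T \<inter> (E - P) = {}"
        obtain x y where xy: "T = {x, y}" "x \<noteq> y" using pair[OF T] by blast
        have "x \<in> P" "y \<in> P" using \<open>T \<inter> (E - P) = {}\<close> B_subset[OF T] xy by auto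
        then have "1 *\<^sub>R q x + (-1) *\<^sub>R q y = 0" using const[of x y] by simp
        then have "(1::real) = 0" by (rule pair_indep(1)[OF T[unfolded xy(1)] xy(2)])
        then show False by simp
      qed
      moreover have "\<exists>T\<in>B. T \<inter> (E - P) = {k}" if k: "k \<in> E - P" for k
      proof -
        obtain a where a: "a \<in> P" using primitive_nonempty[OF P] by blast
        have "{a, k} \<inter> (E - P) = {k}" using a k by auto
        then show ?thesis using primitive_pairs[OF dim P a k] by blast
      qed
      ultimately have "primitive (E - P)" by (simp add: primitive_def)
      moreover have "E - (E - P) = P" using PE by blast
      ultimately show ?thesis using const by metis
    qed (use P in blast)
  qed
  then obtain P where P: "primitive P" and const: "\<And>l l'. l \<in> E - P \<Longrightarrow> l' \<in> E - P \<Longrightarrow> q l = q l'" by blast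
  obtain l where l: "l \<in> E - P" using compl[OF P] by blast
  obtain a where a: "a \<in> P" using primitive_nonempty[OF P] by blast
  have al: "{a, l} \<in> B" "a \<noteq> l" using primitive_pairs[OF dim P a l] a l by auto
  have ne: "q a \<noteq> q l" using pair_indep[OF al, of 1 "-1"] by auto
  have "independent {q a, q l}"
  proof -
    have "q a \<notin> span {q l}"
    proof
      assume "q a \<in> span {q l}"
      then obtain k where "q a = k *\<^sub>R q l" by (auto simp: span_singleton)
      then show False using pair_indep[OF al, of 1 "-k"] by simp
    qed
    moreover have "q l \<noteq> 0" using pair_indep[OF al, of 0 1] by auto
    ultimately show ?thesis by (simp add: independent_insert)
  qed
  then obtain f where f: "linear f" "\<forall>x\<in>{q a, q l}. f x = (if x = q a then 1 else 0 :: real)"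
    using linear_independent_extend[where f = "\<lambda>x. if x = q a then 1 else 0"] by metis
  have fa: "f (q a) = 1" and fl: "f (q l) = 0" using f(2) ne by auto
  have "f (q j) = (if j \<in> P then 1 else 0)" if j: "j \<in> E" for j
  proof (cases "j \<in> P")
    case True
    have "\<exists>\<kappa>. q j = q a + \<kappa> *\<^sub>R q l"
    proof (cases "j = a")
      case False
      then show ?thesis using span_singleton_diff[OF al primitive_pairs[OF dim P True l]] True l by auto
    qed (auto intro: exI[of _ 0])
    then show ?thesis using True f(1) fa fl by (auto simp: linear_add linear_scale)
  next
    case False
    then show ?thesis using const[of j l] j l fl by simp
  qed
  moreover have "in_all_cones l"
  proof (rule in_all_conesI)
    fix T assume T: "T \<in> B"
    obtain x y where xy: "T = {x, y}" "x \<noteq> y" using pair[OF T] by blast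
    have "T \<inter> (E - P) \<noteq> {}"
    proof
      assume "T \<inter> (E - P) = {}"
      then have xyP: "x \<in> P" "y \<in> P" using B_subset[OF T] xy by auto
      have xl: "{x, l} \<in> B" "{y, l} \<in> B" "{y, x} \<in> B" "{l, x} \<in> B" "{l, y} \<in> B" "{x, y} \<in> B"
        using primitive_pairs[OF dim P xyP(1) l] primitive_pairs[OF dim P xyP(2) l] T xy(1)
        by (simp_all add: insert_commute)
      have lxy: "l \<noteq> x" "l \<noteq> y" using l xyP by auto
      \<comment> \<open>All three pairs among \<open>x\<close>, \<open>y\<close>, \<open>l\<close>
        would be in \<open>B\<close>. Their relations force \<open>q l = q x + q y\<close> and then
        both \<nu> = 1 and \<nu> = -1, a planar form of \<open>no_triangle\<close>.\<close>
      obtain \<kappa> where 1: "q l = q x + \<kappa> *\<^sub>R q y" using span_singleton_diff[OF xl(6) xy(2) xl(5)] lxy by auto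
      obtain \<mu> where 2: "q l = q y + \<mu> *\<^sub>R q x" using span_singleton_diff[OF xl(3) _ xl(4)] xy(2) lxy by auto
      obtain \<nu> where 3: "q y = q x + \<nu> *\<^sub>R q l" using span_singleton_diff[OF xl(1) _ xl(2)] xy(2) lxy by auto
      have "(1 - \<mu>) *\<^sub>R q x + (\<kappa> - 1) *\<^sub>R q y = 0" using 1 2 by (simp add: algebra_simps)
      then have k: "\<kappa> = 1" using pair_indep(2)[OF xl(6) xy(2)] by fastforce
      have "q l = q x + q y" using 1 k by simp
      then have "q y = q x + \<nu> *\<^sub>R (q x + q y)" using 3 by metis
      moreover have "(1 + \<nu>) *\<^sub>R q x + (\<nu> - 1) *\<^sub>R q y = (q x + \<nu> *\<^sub>R (q x + q y)) - q y"
        by (simp add: algebra_simps)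
      ultimately have "(1 + \<nu>) *\<^sub>R q x + (\<nu> - 1) *\<^sub>R q y = 0" by simp
      then have "1 + \<nu> = 0" "\<nu> - 1 = 0" using pair_indep[OF xl(6) xy(2)] by blast+
      then show False by simp
    qed
    then obtain t where "t \<in> T" "t \<in> E - P" by blast
    then have "\<exists>t\<in>T. q l = q t" using const[OF l, of t] by blast
    then show "(\<exists>t\<in>T. q l = q t) \<or> (\<exists>t\<in>T. \<exists>t'\<in>T. t \<noteq> t' \<and> q l = q t + q t')" ..
  qed
  ultimately have "\<forall>j\<in>E. f (q j) = (if j \<in> P then 1 else 0)" "in_all_cones l" by blast+
  then show ?thesis using P f(1) l by metis
qed

text \<open>This is the case of projective space: all rays have the same class, and the primitive
  collection is \<open>E\<close> itself, which leaves no \<open>j\<close> outside it.\<close>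

lemma ex_dependent_primitive_1:
  assumes dim: "DIM('v) = 1"
  shows "\<exists>P. primitive P \<and> (\<exists>f. linear f \<and> (\<forall>j\<in>E. f (q j) = (if j \<in> P then 1 else 0 :: real)))"
proof -
  have single: "\<exists>x. T = {x}" if "T \<in> B" for T using card_B[OF that] dim by (metis card_1_singletonE)
  obtain t where t: "{t} \<in> B" using B_nonempty single by blast
  have tE: "t \<in> E" using B_subset[OF t] by blast
  have all: "{j} \<in> B \<and> q j = q t" if j: "j \<in> E" for j
  proof (cases "j = t")
    case False
    then have "{j} \<in> B" using flip[OF t j] by auto
    then show ?thesis using wall[OF t, of t j] False by auto
  qed (use t in blast)
  have "primitive E"
    unfolding primitive_def using single B_subset all by blast
  moreover have "q t \<noteq> 0" using indep[OF t, of "\<lambda>_. 1" t] by auto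
  then have "independent {q t}" by simp
  then obtain f where "linear f" "\<forall>x\<in>{q t}. f x = (1 :: real)"
    using linear_independent_extend[of "{q t}" "\<lambda>_. 1"] by blast
  ultimately show ?thesis using all by (intro exI[of _ E]) auto
qed

theorem ex_dependent_primitive:
  assumes "DIM('v) \<le> 3"
  shows "\<exists>P. primitive P \<and> (\<exists>f. linear f \<and> (\<forall>j\<in>E. f (q j) = (if j \<in> P then 1 else 0 :: real))) \<and>
    (DIM('v) \<noteq> 1 \<longrightarrow> (\<exists>j\<in>E - P. in_all_cones j))"
proof -
  consider "DIM('v) = 1" | "DIM('v) = 2" | "DIM('v) = 3" using assms DIM_positive[where 'a='v] by linarith
  then show ?thesis
    using ex_dependent_primitive_1 ex_dependent_primitive_2 ex_dependent_primitive_3 by cases blast+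
qed

end

section \<open>Simplicial cones and smooth complete fans\<close>

lemma convex_cone_hull_sum:
  assumes "finite S" "\<And>s. s \<in> S \<Longrightarrow> c s \<ge> 0"
  shows "(\<Sum>s\<in>S. c s *\<^sub>R s) \<in> convex_cone hull S"
proof -
  have "(\<Sum>s\<in>T. c s *\<^sub>R s) \<in> convex_cone hull S" if "T \<subseteq> S" for T
    using finite_subset[OF that assms(1)] that
  proof (induction T)
    case empty then show ?case by (simp add: convex_cone_hull_contains_0)
  next
    case (insert x T)
    then have "c x *\<^sub>R x \<in> convex_cone hull S" using assms(2) by (simp add: convex_cone_hull_mul hull_inc)
    then show ?case using insert by (simp add: convex_cone_hull_add)
  qed
  then show ?thesis by blast
qed

lemma convex_cone_hull_finite:
  fixes S :: "'a::real_vector set"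
  assumes "finite S"
  shows "convex_cone hull S = {\<Sum>s\<in>S. c s *\<^sub>R s | c. \<forall>s\<in>S. c s \<ge> 0}" (is "_ = ?R")
proof
  show "?R \<subseteq> convex_cone hull S" using convex_cone_hull_sum[OF assms] by blast
  show "convex_cone hull S \<subseteq> ?R"
  proof (rule hull_minimal)
    show "S \<subseteq> ?R"
    proof
      fix x assume "x \<in> S"
      then have "x = (\<Sum>s\<in>S. (if s = x then 1 else 0) *\<^sub>R s)"
        using assms by (simp add: if_distrib[of "\<lambda>c. c *\<^sub>R _"] cong: if_cong)
      then show "x \<in> ?R" by (intro CollectI exI[of _ "\<lambda>s. if s = x then 1 else 0"]) simp
    qed
    show "convex_cone ?R"
      unfolding convex_cone_iff
    proof (intro conjI ballI allI impI)
      show "0 \<in> ?R" by (intro CollectI exI[of _ "\<lambda>_. 0"]) simp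
    next
      fix x y assume "x \<in> ?R" "y \<in> ?R"
      then obtain c d where "x = (\<Sum>s\<in>S. c s *\<^sub>R s)" "y = (\<Sum>s\<in>S. d s *\<^sub>R s)" "\<forall>s\<in>S. c s \<ge> 0" "\<forall>s\<in>S. d s \<ge> 0" by blast
      then show "x + y \<in> ?R"
        by (intro CollectI exI[of _ "\<lambda>s. c s + d s"]) (simp add: scaleR_add_left sum.distrib)
    next
      fix x and t :: real assume "x \<in> ?R" "t \<ge> 0"
      then obtain c where "x = (\<Sum>s\<in>S. c s *\<^sub>R s)" "\<forall>s\<in>S. c s \<ge> 0" by blast
      then show "t *\<^sub>R x \<in> ?R" using \<open>t \<ge> 0\<close>
        by (intro CollectI exI[of _ "\<lambda>s. t * c s"]) (simp add: scaleR_sum_right)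
    qed
  qed
qed

lemma independent_coeff_eq:
  assumes "independent S" "finite S" "(\<Sum>s\<in>S. c s *\<^sub>R s) = (\<Sum>s\<in>S. d s *\<^sub>R s)" "s \<in> S"
  shows "c s = d s"
proof -
  have "(\<Sum>s\<in>S. (c s - d s) *\<^sub>R s) = 0" using assms(3) by (simp add: scaleR_diff_left sum_subtractf)
  from independentD[OF assms(1,2) order_refl this assms(4)] have "c s - d s = 0" .
  then show ?thesis by simp
qed

text \<open>A nonzero \<open>x\<close> lies strictly between 0 and s x for s > 1, so the face
  contains both ends; convexity supplies the multiples up to 1.\<close>

lemma face_of_scale:
  assumes F: "F face_of C" and C: "convex_cone C" and x: "x \<in> F" and t: "t \<ge> 0"
  shows "t *\<^sub>R x \<in> F"
proof (cases "x = 0")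
  case True then show ?thesis using x by simp
next
  case False
  have xC: "x \<in> C" using F x face_of_imp_subset by blast
  have *: "s *\<^sub>R x \<in> C" if "s \<ge> 0" for s using C xC that by (simp add: convex_cone_scaleR)
  have seg: "x \<in> open_segment 0 (s *\<^sub>R x)" if "s > 1" for s
    unfolding in_segment using that False by (intro conjI exI[of _ "1/s"]) auto
  have out: "0 \<in> F" "s *\<^sub>R x \<in> F" if "s > 1" for s
    using face_ofD[OF F seg[OF that] _ _ x] *[of 0] *[of s] that by auto
  show ?thesis
  proof (cases "t > 1")
    case True then show ?thesis by (rule out(2))
  next
    case False
    have "(1 - t) *\<^sub>R 0 + t *\<^sub>R x \<in> F"
      using convexD[OF face_of_imp_convex[OF F] out(1)[of 2] x, of "1 - t" t] t False by simp
    then show ?thesis by simp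
  qed
qed

text \<open>\<open>x + y\<close> is the midpoint of 2x and 2y.\<close>

lemma face_of_summand:
  assumes F: "F face_of C" and C: "convex_cone C" and xy: "x \<in> C" "y \<in> C" "x + y \<in> F"
  shows "x \<in> F"
proof -
  have "2 *\<^sub>R x \<in> F"
  proof (cases "x = y")
    case True then show ?thesis using xy by (simp add: scaleR_2)
  next
    case False
    then have "x + y \<in> open_segment (2 *\<^sub>R x) (2 *\<^sub>R y)"
      unfolding in_segment by (intro conjI exI[of _ "1/2"]) auto
    then show ?thesis using face_ofD[OF F _ _ _ xy(3)] C xy by (simp add: convex_cone_scaleR)
  qed
  then show ?thesis using face_of_scale[OF F C, of "2 *\<^sub>R x" "1/2"] by simp
qed

lemma face_of_sum_member:
  assumes F: "F face_of convex_cone hull S" and S: "finite S" and c: "\<And>s. s \<in> S \<Longrightarrow> c s \<ge> 0"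
    and sum: "(\<Sum>s\<in>S. c s *\<^sub>R s) \<in> F" and s: "s \<in> S" "c s > 0"
  shows "s \<in> F"
proof -
  have C: "convex_cone (convex_cone hull S)" by (rule convex_cone_convex_cone_hull)
  have "(\<Sum>t\<in>S. (if t = s then 0 else c t) *\<^sub>R t) \<in> convex_cone hull S"
    by (rule convex_cone_hull_sum) (use S c in auto)
  moreover have "(\<Sum>t\<in>S. c t *\<^sub>R t) = c s *\<^sub>R s + (\<Sum>t\<in>S. (if t = s then 0 else c t) *\<^sub>R t)"
    using S s by (simp add: sum.remove[OF S s(1)])
  moreover have "c s *\<^sub>R s \<in> convex_cone hull S" using s by (simp add: convex_cone_hull_mul hull_inc)
  ultimately have "c s *\<^sub>R s \<in> F" using face_of_summand[OF F C] sum by simp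
  then show ?thesis using face_of_scale[OF F C, of "c s *\<^sub>R s" "1 / c s"] s by simp
qed

lemma simplicial_face:
  assumes "independent S" "finite S" "S' \<subseteq> S"
  shows "convex_cone hull S' face_of convex_cone hull S"
  unfolding face_of_def
proof (intro conjI ballI impI)
  show "convex_cone hull S' \<subseteq> convex_cone hull S" using assms(3) by (rule hull_mono)
  show "convex (convex_cone hull S')" by (rule convex_convex_cone_hull)
  fix a b x assume a: "a \<in> convex_cone hull S" and b: "b \<in> convex_cone hull S" and x: "x \<in> convex_cone hull S'"
    and seg: "x \<in> open_segment a b"
  have fin': "finite S'" using assms finite_subset by blast
  obtain \<alpha> where \<alpha>: "a = (\<Sum>s\<in>S. \<alpha> s *\<^sub>R s)" "\<forall>s\<in>S. \<alpha> s \<ge> 0" using a convex_cone_hull_finite[OF assms(2)] by blast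
  obtain \<beta> where \<beta>: "b = (\<Sum>s\<in>S. \<beta> s *\<^sub>R s)" "\<forall>s\<in>S. \<beta> s \<ge> 0" using b convex_cone_hull_finite[OF assms(2)] by blast
  obtain \<gamma> where \<gamma>: "x = (\<Sum>s\<in>S'. \<gamma> s *\<^sub>R s)" using x convex_cone_hull_finite[OF fin'] by blast
  obtain u where u: "0 < u" "u < 1" "x = (1 - u) *\<^sub>R a + u *\<^sub>R b" using seg unfolding in_segment by blast
  have x1: "x = (\<Sum>s\<in>S. ((1 - u) * \<alpha> s + u * \<beta> s) *\<^sub>R s)"
    unfolding u(3) \<alpha> \<beta> by (simp add: scaleR_sum_right scaleR_add_left sum.distrib)
  have x2: "x = (\<Sum>s\<in>S. (if s \<in> S' then \<gamma> s else 0) *\<^sub>R s)"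
    unfolding \<gamma> using assms(2,3) by (intro sum.mono_neutral_cong_left) auto
  have *: "(1 - u) * \<alpha> s + u * \<beta> s = (if s \<in> S' then \<gamma> s else 0)" if "s \<in> S" for s
    by (rule independent_coeff_eq[OF assms(1,2) _ that]) (rule trans[OF x1[symmetric] x2])
  have 0: "\<alpha> s = 0 \<and> \<beta> s = 0" if "s \<in> S - S'" for s
  proof -
    have "(1 - u) * \<alpha> s + u * \<beta> s = 0" using *[of s] that by auto
    moreover have "(1 - u) * \<alpha> s \<ge> 0" "u * \<beta> s \<ge> 0" using u \<alpha> \<beta> that by auto
    ultimately have "(1 - u) * \<alpha> s = 0" "u * \<beta> s = 0" by linarith+
    then show ?thesis using u by auto
  qed
  have "a = (\<Sum>s\<in>S'. \<alpha> s *\<^sub>R s)" "b = (\<Sum>s\<in>S'. \<beta> s *\<^sub>R s)"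
    unfolding \<alpha>(1) \<beta>(1) using assms(2,3) 0 by (auto intro!: sum.mono_neutral_right)
  moreover have "(\<Sum>s\<in>S'. \<alpha> s *\<^sub>R s) \<in> convex_cone hull S'" "(\<Sum>s\<in>S'. \<beta> s *\<^sub>R s) \<in> convex_cone hull S'"
    by (rule convex_cone_hull_sum[OF fin']; use \<alpha>(2) \<beta>(2) assms(3) in auto)+
  ultimately show "a \<in> convex_cone hull S'" "b \<in> convex_cone hull S'" by simp_all
qed

abbreviation ray :: "'a::real_vector \<Rightarrow> 'a set" where
  "ray s \<equiv> convex_cone hull {s}"

lemma ray_eq: "ray s = {t *\<^sub>R s | t. t \<ge> 0}"
  by (subst convex_cone_hull_finite) auto

lemma dim_ray:
  fixes s :: "'a::euclidean_space"
  assumes "s \<noteq> 0" shows "dim (ray s) = 1"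
proof -
  have "ray s \<subseteq> span {s}" by (auto simp: ray_eq span_singleton)
  then have "dim (ray s) \<le> dim {s}" by (metis dim_span dim_subset)
  moreover have "dim {s} \<le> dim (ray s)" by (rule dim_subset) (simp add: hull_inc)
  ultimately show ?thesis using assms by (simp add: dim_singleton)
qed

lemma cone_rays_simplicial:
  fixes S :: "(real^'n) set"
  assumes "independent S" "finite S"
  shows "cone_rays (convex_cone hull S) = ray ` S"
proof
  have C: "convex_cone (convex_cone hull S)" by (rule convex_cone_convex_cone_hull)
  show "ray ` S \<subseteq> cone_rays (convex_cone hull S)"
  proof
    fix \<rho> assume "\<rho> \<in> ray ` S"
    then obtain s where s: "s \<in> S" "\<rho> = ray s" by blast
    have "s \<noteq> 0" using s assms(1) dependent_zero by blast
    then have "dim (ray s) = 1" by (rule dim_ray)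
    moreover have "ray s face_of convex_cone hull S" using simplicial_face[OF assms] s by simp
    ultimately show "\<rho> \<in> cone_rays (convex_cone hull S)" using s by (simp add: cone_rays_def)
  qed
  show "cone_rays (convex_cone hull S) \<subseteq> ray ` S"
  proof
    fix \<rho> assume "\<rho> \<in> cone_rays (convex_cone hull S)"
    then have F: "\<rho> face_of convex_cone hull S" and dim: "dim \<rho> = 1" by (auto simp: cone_rays_def)
    have "\<not> \<rho> \<subseteq> {0}" using dim dim_subset[of \<rho> "{0}"] by auto
    then obtain x where x: "x \<in> \<rho>" "x \<noteq> 0" by blast
    have "x \<in> convex_cone hull S" using F x face_of_imp_subset by blast
    then obtain c where c: "x = (\<Sum>s\<in>S. c s *\<^sub>R s)" "\<forall>s\<in>S. c s \<ge> 0" using convex_cone_hull_finite[OF assms(2)] by blast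
    have "\<exists>s\<in>S. c s \<noteq> 0"
    proof (rule ccontr)
      assume "\<not> ?thesis"
      then have "x = 0" unfolding c(1) by simp
      then show False using x by simp
    qed
    then obtain s where s: "s \<in> S" "c s > 0" using c(2) by force
    have s\<rho>: "s \<in> \<rho>"
      by (rule face_of_sum_member[where c = c, OF F assms(2) _ _ s]) (use c x in auto)
    have s0: "s \<noteq> 0" using s assms(1) dependent_zero by blast
    have "\<rho> \<subseteq> span {s}" using card_ge_dim_independent[of "{s}" \<rho>] s\<rho> s0 dim by simp
    have "\<rho> = ray s"
    proof
      show "ray s \<subseteq> \<rho>" using face_of_scale[OF F C s\<rho>] by (auto simp: ray_eq)
      show "\<rho> \<subseteq> ray s"
      proof
        fix y assume y: "y \<in> \<rho>"
        then obtain t where t: "y = t *\<^sub>R s" using \<open>\<rho> \<subseteq> span {s}\<close> by (auto simp: span_singleton)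
        have "y \<in> convex_cone hull S" using F y face_of_imp_subset by blast
        then obtain d where d: "y = (\<Sum>s\<in>S. d s *\<^sub>R s)" "\<forall>s\<in>S. d s \<ge> 0" using convex_cone_hull_finite[OF assms(2)] by blast
        have "y = (\<Sum>u\<in>S. (if u = s then t else 0) *\<^sub>R u)"
          using assms(2) s t by (simp add: if_distrib[of "\<lambda>c. c *\<^sub>R _"] cong: if_cong)
        then have "d s = t" using independent_coeff_eq[OF assms, of d "\<lambda>u. if u = s then t else 0" s] d s by simp
        then have "t \<ge> 0" using d(2) s(1) by blast
        then show "y \<in> ray s" unfolding ray_eq t by blast
      qed
    qed
    then show "\<rho> \<in> ray ` S" using s by blast
  qed
qed

section \<open>Lattice bases and primitive generators\<close>

lemma lattice_basisD:
  fixes Bs :: "(real^'n) set"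
  assumes "lattice_basis Bs"
  shows "finite Bs" "independent Bs" "Bs \<subseteq> lattice_points" "card Bs = CARD('n)"
    "x \<in> lattice_points \<Longrightarrow> \<exists>k :: real^'n \<Rightarrow> int. x = (\<Sum>b\<in>Bs. of_int (k b) *\<^sub>R b)"
proof -
  show fin: "finite Bs" and ind: "independent Bs" using assms by (auto simp: lattice_basis_def)
  have eq: "lattice_points = {\<Sum>b\<in>Bs. of_int (k b) *\<^sub>R b | k :: real^'n \<Rightarrow> int. True}"
    using assms by (simp add: lattice_basis_def)
  show "Bs \<subseteq> lattice_points"
  proof
    fix x assume "x \<in> Bs"
    then have "x = (\<Sum>b\<in>Bs. of_int (if b = x then 1 else 0) *\<^sub>R b)"
      using fin by (simp add: if_distrib[of "\<lambda>c. of_int c *\<^sub>R _"] cong: if_cong)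
    then show "x \<in> lattice_points" unfolding eq by (intro CollectI exI[of _ "\<lambda>b. if b = x then 1 else 0"]) simp
  qed
  show "x \<in> lattice_points \<Longrightarrow> \<exists>k :: real^'n \<Rightarrow> int. x = (\<Sum>b\<in>Bs. of_int (k b) *\<^sub>R b)" unfolding eq by blast
  have "(Basis :: (real^'n) set) \<subseteq> lattice_points"
    by (auto simp: Basis_vec_def lattice_points_def axis_def)
  also have "lattice_points \<subseteq> span Bs" unfolding eq by (auto intro: span_sum span_scale span_base)
  finally have "span (Basis :: (real^'n) set) \<subseteq> span Bs" by (rule span_minimal) (rule subspace_span)
  then have "span Bs = UNIV" by auto
  then have "dim Bs = CARD('n)" by (metis DIM_cart DIM_real dim_UNIV dim_span mult.right_neutral)
  then show "card Bs = CARD('n)" using ind by (simp add: dim_eq_card_independent)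
qed

text \<open>Coordinates in the lattice basis identify the lattice points of the ray with the natural
  multiples of \<open>b\<close>. Any other generator of this set is \<open>b\<close> again, because
  1 has only the trivial factorization in the natural numbers.\<close>

lemma prim_gen_ray:
  fixes b :: "real^'n"
  assumes Bs: "lattice_basis Bs" and b: "b \<in> Bs"
  shows "prim_gen (ray b) = b"
proof -
  note L = lattice_basisD[OF Bs]
  have b0: "b \<noteq> 0" using L(2) b dependent_zero by blast
  have eq: "ray b \<inter> lattice_points = {of_nat k *\<^sub>R b | k :: nat. True}"
  proof
    show "{of_nat k *\<^sub>R b | k :: nat. True} \<subseteq> ray b \<inter> lattice_points"
    proof -
      have "b \<in> lattice_points" using L(3) b by blast
      then show ?thesis by (auto simp: ray_eq lattice_points_def)
    qed
    show "ray b \<inter> lattice_points \<subseteq> {of_nat k *\<^sub>R b | k :: nat. True}"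
    proof
      fix x assume x: "x \<in> ray b \<inter> lattice_points"
      then obtain t where t: "x = t *\<^sub>R b" "t \<ge> 0" by (auto simp: ray_eq)
      obtain k :: "real^'n \<Rightarrow> int" where k: "x = (\<Sum>b\<in>Bs. of_int (k b) *\<^sub>R b)" using L(5) x by blast
      have "x = (\<Sum>u\<in>Bs. (if u = b then t else 0) *\<^sub>R u)"
        using L(1) b t by (simp add: if_distrib[of "\<lambda>c. c *\<^sub>R _"] cong: if_cong)
      then have "of_int (k b) = t"
        using independent_coeff_eq[OF L(2,1), of "\<lambda>b. of_int (k b)" "\<lambda>u. if u = b then t else 0" b] k b by simp
      then have "t = of_nat (nat (k b))" using t(2) by auto
      then show "x \<in> {of_nat k *\<^sub>R b | k :: nat. True}" using t by blast
    qed
  qed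
  show ?thesis
    unfolding prim_gen_def eq
  proof (rule the_equality)
    show "b \<noteq> 0 \<and> {of_nat k *\<^sub>R b | k :: nat. True} = {of_nat k *\<^sub>R b | k :: nat. True}" using b0 by simp
    fix v assume v: "v \<noteq> 0 \<and> {of_nat k *\<^sub>R b | k :: nat. True} = {of_nat k *\<^sub>R v | k :: nat. True}"
    have "of_nat 1 *\<^sub>R b \<in> {of_nat k *\<^sub>R v | k :: nat. True}" using v by blast
    then obtain k :: nat where k: "b = of_nat k *\<^sub>R v" by auto
    have "of_nat 1 *\<^sub>R v \<in> {of_nat k *\<^sub>R b | k :: nat. True}" using v by blast
    then obtain l :: nat where l: "v = of_nat l *\<^sub>R b" by auto
    have "(of_nat (k * l) :: real) *\<^sub>R b = 1 *\<^sub>R b" using k l by simp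
    then have "of_nat (k * l) = (1 :: real)" using b0 by (metis scaleR_cancel_right)
    then have "k * l = 1" by (metis of_nat_1_eq_iff)
    then have "l = 1" by simp
    then show "v = b" using l by simp
  qed
qed

section \<open>Cones of a smooth complete fan\<close>

locale smooth_fan =
  fixes \<Delta> :: "(real^'n) set set"
  assumes regular: "regular_fan \<Delta>" and complete: "complete_fan \<Delta>"
begin

abbreviation v :: "(real^'n) set \<Rightarrow> real^'n" where "v \<equiv> prim_gen"

lemma fan: "is_fan \<Delta>" and covers: "\<Union>\<Delta> = UNIV"
  using complete by (auto simp: complete_fan_def)

lemma finite_fan: "finite \<Delta>"
  using fan by (simp add: is_fan_def)

lemma face_in_fan: "\<sigma> \<in> \<Delta> \<Longrightarrow> \<tau> face_of \<sigma> \<Longrightarrow> \<tau> \<noteq> {} \<Longrightarrow> \<tau> \<in> \<Delta>"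
  using fan unfolding is_fan_def by blast

lemma inter_face: "\<sigma> \<in> \<Delta> \<Longrightarrow> \<tau> \<in> \<Delta> \<Longrightarrow> (\<sigma> \<inter> \<tau>) face_of \<sigma>"
  using fan unfolding is_fan_def by blast

lemma cone_structure:
  assumes "\<sigma> \<in> \<Delta>"
  obtains Bs where "lattice_basis Bs" "v ` cone_rays \<sigma> \<subseteq> Bs" "inj_on v (cone_rays \<sigma>)"
    "\<sigma> = convex_cone hull (v ` cone_rays \<sigma>)" "\<And>\<rho>. \<rho> \<in> cone_rays \<sigma> \<Longrightarrow> \<rho> = ray (v \<rho>)"
proof -
  obtain Bs S where B: "lattice_basis Bs" "S \<subseteq> Bs" "\<sigma> = convex_cone hull S"
    using regular assms unfolding regular_fan_def by blast
  note L = lattice_basisD[OF B(1)]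
  have fin: "finite S" and ind: "independent S" using L B(2) finite_subset independent_mono by blast+
  have C: "cone_rays \<sigma> = ray ` S" using cone_rays_simplicial[OF ind fin] B(3) by simp
  have v: "v (ray s) = s" if "s \<in> S" for s using prim_gen_ray[OF B(1)] B(2) that by blast
  then have vC: "v ` cone_rays \<sigma> = S" unfolding C by (force simp: image_image)
  show ?thesis
  proof (rule that[OF B(1)])
    show "v ` cone_rays \<sigma> \<subseteq> Bs" using vC B(2) by simp
    show "inj_on v (cone_rays \<sigma>)" unfolding C using v by (auto intro!: inj_onI)
    show "\<sigma> = convex_cone hull (v ` cone_rays \<sigma>)" using vC B(3) by simp
    show "\<rho> = ray (v \<rho>)" if "\<rho> \<in> cone_rays \<sigma>" for \<rho> using that v unfolding C by auto
  qed
qed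

lemma inj_v_cone: "\<sigma> \<in> \<Delta> \<Longrightarrow> inj_on v (cone_rays \<sigma>)"
  by (metis cone_structure)

lemma cone_eq: "\<sigma> \<in> \<Delta> \<Longrightarrow> \<sigma> = convex_cone hull (v ` cone_rays \<sigma>)"
  by (metis cone_structure)

lemma independent_v: "\<sigma> \<in> \<Delta> \<Longrightarrow> independent (v ` cone_rays \<sigma>)"
  by (metis cone_structure lattice_basisD(2) independent_mono)

lemma finite_cone_rays: "\<sigma> \<in> \<Delta> \<Longrightarrow> finite (cone_rays \<sigma>)"
  by (metis cone_structure lattice_basisD(1) finite_subset finite_imageD)

lemma card_cone_rays: assumes "\<sigma> \<in> \<Delta>" shows "card (cone_rays \<sigma>) \<le> CARD('n)"
proof -
  obtain Bs where B: "lattice_basis Bs" "v ` cone_rays \<sigma> \<subseteq> Bs" "inj_on v (cone_rays \<sigma>)"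
    using assms by (rule cone_structure)
  then have "card (v ` cone_rays \<sigma>) \<le> card Bs" using lattice_basisD(1) by (intro card_mono)
  then show ?thesis using lattice_basisD(4)[OF B(1)] B(3) by (simp add: card_image)
qed

lemma cone_rays_subset: assumes "\<sigma> \<in> \<Delta>" shows "cone_rays \<sigma> \<subseteq> rays \<Delta>"
proof
  fix \<rho> assume "\<rho> \<in> cone_rays \<sigma>"
  then have "\<rho> face_of \<sigma>" "dim \<rho> = 1" by (auto simp: cone_rays_def)
  moreover have "\<rho> \<noteq> {}" using calculation(2) by auto
  ultimately show "\<rho> \<in> rays \<Delta>" using face_in_fan[OF assms] by (simp add: rays_def)
qed

lemma ray_in_cone_rays:
  assumes "\<sigma> \<in> \<Delta>" "\<rho> \<in> rays \<Delta>" "\<rho> \<subseteq> \<sigma>" shows "\<rho> \<in> cone_rays \<sigma>"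
proof -
  have "\<rho> \<in> \<Delta>" "dim \<rho> = 1" using assms by (auto simp: rays_def)
  moreover have "\<sigma> \<inter> \<rho> = \<rho>" using assms(3) by blast
  ultimately show ?thesis using inter_face[OF assms(1), of \<rho>] by (simp add: cone_rays_def)
qed

lemma ray_v: assumes "\<rho> \<in> rays \<Delta>" shows "\<rho> = ray (v \<rho>)" "v \<rho> \<noteq> 0" "v \<rho> \<in> lattice_points"
proof -
  have \<rho>: "\<rho> \<in> \<Delta>" using assms by (simp add: rays_def)
  have C: "\<rho> \<in> cone_rays \<rho>" using ray_in_cone_rays[OF \<rho> assms] by simp
  obtain Bs where B: "lattice_basis Bs" "v ` cone_rays \<rho> \<subseteq> Bs" "\<And>\<tau>. \<tau> \<in> cone_rays \<rho> \<Longrightarrow> \<tau> = ray (v \<tau>)"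
    using cone_structure[OF \<rho>] by metis
  show "\<rho> = ray (v \<rho>)" using B(3) C by blast
  have "v \<rho> \<in> Bs" using B(2) C by blast
  then show "v \<rho> \<noteq> 0" "v \<rho> \<in> lattice_points" using lattice_basisD(2,3)[OF B(1)] dependent_zero[of Bs] by (metis, blast)
qed

lemma v_in_cone: assumes "\<sigma> \<in> \<Delta>" "\<rho> \<in> rays \<Delta>" "v \<rho> \<in> \<sigma>" shows "\<rho> \<in> cone_rays \<sigma>"
proof (rule ray_in_cone_rays[OF assms(1,2)])
  have "ray (v \<rho>) \<subseteq> \<sigma>" using cone_eq[OF assms(1)] assms(3)
    by (metis convex_cone_convex_cone_hull empty_subsetI hull_minimal insert_subset)
  then show "\<rho> \<subseteq> \<sigma>" using ray_v(1)[OF assms(2)] by simp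
qed

lemma finite_rays: "finite (rays \<Delta>)"
  using finite_fan by (simp add: rays_def)

lemma sum_v_reindex:
  assumes "\<sigma> \<in> \<Delta>" "A \<subseteq> cone_rays \<sigma>"
  shows "(\<Sum>s\<in>v ` A. c s *\<^sub>R s) = (\<Sum>\<rho>\<in>A. c (v \<rho>) *\<^sub>R v \<rho>)"
  using sum.reindex[OF inj_on_subset[OF inj_v_cone[OF assms(1)] assms(2)]] by simp

lemma sum_v_reindex':
  assumes "\<sigma> \<in> \<Delta>" "A \<subseteq> cone_rays \<sigma>"
  shows "(\<Sum>\<rho>\<in>A. c \<rho> *\<^sub>R v \<rho>) = (\<Sum>s\<in>v ` A. c (the_inv_into (cone_rays \<sigma>) v s) *\<^sub>R s)"
  unfolding sum_v_reindex[OF assms]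
  by (rule sum.cong) (use assms in \<open>auto simp: the_inv_into_f_f[OF inj_v_cone[OF assms(1)]]\<close>)

lemma mem_cone:
  assumes "\<sigma> \<in> \<Delta>"
  shows "x \<in> \<sigma> \<longleftrightarrow> (\<exists>c. (\<forall>\<rho>\<in>cone_rays \<sigma>. c \<rho> \<ge> 0) \<and> x = (\<Sum>\<rho>\<in>cone_rays \<sigma>. c \<rho> *\<^sub>R v \<rho>))"
proof -
  have fin: "finite (v ` cone_rays \<sigma>)" using finite_cone_rays[OF assms] by simp
  have "x \<in> \<sigma> \<longleftrightarrow> x \<in> convex_cone hull (v ` cone_rays \<sigma>)" using cone_eq[OF assms] by simp
  also have "\<dots> \<longleftrightarrow> (\<exists>c. (\<forall>s\<in>v ` cone_rays \<sigma>. c s \<ge> 0) \<and> x = (\<Sum>s\<in>v ` cone_rays \<sigma>. c s *\<^sub>R s))"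
    unfolding convex_cone_hull_finite[OF fin] by blast
  also have "\<dots> \<longleftrightarrow> (\<exists>c. (\<forall>\<rho>\<in>cone_rays \<sigma>. c \<rho> \<ge> 0) \<and> x = (\<Sum>\<rho>\<in>cone_rays \<sigma>. c \<rho> *\<^sub>R v \<rho>))"
  proof
    assume "\<exists>c. (\<forall>s\<in>v ` cone_rays \<sigma>. c s \<ge> 0) \<and> x = (\<Sum>s\<in>v ` cone_rays \<sigma>. c s *\<^sub>R s)"
    then obtain c where "\<forall>s\<in>v ` cone_rays \<sigma>. c s \<ge> 0" "x = (\<Sum>s\<in>v ` cone_rays \<sigma>. c s *\<^sub>R s)" by blast
    then show "\<exists>c. (\<forall>\<rho>\<in>cone_rays \<sigma>. c \<rho> \<ge> 0) \<and> x = (\<Sum>\<rho>\<in>cone_rays \<sigma>. c \<rho> *\<^sub>R v \<rho>)"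
      using sum_v_reindex[OF assms order_refl] by (intro exI[of _ "\<lambda>\<rho>. c (v \<rho>)"]) simp
  next
    assume "\<exists>c. (\<forall>\<rho>\<in>cone_rays \<sigma>. c \<rho> \<ge> 0) \<and> x = (\<Sum>\<rho>\<in>cone_rays \<sigma>. c \<rho> *\<^sub>R v \<rho>)"
    then obtain c where "\<forall>\<rho>\<in>cone_rays \<sigma>. c \<rho> \<ge> 0" "x = (\<Sum>\<rho>\<in>cone_rays \<sigma>. c \<rho> *\<^sub>R v \<rho>)" by blast
    then show "\<exists>c. (\<forall>s\<in>v ` cone_rays \<sigma>. c s \<ge> 0) \<and> x = (\<Sum>s\<in>v ` cone_rays \<sigma>. c s *\<^sub>R s)"
      using sum_v_reindex'[OF assms order_refl]
      by (intro exI[of _ "\<lambda>s. c (the_inv_into (cone_rays \<sigma>) v s)"])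
        (auto simp: the_inv_into_f_f[OF inj_v_cone[OF assms]])
  qed
  finally show ?thesis .
qed

lemma coeff_eq:
  assumes "\<sigma> \<in> \<Delta>" "(\<Sum>\<rho>\<in>cone_rays \<sigma>. c \<rho> *\<^sub>R v \<rho>) = (\<Sum>\<rho>\<in>cone_rays \<sigma>. d \<rho> *\<^sub>R v \<rho>)" "\<rho> \<in> cone_rays \<sigma>"
  shows "c \<rho> = d \<rho>"
proof -
  have fin: "finite (v ` cone_rays \<sigma>)" using finite_cone_rays[OF assms(1)] by simp
  let ?i = "the_inv_into (cone_rays \<sigma>) v"
  have eq: "(\<Sum>s\<in>v ` cone_rays \<sigma>. c (?i s) *\<^sub>R s) = (\<Sum>s\<in>v ` cone_rays \<sigma>. d (?i s) *\<^sub>R s)"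
    using assms(2) unfolding sum_v_reindex'[OF assms(1) order_refl] .
  have "c (?i (v \<rho>)) = d (?i (v \<rho>))"
    by (rule independent_coeff_eq[OF independent_v[OF assms(1)] fin eq]) (use assms(3) in blast)
  then show ?thesis using the_inv_into_f_f[OF inj_v_cone[OF assms(1)] assms(3)] by simp
qed

lemma subcone:
  assumes "\<sigma> \<in> \<Delta>" "A \<subseteq> cone_rays \<sigma>"
  shows "convex_cone hull (v ` A) \<in> \<Delta>" "cone_rays (convex_cone hull (v ` A)) = A"
proof -
  have fin: "finite (v ` cone_rays \<sigma>)" using finite_cone_rays[OF assms(1)] by simp
  have "convex_cone hull (v ` A) face_of convex_cone hull (v ` cone_rays \<sigma>)"
    by (rule simplicial_face[OF independent_v[OF assms(1)] fin]) (use assms in blast)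
  then have "convex_cone hull (v ` A) face_of \<sigma>" using cone_eq[OF assms(1)] by simp
  then show "convex_cone hull (v ` A) \<in> \<Delta>" using face_in_fan[OF assms(1)] convex_cone_hull_nonempty by blast
  have "independent (v ` A)" "finite (v ` A)"
    using independent_v[OF assms(1)] fin assms(2) by (meson finite_subset image_mono independent_mono)+
  then have "cone_rays (convex_cone hull (v ` A)) = ray ` v ` A" by (rule cone_rays_simplicial)
  also have "\<dots> = A" using ray_v(1) cone_rays_subset[OF assms(1)] assms(2) by (force simp: image_image)
  finally show "cone_rays (convex_cone hull (v ` A)) = A" .
qed

text \<open>The point lies in the common face of two cones of the fan, and a face containing a
  positive combination contains every generator occurring in it.\<close>

lemma support_subset:
  assumes "\<sigma> \<in> \<Delta>" "A \<subseteq> cone_rays \<sigma>" "\<sigma>' \<in> \<Delta>" and pos: "\<And>\<rho>. \<rho> \<in> A \<Longrightarrow> c \<rho> > 0"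
    and z: "(\<Sum>\<rho>\<in>A. c \<rho> *\<^sub>R v \<rho>) \<in> \<sigma>'"
  shows "A \<subseteq> cone_rays \<sigma>'"
proof
  fix \<rho> assume \<rho>: "\<rho> \<in> A"
  let ?\<tau> = "convex_cone hull (v ` A)"
  let ?c = "\<lambda>s. c (the_inv_into (cone_rays \<sigma>) v s)"
  note sub = subcone[OF assms(1,2)]
  have fin: "finite (v ` A)" using finite_cone_rays[OF assms(1)] assms(2) finite_subset by blast
  have pos': "?c s > 0" if "s \<in> v ` A" for s
    using that pos assms(2) the_inv_into_f_f[OF inj_v_cone[OF assms(1)]] by auto
  have eq: "(\<Sum>\<rho>\<in>A. c \<rho> *\<^sub>R v \<rho>) = (\<Sum>s\<in>v ` A. ?c s *\<^sub>R s)" by (rule sum_v_reindex'[OF assms(1,2)])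
  have "(\<Sum>s\<in>v ` A. ?c s *\<^sub>R s) \<in> ?\<tau>" by (rule convex_cone_hull_sum[OF fin]) (use pos' in force)
  then have z': "(\<Sum>s\<in>v ` A. ?c s *\<^sub>R s) \<in> ?\<tau> \<inter> \<sigma>'" using z eq by simp
  have "v \<rho> \<in> ?\<tau> \<inter> \<sigma>'"
    by (rule face_of_sum_member[where c = ?c, OF inter_face[OF sub(1) assms(3)] fin _ z'])
      (use pos' \<rho> in \<open>auto simp: less_imp_le\<close>)
  then show "\<rho> \<in> cone_rays \<sigma>'"
    using v_in_cone[OF assms(3)] \<rho> assms(2) cone_rays_subset[OF assms(1)] by blast
qed

lemma sum_extend:
  assumes "\<sigma> \<in> \<Delta>" "A \<subseteq> cone_rays \<sigma>"
  shows "(\<Sum>\<rho>\<in>A. c \<rho> *\<^sub>R v \<rho>) = (\<Sum>\<rho>\<in>cone_rays \<sigma>. (if \<rho> \<in> A then c \<rho> else 0) *\<^sub>R v \<rho>)"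
  using finite_cone_rays[OF assms(1)] assms(2) by (intro sum.mono_neutral_cong_left) auto

text \<open>\<open>support_subset\<close> puts \<open>A\<close> inside \<open>\<sigma>'\<close>,
  where coordinates are unique. This is the disjointness of relative interiors of different cones,
  in terms of their rays.\<close>

lemma unique_support:
  assumes "\<sigma> \<in> \<Delta>" "A \<subseteq> cone_rays \<sigma>" "\<sigma>' \<in> \<Delta>" "A' \<subseteq> cone_rays \<sigma>'"
    and pos: "\<And>\<rho>. \<rho> \<in> A \<Longrightarrow> c \<rho> > 0" "\<And>\<rho>. \<rho> \<in> A' \<Longrightarrow> c' \<rho> > 0"
    and eq: "(\<Sum>\<rho>\<in>A. c \<rho> *\<^sub>R v \<rho>) = (\<Sum>\<rho>\<in>A'. c' \<rho> *\<^sub>R v \<rho>)"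
  shows "A = A'"
proof -
  have "(\<Sum>\<rho>\<in>A'. c' \<rho> *\<^sub>R v \<rho>) \<in> \<sigma>'"
    unfolding mem_cone[OF assms(3)] sum_extend[OF assms(3,4)]
    using pos(2) by (intro exI[of _ "\<lambda>\<rho>. if \<rho> \<in> A' then c' \<rho> else 0"]) (auto simp: less_imp_le)
  then have A: "A \<subseteq> cone_rays \<sigma>'" using support_subset[OF assms(1,2,3) pos(1)] eq by simp
  have "(if \<rho> \<in> A then c \<rho> else 0) = (if \<rho> \<in> A' then c' \<rho> else 0)" if "\<rho> \<in> cone_rays \<sigma>'" for \<rho>
    by (rule coeff_eq[OF assms(3) _ that]) (use eq sum_extend[OF assms(3) A, of c] sum_extend[OF assms(3,4), of c'] in simp)
  then show ?thesis using A assms(4) pos by (metis (no_types, lifting) less_irrefl subset_antisym subset_iff)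
qed

section \<open>Maximal cones and walls\<close>

definition maxcones :: "(real^'n) set set" where
  "maxcones = {\<sigma> \<in> \<Delta>. card (cone_rays \<sigma>) = CARD('n)}"

lemma maxconesD: "\<sigma> \<in> maxcones \<Longrightarrow> \<sigma> \<in> \<Delta>" "\<sigma> \<in> maxcones \<Longrightarrow> card (cone_rays \<sigma>) = CARD('n)"
  by (auto simp: maxcones_def)

lemma closed_cone: assumes "\<sigma> \<in> \<Delta>" shows "closed \<sigma>"
proof -
  have "closed (convex_cone hull (v ` cone_rays \<sigma>))"
    using finite_cone_rays[OF assms] by (intro closed_convex_cone_hull) simp
  then show ?thesis using cone_eq[OF assms] by simp
qed

text \<open>The uncovered set is open, yet contained in finitely many cones of lower dimension,
  which are null sets.\<close>

lemma maxcones_cover: "\<Union>maxcones = UNIV"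
proof (rule ccontr)
  assume ne: "\<Union>maxcones \<noteq> UNIV"
  have fin: "finite maxcones" using finite_fan by (simp add: maxcones_def)
  have "closed (\<Union>maxcones)" using fin closed_cone maxconesD(1) by (intro closed_Union) auto
  then have "open (- \<Union>maxcones)" by (simp add: open_Compl)
  moreover have "- \<Union>maxcones \<noteq> {}" using ne by blast
  ultimately have "\<not> negligible (- \<Union>maxcones)" by (rule open_not_negligible)
  moreover have "negligible (\<Union>(\<Delta> - maxcones))"
  proof (rule negligible_Union)
    show "finite (\<Delta> - maxcones)" using finite_fan by simp
    fix \<sigma> assume \<sigma>: "\<sigma> \<in> \<Delta> - maxcones"
    then have "card (cone_rays \<sigma>) < CARD('n)" using card_cone_rays[of \<sigma>] by (auto simp: maxcones_def)
    moreover have "convex_cone hull (v ` cone_rays \<sigma>) \<subseteq> span (v ` cone_rays \<sigma>)"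
      by (rule hull_minimal) (auto simp: span_superset convex_cone_span)
    then have "dim \<sigma> \<le> dim (v ` cone_rays \<sigma>)" using cone_eq[of \<sigma>] \<sigma> by (metis DiffD1 dim_span dim_subset)
    moreover have "dim (v ` cone_rays \<sigma>) \<le> card (v ` cone_rays \<sigma>)" using finite_cone_rays[of \<sigma>] \<sigma> by (intro dim_le_card') auto
    moreover have "card (v ` cone_rays \<sigma>) \<le> card (cone_rays \<sigma>)" using finite_cone_rays[of \<sigma>] \<sigma> by (intro card_image_le) auto
    ultimately have "dim \<sigma> < DIM(real^'n)" by simp
    then show "negligible \<sigma>" by (rule negligible_lowdim)
  qed
  moreover have "- \<Union>maxcones \<subseteq> \<Union>(\<Delta> - maxcones)" using covers by blast
  ultimately show False using negligible_subset by blast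
qed

lemma in_maxcone:
  assumes "\<sigma> \<in> \<Delta>" obtains \<mu> where "\<mu> \<in> maxcones" "cone_rays \<sigma> \<subseteq> cone_rays \<mu>"
proof -
  let ?z = "\<Sum>\<rho>\<in>cone_rays \<sigma>. (1::real) *\<^sub>R v \<rho>"
  obtain \<mu> where \<mu>: "\<mu> \<in> maxcones" "?z \<in> \<mu>" using maxcones_cover by blast
  then have "cone_rays \<sigma> \<subseteq> cone_rays \<mu>"
    using support_subset[OF assms order_refl maxconesD(1)[OF \<mu>(1)], of "\<lambda>_. 1"] by simp
  then show ?thesis using that \<mu> by blast
qed

lemma maxcone_basis:
  assumes "\<mu> \<in> maxcones" shows "lattice_basis (v ` cone_rays \<mu>)" "span (v ` cone_rays \<mu>) = UNIV"
proof -
  note \<mu> = maxconesD[OF assms]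
  obtain Bs where B: "lattice_basis Bs" "v ` cone_rays \<mu> \<subseteq> Bs" "inj_on v (cone_rays \<mu>)"
    using \<mu>(1) by (rule cone_structure)
  have "card (v ` cone_rays \<mu>) = card Bs" using lattice_basisD(4)[OF B(1)] \<mu>(2) B(3) by (simp add: card_image)
  then have "v ` cone_rays \<mu> = Bs" using B(2) lattice_basisD(1)[OF B(1)] by (simp add: card_subset_eq)
  then show "lattice_basis (v ` cone_rays \<mu>)" using B(1) by simp
  have "dim (v ` cone_rays \<mu>) = DIM(real^'n)"
    using independent_v[OF \<mu>(1)] B(3) \<mu>(2) by (simp add: dim_eq_card_independent card_image)
  then show "span (v ` cone_rays \<mu>) = UNIV" using dim_eq_full[of "v ` cone_rays \<mu>"] by simp
qed

lemma integral_coordinates: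
  assumes "\<mu> \<in> maxcones" "\<rho>' \<in> rays \<Delta>"
  obtains k :: "(real^'n) set \<Rightarrow> int" where "v \<rho>' = (\<Sum>\<rho>\<in>cone_rays \<mu>. of_int (k \<rho>) *\<^sub>R v \<rho>)"
proof -
  obtain k :: "real^'n \<Rightarrow> int" where "v \<rho>' = (\<Sum>b\<in>v ` cone_rays \<mu>. of_int (k b) *\<^sub>R b)"
    using lattice_basisD(5)[OF maxcone_basis(1)[OF assms(1)] ray_v(3)[OF assms(2)]] by blast
  then show ?thesis
    using sum_v_reindex[OF maxconesD(1)[OF assms(1)] order_refl, of "\<lambda>b. of_int (k b)"] that[of "\<lambda>\<rho>. k (v \<rho>)"] by simp
qed

lemma dual:
  assumes "\<mu> \<in> maxcones" obtains m where "\<And>\<rho>. \<rho> \<in> cone_rays \<mu> \<Longrightarrow> m \<bullet> v \<rho> = g \<rho>"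
proof -
  note \<mu> = maxconesD[OF assms]
  obtain f where f: "linear f" "\<forall>s\<in>v ` cone_rays \<mu>. f s = g (the_inv_into (cone_rays \<mu>) v s)"
    using linear_independent_extend[OF independent_v[OF \<mu>(1)], where f = "\<lambda>s. g (the_inv_into (cone_rays \<mu>) v s)"] by metis
  have "adjoint f 1 \<bullet> v \<rho> = g \<rho>" if "\<rho> \<in> cone_rays \<mu>" for \<rho>
  proof -
    have "adjoint f 1 \<bullet> v \<rho> = f (v \<rho>)" using adjoint_works[OF f(1), of "v \<rho>" 1] by (simp add: inner_commute)
    then show ?thesis using f(2) that the_inv_into_f_f[OF inj_v_cone[OF \<mu>(1)] that] by simp
  qed
  then show ?thesis using that by blast
qed

lemma orthogonal_maxcone:
  assumes "\<mu> \<in> maxcones" "\<And>\<rho>. \<rho> \<in> cone_rays \<mu> \<Longrightarrow> m \<bullet> v \<rho> = 0" shows "m = 0"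
proof -
  have "m \<in> span (v ` cone_rays \<mu>)" using maxcone_basis(2)[OF assms(1)] by simp
  then have "orthogonal m m" by (rule orthogonal_to_span) (use assms(2) in \<open>auto simp: orthogonal_def\<close>)
  then show ?thesis by (simp add: orthogonal_self)
qed

text \<open>Move from the point \<open>w\<close> in the relative interior of the wall slightly to
  the side opposite \<open>\<rho>\<close>. Near \<open>w\<close> only maximal cones containing
  \<open>w\<close> occur, and such a cone contains all rays of the wall by
  \<open>support_subset\<close>.\<close>

lemma wall_neighbour:
  assumes \<mu>: "\<mu> \<in> maxcones" and \<rho>: "\<rho> \<in> cone_rays \<mu>"
  obtains \<mu>' \<rho>' where "\<mu>' \<in> maxcones" "\<rho>' \<notin> cone_rays \<mu>" "cone_rays \<mu>' = insert \<rho>' (cone_rays \<mu> - {\<rho>})"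
proof -
  note \<mu>D = maxconesD[OF \<mu>]
  define \<tau> where "\<tau> = cone_rays \<mu> - {\<rho>}"
  define w where "w = (\<Sum>\<rho>\<in>\<tau>. (1::real) *\<^sub>R v \<rho>)"
  define N where "N = \<Union>{\<sigma> \<in> maxcones. w \<notin> \<sigma>}"
  have \<rho>R: "\<rho> \<in> rays \<Delta>" using cone_rays_subset[OF \<mu>D(1)] \<rho> by blast
  have "finite {\<sigma> \<in> maxcones. w \<notin> \<sigma>}" using finite_fan by (simp add: maxcones_def)
  then have "closed N" unfolding N_def using closed_cone maxconesD(1) by (intro closed_Union) auto
  moreover have "w \<in> - N" by (auto simp: N_def)
  ultimately obtain e where e: "e > 0" "ball w e \<subseteq> - N" using open_contains_ball by (metis open_Compl)
  define \<delta> where "\<delta> = e / (2 * norm (v \<rho>))"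
  have vpos: "norm (v \<rho>) > 0" using ray_v(2)[OF \<rho>R] by simp
  then have \<delta>: "\<delta> > 0" using e by (simp add: \<delta>_def)
  define x where "x = w - \<delta> *\<^sub>R v \<rho>"
  have "dist w x = \<delta> * norm (v \<rho>)" using \<delta> by (simp add: x_def dist_norm)
  also have "\<dots> = e / 2" using vpos by (simp add: \<delta>_def)
  finally have "x \<in> ball w e" using e by simp
  then have "x \<notin> N" using e by blast
  moreover obtain \<mu>' where \<mu>': "\<mu>' \<in> maxcones" "x \<in> \<mu>'" using maxcones_cover by blast
  ultimately have "w \<in> \<mu>'" by (auto simp: N_def)
  note \<mu>'D = maxconesD[OF \<mu>'(1)]
  have \<tau>sub: "\<tau> \<subseteq> cone_rays \<mu>" by (auto simp: \<tau>_def)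
  have sub: "\<tau> \<subseteq> cone_rays \<mu>'"
    using support_subset[OF \<mu>D(1) \<tau>sub \<mu>'D(1), of "\<lambda>_. 1"] \<open>w \<in> \<mu>'\<close> by (simp add: w_def)
  have fin: "finite (cone_rays \<mu>')" "finite \<tau>" using finite_cone_rays \<mu>'D(1) sub finite_subset by blast+
  have "card \<tau> = CARD('n) - 1" using \<mu>D \<rho> finite_cone_rays by (simp add: \<tau>_def)
  then have "card (cone_rays \<mu>' - \<tau>) = 1"
    using card_Diff_subset[OF fin(2) sub] \<mu>'D(2) by (simp add: Suc_leI)
  then obtain \<rho>' where \<rho>': "cone_rays \<mu>' - \<tau> = {\<rho>'}" by (meson card_1_singletonE)
  then have C': "cone_rays \<mu>' = insert \<rho>' \<tau>" using sub by blast
  have "\<rho>' \<notin> cone_rays \<mu>"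
  proof
    assume "\<rho>' \<in> cone_rays \<mu>"
    then have "\<rho>' = \<rho>" using \<rho>' by (auto simp: \<tau>_def)
    then have "cone_rays \<mu>' = cone_rays \<mu>" using C' \<rho> by (auto simp: \<tau>_def)
    then have "x \<in> \<mu>" using \<mu>'(2) cone_eq[OF \<mu>D(1)] cone_eq[OF \<mu>'D(1)] by simp
    then obtain c where c: "\<forall>\<rho>\<in>cone_rays \<mu>. c \<rho> \<ge> 0" "x = (\<Sum>\<rho>\<in>cone_rays \<mu>. c \<rho> *\<^sub>R v \<rho>)"
      using mem_cone[OF \<mu>D(1)] by blast
    have "x = (\<Sum>\<kappa>\<in>cone_rays \<mu>. (if \<kappa> = \<rho> then - \<delta> else 1) *\<^sub>R v \<kappa>)"
      unfolding x_def w_def \<tau>_def sum.remove[OF finite_cone_rays[OF \<mu>D(1)] \<rho>]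
      by (simp add: algebra_simps)
    then have "c \<rho> = - \<delta>"
      using coeff_eq[OF \<mu>D(1), of c "\<lambda>\<kappa>. if \<kappa> = \<rho> then - \<delta> else 1" \<rho>] c(2) \<rho> by simp
    then show False using c(1) \<rho> \<delta> by force
  qed
  then show ?thesis using that[OF \<mu>'(1)] C' by (simp add: \<tau>_def)
qed

text \<open>Both cones have lattice bases sharing the wall, so the coefficient of
  \<open>v \<rho>\<close> in \<open>v \<rho>'\<close> is 1 or -1. If it were 1, moving the negative
  terms across would express one point positively through \<open>\<rho>'\<close> and wall rays and
  also through \<open>\<rho>\<close> and wall rays, against \<open>unique_support\<close>.\<close>

lemma wall_relation:
  assumes \<sigma>: "\<sigma> \<in> maxcones" and \<sigma>': "\<sigma>' \<in> maxcones" and \<rho>: "\<rho> \<in> cone_rays \<sigma>" and \<rho>': "\<rho>' \<notin> cone_rays \<sigma>"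
    and C': "cone_rays \<sigma>' = insert \<rho>' (cone_rays \<sigma> - {\<rho>})"
  obtains c where "v \<rho> + v \<rho>' = (\<Sum>\<kappa>\<in>cone_rays \<sigma> - {\<rho>}. c \<kappa> *\<^sub>R v \<kappa>)"
proof -
  note \<sigma>D = maxconesD[OF \<sigma>] and \<sigma>'D = maxconesD[OF \<sigma>']
  let ?\<tau> = "cone_rays \<sigma> - {\<rho>}"
  have fin: "finite (cone_rays \<sigma>)" "finite ?\<tau>" using finite_cone_rays[OF \<sigma>D(1)] by auto
  have R: "\<rho> \<in> rays \<Delta>" "\<rho>' \<in> rays \<Delta>" using cone_rays_subset \<sigma>D(1) \<sigma>'D(1) \<rho> C' by blast+
  obtain k :: "(real^'n) set \<Rightarrow> int" where k: "v \<rho>' = (\<Sum>\<kappa>\<in>cone_rays \<sigma>. of_int (k \<kappa>) *\<^sub>R v \<kappa>)"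
    using \<sigma> R(2) by (rule integral_coordinates)
  obtain l :: "(real^'n) set \<Rightarrow> int" where l: "v \<rho> = (\<Sum>\<kappa>\<in>cone_rays \<sigma>'. of_int (l \<kappa>) *\<^sub>R v \<kappa>)"
    using \<sigma>' R(1) by (rule integral_coordinates)
  have k': "v \<rho>' = of_int (k \<rho>) *\<^sub>R v \<rho> + (\<Sum>\<kappa>\<in>?\<tau>. of_int (k \<kappa>) *\<^sub>R v \<kappa>)"
    using k sum.remove[OF fin(1) \<rho>] by metis
  have l': "v \<rho> = of_int (l \<rho>') *\<^sub>R v \<rho>' + (\<Sum>\<kappa>\<in>?\<tau>. of_int (l \<kappa>) *\<^sub>R v \<kappa>)"
    using l \<rho>' fin(2) unfolding C' by simp
  let ?d = "\<lambda>\<kappa>. if \<kappa> = \<rho> then of_int (l \<rho>' * k \<rho>) else of_int (l \<rho>' * k \<kappa> + l \<kappa>) :: real"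
  have "(\<Sum>\<kappa>\<in>cone_rays \<sigma>. ?d \<kappa> *\<^sub>R v \<kappa>)
      = of_int (l \<rho>' * k \<rho>) *\<^sub>R v \<rho> + (\<Sum>\<kappa>\<in>?\<tau>. of_int (l \<rho>' * k \<kappa> + l \<kappa>) *\<^sub>R v \<kappa>)"
    unfolding sum.remove[OF fin(1) \<rho>] by simp
  also have "\<dots> = of_int (l \<rho>') *\<^sub>R v \<rho>' + (\<Sum>\<kappa>\<in>?\<tau>. of_int (l \<kappa>) *\<^sub>R v \<kappa>)"
    unfolding k' by (simp add: scaleR_add_right scaleR_add_left sum.distrib scaleR_sum_right)
  also have "\<dots> = v \<rho>" using l' by simp
  also have "v \<rho> = (\<Sum>\<kappa>\<in>cone_rays \<sigma>. (if \<kappa> = \<rho> then 1 else 0) *\<^sub>R v \<kappa>)"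
    using fin \<rho> by (simp add: if_distrib[of "\<lambda>c. c *\<^sub>R _"] cong: if_cong)
  finally have "?d \<rho> = (if \<rho> = \<rho> then 1 else 0)" by (rule coeff_eq[OF \<sigma>D(1) _ \<rho>])
  then have "l \<rho>' * k \<rho> = 1" by (simp flip: of_int_mult)
  then consider "k \<rho> = 1" | "k \<rho> = -1" by (metis mult.commute zmult_eq_1_iff)
  then show ?thesis
  proof cases
    case 2
    then have "v \<rho> + v \<rho>' = (\<Sum>\<kappa>\<in>?\<tau>. of_int (k \<kappa>) *\<^sub>R v \<kappa>)" using k' by simp
    then show ?thesis by (rule that)
  next
    case 1
    let ?N = "{\<kappa> \<in> ?\<tau>. k \<kappa> < 0}" and ?P = "{\<kappa> \<in> ?\<tau>. k \<kappa> > 0}"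
    let ?c = "\<lambda>\<kappa>. if \<kappa> = \<rho>' then 1 else - of_int (k \<kappa>) :: real" and ?c' = "\<lambda>\<kappa>. if \<kappa> = \<rho> then 1 else of_int (k \<kappa>) :: real"
    have "(\<Sum>\<kappa>\<in>?\<tau>. of_int (k \<kappa>) *\<^sub>R v \<kappa>) = (\<Sum>\<kappa>\<in>?P \<union> ?N. of_int (k \<kappa>) *\<^sub>R v \<kappa>)"
      using fin by (intro sum.mono_neutral_right) auto
    also have "\<dots> = (\<Sum>\<kappa>\<in>?P. of_int (k \<kappa>) *\<^sub>R v \<kappa>) + (\<Sum>\<kappa>\<in>?N. of_int (k \<kappa>) *\<^sub>R v \<kappa>)"
      using fin by (intro sum.union_disjoint) auto
    finally have split: "v \<rho>' + (\<Sum>\<kappa>\<in>?N. (- of_int (k \<kappa>)) *\<^sub>R v \<kappa>) = v \<rho> + (\<Sum>\<kappa>\<in>?P. of_int (k \<kappa>) *\<^sub>R v \<kappa>)"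
      using k' 1 by (simp add: sum_negf)
    have "(\<Sum>\<kappa>\<in>insert \<rho>' ?N. ?c \<kappa> *\<^sub>R v \<kappa>) = v \<rho>' + (\<Sum>\<kappa>\<in>?N. ?c \<kappa> *\<^sub>R v \<kappa>)"
      using fin \<rho>' by (subst sum.insert) auto
    moreover have "(\<Sum>\<kappa>\<in>?N. ?c \<kappa> *\<^sub>R v \<kappa>) = (\<Sum>\<kappa>\<in>?N. (- of_int (k \<kappa>)) *\<^sub>R v \<kappa>)"
      using \<rho>' by (intro sum.cong) auto
    moreover have "(\<Sum>\<kappa>\<in>insert \<rho> ?P. ?c' \<kappa> *\<^sub>R v \<kappa>) = v \<rho> + (\<Sum>\<kappa>\<in>?P. ?c' \<kappa> *\<^sub>R v \<kappa>)"
      using fin by (subst sum.insert) auto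
    moreover have "(\<Sum>\<kappa>\<in>?P. ?c' \<kappa> *\<^sub>R v \<kappa>) = (\<Sum>\<kappa>\<in>?P. of_int (k \<kappa>) *\<^sub>R v \<kappa>)"
      by (intro sum.cong) auto
    ultimately have eq: "(\<Sum>\<kappa>\<in>insert \<rho>' ?N. ?c \<kappa> *\<^sub>R v \<kappa>) = (\<Sum>\<kappa>\<in>insert \<rho> ?P. ?c' \<kappa> *\<^sub>R v \<kappa>)"
      using split by simp
    have "insert \<rho>' ?N = insert \<rho> ?P"
      by (rule unique_support[OF \<sigma>'D(1) _ \<sigma>D(1) _ _ _ eq]) (use C' \<rho> in auto)
    then have "\<rho> \<in> insert \<rho>' ?N" by simp
    then have False using \<rho> \<rho>' by auto
    then show ?thesis ..
  qed
qed

end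

section \<open>Divisor classes of a smooth complete fan\<close>

locale smooth_fan_class = smooth_fan \<Delta> for \<Delta> :: "(real^'n) set set" +
  fixes q :: "(real^'n) set \<Rightarrow> real^'r"
  assumes class_map: "class_map \<Delta> q"
begin

definition complements :: "(real^'n) set set set" where
  "complements = (\<lambda>\<mu>. rays \<Delta> - cone_rays \<mu>) ` maxcones"

lemma span_q: "span (q ` rays \<Delta>) = UNIV"
  using class_map by (simp add: class_map_def)

lemma relation_iff: "(\<Sum>\<rho>\<in>rays \<Delta>. a \<rho> *\<^sub>R q \<rho>) = 0 \<longleftrightarrow> (\<exists>m. \<forall>\<rho>\<in>rays \<Delta>. a \<rho> = m \<bullet> v \<rho>)"
  using class_map by (simp add: class_map_def)

lemma principal_relation: "(\<Sum>\<rho>\<in>rays \<Delta>. (m \<bullet> v \<rho>) *\<^sub>R q \<rho>) = 0"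
  unfolding relation_iff by blast

lemma relation_principal:
  assumes "(\<Sum>\<rho>\<in>rays \<Delta>. a \<rho> *\<^sub>R q \<rho>) = 0" obtains m where "\<And>\<rho>. \<rho> \<in> rays \<Delta> \<Longrightarrow> a \<rho> = m \<bullet> v \<rho>"
  using assms unfolding relation_iff by blast

text \<open>One half of Gale duality: pairing the sum with itself turns it into \<open>f\<close>
  applied to a principal relation.\<close>

lemma functional_relation:
  assumes "linear f" shows "(\<Sum>\<rho>\<in>rays \<Delta>. f (q \<rho>) *\<^sub>R v \<rho>) = 0"
proof -
  define s where "s = (\<Sum>\<rho>\<in>rays \<Delta>. f (q \<rho>) *\<^sub>R v \<rho>)"
  have "s \<bullet> s = (\<Sum>\<rho>\<in>rays \<Delta>. (s \<bullet> v \<rho>) * f (q \<rho>))"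
    by (subst (2) s_def) (simp add: inner_sum_right mult.commute)
  also have "\<dots> = f (\<Sum>\<rho>\<in>rays \<Delta>. (s \<bullet> v \<rho>) *\<^sub>R q \<rho>)"
    using assms by (simp add: linear_sum linear_scale)
  also have "\<dots> = 0" using principal_relation assms by (simp add: linear_0)
  finally show ?thesis by (simp add: s_def)
qed

lemma sum_split:
  assumes "\<mu> \<in> maxcones"
  shows "(\<Sum>\<rho>\<in>rays \<Delta>. g \<rho>) = (\<Sum>\<rho>\<in>cone_rays \<mu>. g \<rho>) + (\<Sum>\<rho>\<in>rays \<Delta> - cone_rays \<mu>. g \<rho> :: 'b::comm_monoid_add)"
  using sum.subset_diff[OF cone_rays_subset[OF maxconesD(1)[OF assms]] finite_rays, of g] by (simp add: add.commute)

text \<open>A relation supported off \<open>\<mu>\<close> comes from a linear form vanishing on the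
  generators of \<open>\<mu>\<close>, which span.\<close>

lemma complement_independent:
  assumes \<mu>: "\<mu> \<in> maxcones" and 0: "(\<Sum>\<rho>\<in>rays \<Delta> - cone_rays \<mu>. c \<rho> *\<^sub>R q \<rho>) = 0"
    and t: "t \<in> rays \<Delta> - cone_rays \<mu>"
  shows "c t = 0"
proof -
  let ?a = "\<lambda>\<rho>. if \<rho> \<in> cone_rays \<mu> then 0 else c \<rho>"
  have "(\<Sum>\<rho>\<in>rays \<Delta>. ?a \<rho> *\<^sub>R q \<rho>) = (\<Sum>\<rho>\<in>rays \<Delta> - cone_rays \<mu>. c \<rho> *\<^sub>R q \<rho>)"
    unfolding sum_split[OF \<mu>] by simp
  then have "(\<Sum>\<rho>\<in>rays \<Delta>. ?a \<rho> *\<^sub>R q \<rho>) = 0" using 0 by simp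
  then obtain m where m: "\<And>\<rho>. \<rho> \<in> rays \<Delta> \<Longrightarrow> ?a \<rho> = m \<bullet> v \<rho>" by (rule relation_principal) blast
  have "m = 0"
    by (rule orthogonal_maxcone[OF \<mu>]) (use m[symmetric] cone_rays_subset[OF maxconesD(1)[OF \<mu>]] in auto)
  then show ?thesis using m[of t] t by simp
qed

lemma class_in_complement:
  assumes \<mu>: "\<mu> \<in> maxcones" and m: "\<And>\<rho>. \<rho> \<in> cone_rays \<mu> \<Longrightarrow> m \<bullet> v \<rho> = (if \<rho> = i then 1 else 0)" and i: "i \<in> cone_rays \<mu>"
  shows "q i = (\<Sum>\<rho>\<in>rays \<Delta> - cone_rays \<mu>. (- (m \<bullet> v \<rho>)) *\<^sub>R q \<rho>)"
proof -
  have "(\<Sum>\<rho>\<in>cone_rays \<mu>. (m \<bullet> v \<rho>) *\<^sub>R q \<rho>) = (\<Sum>\<rho>\<in>cone_rays \<mu>. (if \<rho> = i then 1 else 0) *\<^sub>R q \<rho>)"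
    using m by simp
  also have "\<dots> = q i" using i finite_cone_rays[OF maxconesD(1)[OF \<mu>]]
    by (simp add: if_distrib[of "\<lambda>c. c *\<^sub>R _"] cong: if_cong)
  finally have "q i + (\<Sum>\<rho>\<in>rays \<Delta> - cone_rays \<mu>. (m \<bullet> v \<rho>) *\<^sub>R q \<rho>) = 0"
    using principal_relation[of m] unfolding sum_split[OF \<mu>] by simp
  then show ?thesis by (simp add: sum_negf eq_neg_iff_add_eq_0)
qed

lemma integral_dual:
  assumes \<mu>: "\<mu> \<in> maxcones" and m: "\<And>\<rho>. \<rho> \<in> cone_rays \<mu> \<Longrightarrow> m \<bullet> v \<rho> \<in> \<int>" and \<rho>: "\<rho> \<in> rays \<Delta>"
  shows "m \<bullet> v \<rho> \<in> \<int>"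
proof -
  obtain k :: "(real^'n) set \<Rightarrow> int" where "v \<rho> = (\<Sum>\<kappa>\<in>cone_rays \<mu>. of_int (k \<kappa>) *\<^sub>R v \<kappa>)"
    using \<mu> \<rho> by (rule integral_coordinates)
  then have "m \<bullet> v \<rho> = (\<Sum>\<kappa>\<in>cone_rays \<mu>. of_int (k \<kappa>) * (m \<bullet> v \<kappa>))" by (simp add: inner_sum_right)
  also have "\<dots> \<in> \<int>" using m by (intro Ints_sum Ints_mult) auto
  finally show ?thesis .
qed

lemma coordinates_integral:
  assumes \<mu>: "\<mu> \<in> maxcones" and i: "i \<in> rays \<Delta>"
  shows "\<exists>c. (\<forall>\<rho>\<in>rays \<Delta> - cone_rays \<mu>. c \<rho> \<in> \<int>) \<and> q i = (\<Sum>\<rho>\<in>rays \<Delta> - cone_rays \<mu>. c \<rho> *\<^sub>R q \<rho>)"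
proof (cases "i \<in> cone_rays \<mu>")
  case True
  obtain m where m: "\<And>\<rho>. \<rho> \<in> cone_rays \<mu> \<Longrightarrow> m \<bullet> v \<rho> = (if \<rho> = i then 1 else 0)"
    using dual[OF \<mu>, where g = "\<lambda>\<rho>. if \<rho> = i then 1 else 0"] by metis
  have "m \<bullet> v \<rho> \<in> \<int>" if "\<rho> \<in> rays \<Delta>" for \<rho> by (rule integral_dual[OF \<mu> _ that]) (simp add: m)
  then show ?thesis
    using class_in_complement[OF \<mu> m True] by (intro exI[of _ "\<lambda>\<rho>. - (m \<bullet> v \<rho>)"]) auto
next
  case False
  then have "q i = (\<Sum>\<rho>\<in>rays \<Delta> - cone_rays \<mu>. (if \<rho> = i then 1 else 0) *\<^sub>R q \<rho>)"
    using i finite_rays by (simp add: if_distrib[of "\<lambda>c. c *\<^sub>R _"] cong: if_cong)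
  then show ?thesis by (intro exI[of _ "\<lambda>\<rho>. if \<rho> = i then 1 else 0"]) simp
qed

lemma complement_basis:
  assumes \<mu>: "\<mu> \<in> maxcones"
  defines "T \<equiv> rays \<Delta> - cone_rays \<mu>"
  shows "inj_on q T" "independent (q ` T)" "span (q ` T) = UNIV" "card T = CARD('r)"
proof -
  have fin: "finite T" using finite_rays by (simp add: T_def)
  note ind = complement_independent[OF \<mu>, folded T_def]
  show inj: "inj_on q T"
  proof (rule inj_onI, rule ccontr)
    fix x y assume xy: "x \<in> T" "y \<in> T" "q x = q y" "x \<noteq> y"
    let ?c = "\<lambda>t. (if t = x then 1 else 0) - (if t = y then 1 else 0) :: real"
    have "(\<Sum>t\<in>T. ?c t *\<^sub>R q t) = q x - q y"
      using fin xy(1,2) by (simp add: scaleR_diff_left sum_subtractf if_distrib[of "\<lambda>c. c *\<^sub>R _"] cong: if_cong)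
    then have "?c x = 0" using ind[of ?c x] xy by simp
    then show False using xy by simp
  qed
  show indep: "independent (q ` T)"
  proof
    assume "dependent (q ` T)"
    then obtain u where u: "\<exists>w\<in>q ` T. u w \<noteq> 0" "(\<Sum>w\<in>q ` T. u w *\<^sub>R w) = 0"
      using dependent_finite[of "q ` T"] fin by auto
    have "(\<Sum>t\<in>T. u (q t) *\<^sub>R q t) = 0" using u(2) by (simp add: sum.reindex[OF inj])
    then show False using ind[of "\<lambda>t. u (q t)"] u(1) by blast
  qed
  have "q ` rays \<Delta> \<subseteq> span (q ` T)"
  proof
    fix x assume "x \<in> q ` rays \<Delta>"
    then obtain i where i: "i \<in> rays \<Delta>" "x = q i" by blast
    obtain c where "q i = (\<Sum>\<rho>\<in>T. c \<rho> *\<^sub>R q \<rho>)" using coordinates_integral[OF \<mu> i(1)] unfolding T_def by blast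
    then show "x \<in> span (q ` T)" unfolding i(2) by (simp only:) (intro span_sum span_scale span_base, simp)
  qed
  then have "span (q ` rays \<Delta>) \<subseteq> span (q ` T)" by (rule span_minimal) (rule subspace_span)
  then show span: "span (q ` T) = UNIV" using span_q by auto
  have "card (q ` T) = dim (q ` T)" using indep by (simp add: dim_eq_card_independent)
  also have "\<dots> = CARD('r)" using dim_eq_full[of "q ` T"] span by simp
  finally show "card T = CARD('r)" using card_image[OF inj] by simp
qed

text \<open>The converse half of Gale duality: prescribe \<open>f\<close> on the basis of classes
  off \<open>\<mu>\<close>; pairing the relation with dual basis vectors of \<open>\<mu>\<close>
  gives the correct values on its rays.\<close>

lemma relation_functional:
  assumes b: "(\<Sum>\<rho>\<in>rays \<Delta>. b \<rho> *\<^sub>R v \<rho>) = 0"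
  obtains f where "linear f" "\<And>\<rho>. \<rho> \<in> rays \<Delta> \<Longrightarrow> f (q \<rho>) = b \<rho>"
proof -
  obtain \<mu> where \<mu>: "\<mu> \<in> maxcones" using maxcones_cover by blast
  let ?T = "rays \<Delta> - cone_rays \<mu>"
  note basis = complement_basis[OF \<mu>]
  obtain f where f: "linear f" "\<forall>x\<in>q ` ?T. f x = b (the_inv_into ?T q x)"
    using linear_independent_extend[OF basis(2), where f = "\<lambda>x. b (the_inv_into ?T q x)"] by metis
  have fT: "f (q t) = b t" if "t \<in> ?T" for t
    using f(2) that the_inv_into_f_f[OF basis(1) that] by simp
  have "f (q \<rho>) = b \<rho>" if \<rho>: "\<rho> \<in> rays \<Delta>" for \<rho>
  proof (cases "\<rho> \<in> cone_rays \<mu>")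
    case True
    obtain m where m: "\<And>\<kappa>. \<kappa> \<in> cone_rays \<mu> \<Longrightarrow> m \<bullet> v \<kappa> = (if \<kappa> = \<rho> then 1 else 0)"
      using dual[OF \<mu>, where g = "\<lambda>\<kappa>. if \<kappa> = \<rho> then 1 else 0"] by metis
    have "0 = m \<bullet> (\<Sum>\<rho>\<in>rays \<Delta>. b \<rho> *\<^sub>R v \<rho>)" using b by simp
    also have "\<dots> = (\<Sum>\<kappa>\<in>rays \<Delta>. b \<kappa> * (m \<bullet> v \<kappa>))" by (simp add: inner_sum_right)
    also have "\<dots> = (\<Sum>\<kappa>\<in>cone_rays \<mu>. b \<kappa> * (m \<bullet> v \<kappa>)) + (\<Sum>\<kappa>\<in>?T. b \<kappa> * (m \<bullet> v \<kappa>))"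
      by (rule sum_split[OF \<mu>])
    also have "(\<Sum>\<kappa>\<in>cone_rays \<mu>. b \<kappa> * (m \<bullet> v \<kappa>)) = b \<rho>"
      using True m finite_cone_rays[OF maxconesD(1)[OF \<mu>]] by (simp add: if_distrib[of "\<lambda>c. _ * c"] cong: if_cong)
    finally have "b \<rho> = (\<Sum>\<kappa>\<in>?T. - (m \<bullet> v \<kappa>) * b \<kappa>)" by (simp add: sum_negf mult.commute eq_neg_iff_add_eq_0)
    also have "\<dots> = f (q \<rho>)"
      using class_in_complement[OF \<mu> m True] f(1) fT by (simp add: linear_sum linear_scale linear_neg sum_negf)
    finally show ?thesis by simp
  next
    case False
    then show ?thesis using fT \<rho> by blast
  qed
  then show ?thesis using that f(1) by blast
qed

lemma linear_vanishes:
  assumes "linear f" "\<And>\<rho>. \<rho> \<in> rays \<Delta> \<Longrightarrow> f (q \<rho>) = (0::real)" shows "f x = 0"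
proof -
  have "x \<in> span (q ` rays \<Delta>)" using span_q by simp
  then show ?thesis by (rule linear_eq_0_on_span[OF assms(1), rotated]) (use assms(2) in blast)
qed

text \<open>Completeness puts the negative of the sum of all generators into some cone, which yields
  a relation with all coefficients at least 1.\<close>

lemma positive_functional: "\<exists>h. linear h \<and> (\<forall>\<rho>\<in>rays \<Delta>. h (q \<rho>) > (0::real))"
proof -
  obtain \<sigma> where \<sigma>: "\<sigma> \<in> \<Delta>" "- (\<Sum>\<rho>\<in>rays \<Delta>. v \<rho>) \<in> \<sigma>" using covers by blast
  obtain c where c: "\<forall>\<rho>\<in>cone_rays \<sigma>. c \<rho> \<ge> 0" "- (\<Sum>\<rho>\<in>rays \<Delta>. v \<rho>) = (\<Sum>\<rho>\<in>cone_rays \<sigma>. c \<rho> *\<^sub>R v \<rho>)"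
    using \<sigma>(2) mem_cone[OF \<sigma>(1)] by blast
  let ?b = "\<lambda>\<rho>. 1 + (if \<rho> \<in> cone_rays \<sigma> then c \<rho> else 0)"
  have "(\<Sum>\<rho>\<in>cone_rays \<sigma>. c \<rho> *\<^sub>R v \<rho>) = (\<Sum>\<rho>\<in>rays \<Delta>. (if \<rho> \<in> cone_rays \<sigma> then c \<rho> else 0) *\<^sub>R v \<rho>)"
    using cone_rays_subset[OF \<sigma>(1)] finite_rays by (intro sum.mono_neutral_cong_left) auto
  then have "(\<Sum>\<rho>\<in>rays \<Delta>. (if \<rho> \<in> cone_rays \<sigma> then c \<rho> else 0) *\<^sub>R v \<rho>) = - (\<Sum>\<rho>\<in>rays \<Delta>. v \<rho>)"
    using c(2) by metis
  then have "(\<Sum>\<rho>\<in>rays \<Delta>. ?b \<rho> *\<^sub>R v \<rho>) = 0"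
    unfolding scaleR_add_left sum.distrib by simp
  then obtain h where "linear h" "\<And>\<rho>. \<rho> \<in> rays \<Delta> \<Longrightarrow> h (q \<rho>) = ?b \<rho>" by (rule relation_functional) blast
  then show ?thesis using c(1) by (intro exI[of _ h]) (auto simp: add_pos_nonneg)
qed

text \<open>By Gale duality the values of \<open>f\<close> form a relation. Its positive part is
  supported on \<open>\<mu>\<close> and its negative part on \<open>\<mu>'\<close>, so one point is
  expressed twice, and \<open>unique_support\<close> equates two disjoint supports.\<close>

lemma separated_functional:
  assumes \<mu>: "\<mu> \<in> maxcones" "\<mu>' \<in> maxcones" and f: "linear f"
    and neg: "\<And>t. t \<in> rays \<Delta> - cone_rays \<mu> \<Longrightarrow> f (q t) \<le> 0" and pos: "\<And>t. t \<in> rays \<Delta> - cone_rays \<mu>' \<Longrightarrow> f (q t) \<ge> (0::real)"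
  shows "f x = 0"
proof -
  let ?P = "{\<rho> \<in> rays \<Delta>. f (q \<rho>) > 0}" and ?N = "{\<rho> \<in> rays \<Delta>. f (q \<rho>) < 0}"
  have "(\<Sum>\<rho>\<in>rays \<Delta>. f (q \<rho>) *\<^sub>R v \<rho>) = (\<Sum>\<rho>\<in>?P \<union> ?N. f (q \<rho>) *\<^sub>R v \<rho>)"
    using finite_rays by (intro sum.mono_neutral_right) auto
  also have "\<dots> = (\<Sum>\<rho>\<in>?P. f (q \<rho>) *\<^sub>R v \<rho>) + (\<Sum>\<rho>\<in>?N. f (q \<rho>) *\<^sub>R v \<rho>)"
    using finite_rays by (intro sum.union_disjoint) auto
  finally have eq: "(\<Sum>\<rho>\<in>?P. f (q \<rho>) *\<^sub>R v \<rho>) = (\<Sum>\<rho>\<in>?N. (- f (q \<rho>)) *\<^sub>R v \<rho>)"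
    using functional_relation[OF f] by (simp add: sum_negf eq_neg_iff_add_eq_0)
  have sub: "?P \<subseteq> cone_rays \<mu>" "?N \<subseteq> cone_rays \<mu>'" using neg pos by force+
  have PN: "?P = ?N"
    by (rule unique_support[OF maxconesD(1)[OF \<mu>(1)] sub(1) maxconesD(1)[OF \<mu>(2)] sub(2) _ _ eq]) auto
  have "f (q \<rho>) = 0" if \<rho>: "\<rho> \<in> rays \<Delta>" for \<rho>
  proof -
    have "\<rho> \<in> ?P \<longleftrightarrow> \<rho> \<in> ?N" using PN by (rule arg_cong)
    then show ?thesis using \<rho> by auto
  qed
  then show ?thesis using linear_vanishes[OF f] by blast
qed

lemma maxcone_of_complement: "rays \<Delta> - (rays \<Delta> - cone_rays \<mu>) = cone_rays \<mu>" if "\<mu> \<in> maxcones"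
  using cone_rays_subset[OF maxconesD(1)[OF that]] by blast

lemma complement_exchange:
  assumes "\<mu> \<in> maxcones" "i \<in> cone_rays \<mu>" "i' \<in> rays \<Delta>" "cone_rays \<mu>' = insert i' (cone_rays \<mu> - {i})"
    "i' \<notin> cone_rays \<mu>"
  shows "rays \<Delta> - cone_rays \<mu>' = insert i ((rays \<Delta> - cone_rays \<mu>) - {i'})"
proof -
  have "cone_rays \<mu> \<subseteq> rays \<Delta>" using cone_rays_subset[OF maxconesD(1)[OF assms(1)]] .
  then show ?thesis unfolding assms(4) using assms(2,3,5) by auto
qed

lemma bunch: "bunch (rays \<Delta>) q complements"
proof
  show "finite (rays \<Delta>)" by (rule finite_rays)
  show "complements \<noteq> {}" using maxcones_cover unfolding complements_def by blast
  fix T assume "T \<in> complements"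
  then obtain \<mu> where \<mu>: "\<mu> \<in> maxcones" "T = rays \<Delta> - cone_rays \<mu>" by (auto simp: complements_def)
  have C: "cone_rays \<mu> = rays \<Delta> - T" using maxcone_of_complement[OF \<mu>(1)] \<mu>(2) by simp
  show "T \<subseteq> rays \<Delta>" using \<mu> by blast
  show "card T = DIM(real^'r)" using complement_basis(4)[OF \<mu>(1)] \<mu>(2) by simp
  show "c t = 0" if "(\<Sum>t\<in>T. c t *\<^sub>R q t) = 0" "t \<in> T" for c t
    using complement_independent[OF \<mu>(1)] that \<mu>(2) by blast
  show "\<exists>t\<in>T. insert i (T - {t}) \<in> complements" if i: "i \<in> rays \<Delta>" "i \<notin> T" for i
  proof -
    have iC: "i \<in> cone_rays \<mu>" using i C by blast
    obtain \<mu>' i' where \<mu>': "\<mu>' \<in> maxcones" "i' \<notin> cone_rays \<mu>" "cone_rays \<mu>' = insert i' (cone_rays \<mu> - {i})"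
      using wall_neighbour[OF \<mu>(1) iC] by metis
    have i'R: "i' \<in> rays \<Delta>" using cone_rays_subset[OF maxconesD(1)[OF \<mu>'(1)]] \<mu>'(3) by blast
    have "rays \<Delta> - cone_rays \<mu>' = insert i (T - {i'})"
      using complement_exchange[OF \<mu>(1) iC i'R \<mu>'(3,2)] \<mu>(2) by simp
    then have "insert i (T - {i'}) \<in> complements" using \<mu>'(1) unfolding complements_def by (metis imageI)
    moreover have "i' \<in> T" using i'R \<mu>'(2) \<mu>(2) by blast
    ultimately show ?thesis by blast
  qed
  show "q i - q t \<in> span (q ` (T - {t}))" if t: "t \<in> T" and i: "i \<notin> T" and T': "insert i (T - {t}) \<in> complements" for i t
  proof -
    obtain \<mu>' where \<mu>': "\<mu>' \<in> maxcones" "insert i (T - {t}) = rays \<Delta> - cone_rays \<mu>'"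
      using T' unfolding complements_def by blast
    have tR: "t \<in> rays \<Delta>" using t \<mu>(2) by blast
    have iR: "i \<in> rays \<Delta>" using \<mu>'(2) by blast
    have iC: "i \<in> cone_rays \<mu>" and tC: "t \<notin> cone_rays \<mu>" using C i iR t by blast+
    have "cone_rays \<mu>' = rays \<Delta> - insert i (T - {t})" using maxcone_of_complement[OF \<mu>'(1)] \<mu>'(2) by simp
    also have "\<dots> = insert t (cone_rays \<mu> - {i})" using C tR t i by auto
    finally have C': "cone_rays \<mu>' = insert t (cone_rays \<mu> - {i})" .
    obtain c where c: "v i + v t = (\<Sum>\<kappa>\<in>cone_rays \<mu> - {i}. c \<kappa> *\<^sub>R v \<kappa>)"
      using wall_relation[OF \<mu>(1) \<mu>'(1) iC tC C'] by metis
    obtain m where m: "\<And>\<rho>. \<rho> \<in> cone_rays \<mu> \<Longrightarrow> m \<bullet> v \<rho> = (if \<rho> = i then 1 else 0)"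
      using dual[OF \<mu>(1), where g = "\<lambda>\<rho>. if \<rho> = i then 1 else 0"] by metis
    have "m \<bullet> v i + m \<bullet> v t = (\<Sum>\<kappa>\<in>cone_rays \<mu> - {i}. c \<kappa> * (m \<bullet> v \<kappa>))"
      using arg_cong[OF c, of "inner m"] by (simp add: inner_add_right inner_sum_right)
    also have "\<dots> = 0" using m by (intro sum.neutral) auto
    \<comment> \<open>Because the wall relation expresses the sum \<open>v i + v t\<close> through
      wall rays, \<open>v t\<close> has coordinate -1 along \<open>v i\<close>, and
      \<open>q t\<close> enters \<open>q i\<close> with coefficient 1.\<close>
    finally have mt: "m \<bullet> v t = -1" using m[OF iC] by simp
    have fin: "finite T" using finite_rays \<mu>(2) by simp
    have "q i = (\<Sum>\<rho>\<in>T. (- (m \<bullet> v \<rho>)) *\<^sub>R q \<rho>)" using class_in_complement[OF \<mu>(1) m iC] \<mu>(2) by simp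
    also have "\<dots> = q t + (\<Sum>\<rho>\<in>T - {t}. (- (m \<bullet> v \<rho>)) *\<^sub>R q \<rho>)" unfolding sum.remove[OF fin t] using mt by simp
    finally have "q i - q t = (\<Sum>\<rho>\<in>T - {t}. (- (m \<bullet> v \<rho>)) *\<^sub>R q \<rho>)" by simp
    also have "\<dots> \<in> span (q ` (T - {t}))" by (intro span_sum span_scale span_base) auto
    finally show ?thesis .
  qed
  show "\<exists>c. (\<forall>t\<in>T. c t \<in> \<int>) \<and> q i = (\<Sum>t\<in>T. c t *\<^sub>R q t)" if "i \<in> rays \<Delta>" for i
    using coordinates_integral[OF \<mu>(1) that] \<mu>(2) by simp
  show "f x = 0" if T': "T' \<in> complements" and "linear f" "\<And>t. t \<in> T \<Longrightarrow> f (q t) \<le> 0" "\<And>t. t \<in> T' \<Longrightarrow> (0::real) \<le> f (q t)" for T' f x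
  proof -
    obtain \<mu>' where \<mu>': "\<mu>' \<in> maxcones" "T' = rays \<Delta> - cone_rays \<mu>'" using T' by (auto simp: complements_def)
    show ?thesis by (rule separated_functional[OF \<mu>(1) \<mu>'(1) that(2)]) (use that \<mu> \<mu>' in auto)
  qed
next
  show "\<exists>h. linear h \<and> (\<forall>j\<in>rays \<Delta>. h (q j) > (0::real))" by (rule positive_functional)
qed

sublocale bunch "rays \<Delta>" q complements by (rule bunch)

section \<open>Primitive relations, the facet of the effective cone and a nef divisor on it\<close>

lemma primitive_collection_of_primitive:
  assumes P: "primitive P" shows "primitive_collection \<Delta> P"
  unfolding primitive_collection_def
proof (intro conjI allI impI)
  show "P \<subseteq> rays \<Delta>" using P by (simp add: primitive_def)
  show "\<not> (\<exists>\<sigma>\<in>\<Delta>. P \<subseteq> cone_rays \<sigma>)"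
  proof
    assume "\<exists>\<sigma>\<in>\<Delta>. P \<subseteq> cone_rays \<sigma>"
    then obtain \<sigma> where \<sigma>: "\<sigma> \<in> \<Delta>" "P \<subseteq> cone_rays \<sigma>" by blast
    obtain \<mu> where \<mu>: "\<mu> \<in> maxcones" "cone_rays \<sigma> \<subseteq> cone_rays \<mu>" using \<sigma>(1) by (rule in_maxcone)
    have "rays \<Delta> - cone_rays \<mu> \<in> complements" using \<mu>(1) unfolding complements_def by (rule imageI)
    then have "(rays \<Delta> - cone_rays \<mu>) \<inter> P \<noteq> {}" using P unfolding primitive_def by blast
    then show False using \<mu>(2) \<sigma>(2) by blast
  qed
  fix Q assume "Q \<subset> P"
  then obtain a where a: "a \<in> P" "a \<notin> Q" "Q \<subseteq> P" by blast
  then obtain T where "T \<in> complements" "T \<inter> P = {a}" using P unfolding primitive_def by blast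
  then obtain \<mu> where \<mu>: "\<mu> \<in> maxcones" "(rays \<Delta> - cone_rays \<mu>) \<inter> P = {a}" by (auto simp: complements_def)
  have PR: "P \<subseteq> rays \<Delta>" using P by (simp add: primitive_def)
  have "Q \<subseteq> cone_rays \<mu>"
  proof (rule subsetI, rule ccontr)
    fix x assume "x \<in> Q" "x \<notin> cone_rays \<mu>"
    then have "x \<in> (rays \<Delta> - cone_rays \<mu>) \<inter> P" using a(3) PR by blast
    then have "x = a" unfolding \<mu>(2) by simp
    then show False using \<open>x \<in> Q\<close> a(2) by simp
  qed
  then show "\<exists>\<sigma>\<in>\<Delta>. Q \<subseteq> cone_rays \<sigma>" using maxconesD(1)[OF \<mu>(1)] by blast
qed

lemma zero_cone: "{0} \<in> \<Delta>" "cone_rays {0 :: real^'n} = {}"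
proof -
  obtain \<sigma> where "\<sigma> \<in> \<Delta>" using covers by blast
  then show "{0} \<in> \<Delta>" "cone_rays {0 :: real^'n} = {}" using subcone[of \<sigma> "{}"] by simp_all
qed

text \<open>The positive combination of the rays of the cone is 0, so that cone has no rays and
  nothing is subtracted.\<close>

lemma prim_coeff_zero_sum:
  assumes "(\<Sum>\<rho>\<in>P. v \<rho>) = 0"
  shows "prim_coeff \<Delta> P = (\<lambda>\<rho>. if \<rho> \<in> P then 1 else 0)"
  unfolding prim_coeff_def
proof (rule the_equality)
  show "primitive_relation \<Delta> P (\<lambda>\<rho>. if \<rho> \<in> P then 1 else 0)"
    unfolding primitive_relation_def using zero_cone assms
    by (intro bexI[of _ "{0}"] exI[of _ "\<lambda>_. 1"]) auto
  fix b assume "primitive_relation \<Delta> P b"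
  then obtain \<sigma> c where \<sigma>: "\<sigma> \<in> \<Delta>" "\<forall>\<rho>\<in>cone_rays \<sigma>. c \<rho> > 0" "(\<Sum>\<rho>\<in>cone_rays \<sigma>. c \<rho> *\<^sub>R v \<rho>) = 0"
    and b: "b = (\<lambda>\<rho>. (if \<rho> \<in> P then 1 else 0) - (if \<rho> \<in> cone_rays \<sigma> then c \<rho> else 0))"
    unfolding primitive_relation_def assms by auto
  have "c \<rho> = 0" if "\<rho> \<in> cone_rays \<sigma>" for \<rho>
    using coeff_eq[OF \<sigma>(1), of c "\<lambda>_. 0" \<rho>] \<sigma>(3) that by simp
  then have "cone_rays \<sigma> = {}" using \<sigma>(2) by fastforce
  then show "b = (\<lambda>\<rho>. if \<rho> \<in> P then 1 else 0)" using b by simp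
qed

lemma prim_functional_eq:
  assumes f: "linear f" "\<And>\<rho>. \<rho> \<in> rays \<Delta> \<Longrightarrow> f (q \<rho>) = prim_coeff \<Delta> P \<rho>"
  shows "prim_functional \<Delta> q P = f"
  unfolding prim_functional_def
proof (rule the_equality)
  show "linear f \<and> (\<forall>\<rho>\<in>rays \<Delta>. f (q \<rho>) = prim_coeff \<Delta> P \<rho>)" using f by blast
  fix g assume g: "linear g \<and> (\<forall>\<rho>\<in>rays \<Delta>. g (q \<rho>) = prim_coeff \<Delta> P \<rho>)"
  have "linear (\<lambda>x. g x - f x)" using g f(1) by (intro linear_compose_sub) auto
  then have "g x - f x = 0" for x by (rule linear_vanishes) (use f g in simp)
  then show "g = f" by auto
qed

text \<open>\<open>f\<close> is nonnegative on the generating classes, so its zeros form a face. A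
  complement meeting \<open>P\<close> in a single ray \<open>a\<close> supplies r - 1 independent
  classes on that face, and \<open>q a\<close> is off it.\<close>

lemma Eff_facet:
  assumes P: "primitive P" and f: "linear f" "\<And>\<rho>. \<rho> \<in> rays \<Delta> \<Longrightarrow> f (q \<rho>) = (if \<rho> \<in> P then 1 else 0 :: real)"
  shows "cuts_out_facet {x. f x = 0} (Eff_cone \<Delta> q)"
proof -
  let ?E = "Eff_cone \<Delta> q" and ?H = "{x. f x = 0}"
  have conv: "convex ?E" by (simp add: Eff_cone_def convex_convex_cone_hull)
  have "convex_cone {x. f x \<ge> 0}"
    unfolding convex_cone_iff using f(1) by (auto simp: linear_0 linear_add linear_scale)
  moreover have "q ` rays \<Delta> \<subseteq> {x. f x \<ge> 0}" using f(2) by auto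
  ultimately have nonneg: "f x \<ge> 0" if "x \<in> ?E" for x
    using hull_minimal[of "q ` rays \<Delta>" "{x. f x \<ge> 0}" convex_cone] that by (auto simp: Eff_cone_def)
  have 0: "0 \<in> ?H \<inter> ?E" using f(1) by (simp add: linear_0 Eff_cone_def convex_cone_hull_contains_0)
  have convH: "convex ?H" using f(1) by (intro subspace_imp_convex) (auto simp: subspace_def linear_0 linear_add linear_scale)
  have face: "(?H \<inter> ?E) face_of ?E"
    unfolding face_of_def
  proof (intro conjI ballI impI)
    show "convex (?H \<inter> ?E)" using convH conv by (rule convex_Int)
    fix a b x assume ab: "a \<in> ?E" "b \<in> ?E" and x: "x \<in> ?H \<inter> ?E" "x \<in> open_segment a b"
    obtain u where u: "0 < u" "u < 1" "x = (1 - u) *\<^sub>R a + u *\<^sub>R b" using x(2) unfolding in_segment by blast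
    have "(1 - u) * f a + u * f b = 0" using x(1) u(3) f(1) by (simp add: linear_add linear_scale)
    moreover have "(1 - u) * f a \<ge> 0" "u * f b \<ge> 0" using u nonneg ab by auto
    ultimately have "(1 - u) * f a = 0" "u * f b = 0" by linarith+
    then have "f a = 0" "f b = 0" using u by auto
    then show "a \<in> ?H \<inter> ?E" "b \<in> ?H \<inter> ?E" using ab by auto
  qed blast
  have qE: "q \<rho> \<in> ?E" if "\<rho> \<in> rays \<Delta>" for \<rho> using that by (simp add: Eff_cone_def hull_inc)
  have "UNIV \<subseteq> span ?E" using span_q span_mono[of "q ` rays \<Delta>" ?E] qE by blast
  then have dimE: "dim ?E = CARD('r)" using dim_eq_full[of ?E] by auto
  obtain a where a: "a \<in> P" using primitive_nonempty[OF P] by blast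
  then obtain T where "T \<in> complements" "T \<inter> P = {a}" using P unfolding primitive_def by blast
  then obtain \<mu> where \<mu>: "\<mu> \<in> maxcones" and TP: "(rays \<Delta> - cone_rays \<mu>) \<inter> P = {a}" by (auto simp: complements_def)
  let ?T = "rays \<Delta> - cone_rays \<mu>"
  note basis = complement_basis[OF \<mu>]
  have aT: "a \<in> ?T" using TP by blast
  have "q ` (?T - {a}) \<subseteq> ?H \<inter> ?E"
  proof
    fix x assume "x \<in> q ` (?T - {a})"
    then obtain t where t: "t \<in> ?T - {a}" "x = q t" by blast
    have "t \<notin> P"
    proof
      assume "t \<in> P"
      then have "t \<in> ?T \<inter> P" using t(1) by blast
      then show False using t(1) unfolding TP by simp
    qed
    moreover have "t \<in> rays \<Delta>" using t(1) by blast
    ultimately show "x \<in> ?H \<inter> ?E" using f(2) qE t(2) by simp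
  qed
  then have "dim (q ` (?T - {a})) \<le> dim (?H \<inter> ?E)" by (rule dim_subset)
  moreover have "independent (q ` (?T - {a}))" using basis(2) by (rule independent_mono) blast
  then have "dim (q ` (?T - {a})) = card (q ` (?T - {a}))" by (rule dim_eq_card_independent)
  moreover have "card (q ` (?T - {a})) = card (?T - {a})"
    using basis(1) by (intro card_image) (rule inj_on_subset, blast+)
  moreover have "card (?T - {a}) = CARD('r) - 1" using basis(4) aT finite_rays by simp
  ultimately have lower: "CARD('r) - 1 \<le> dim (?H \<inter> ?E)" by simp
  have "span (?H \<inter> ?E) \<subset> UNIV"
  proof -
    have "subspace ?H" using f(1) by (auto simp: subspace_def linear_0 linear_add linear_scale)
    then have "span (?H \<inter> ?E) \<subseteq> ?H" by (intro span_minimal) auto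
    moreover have "q a \<notin> ?H" using f(2) a aT by simp
    ultimately show ?thesis by blast
  qed
  then have "dim (?H \<inter> ?E) < CARD('r)" using dim_psubset[of "?H \<inter> ?E" UNIV] by simp
  then have "dim (?H \<inter> ?E) = CARD('r) - 1" using lower by linarith
  moreover have "aff_dim (?H \<inter> ?E) = int (dim (?H \<inter> ?E))" using 0 by (intro aff_dim_zero hull_inc)
  moreover have "aff_dim ?E = int (dim ?E)" using 0 by (intro aff_dim_zero hull_inc) blast
  ultimately have "aff_dim (?H \<inter> ?E) = aff_dim ?E - 1" using dimE by (simp add: of_nat_diff)
  then show ?thesis using face 0 by (auto simp: cuts_out_facet_def facet_of_def)
qed

text \<open>The coordinates of \<open>q j\<close> in the cone over a complement form an effective
  divisor equivalent to the prime divisor and vanishing on \<open>\<mu>\<close>. The difference is a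
  linear form \<open>m \<mu>\<close> bounded by the prime divisor on all generators and equal to it
  on those of \<open>\<mu>\<close>; the maximum of these forms is the support function.\<close>

lemma nef_prime_divisor:
  assumes j: "j \<in> rays \<Delta>" and nef: "in_all_cones j"
  shows "nef_divisor \<Delta> (\<lambda>\<rho>. if \<rho> = j then 1 else 0)"
proof -
  let ?a = "\<lambda>\<rho>. if \<rho> = j then 1 else 0 :: real"
  have "\<forall>\<mu>\<in>maxcones. \<exists>m. (\<forall>\<rho>\<in>rays \<Delta>. m \<bullet> v \<rho> \<le> ?a \<rho>) \<and> (\<forall>\<rho>\<in>cone_rays \<mu>. m \<bullet> v \<rho> = ?a \<rho>)"
  proof
    fix \<mu> assume \<mu>: "\<mu> \<in> maxcones"
    let ?T = "rays \<Delta> - cone_rays \<mu>"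
    have "?T \<in> complements" using \<mu> unfolding complements_def by (rule imageI)
    then obtain x where x: "\<forall>t\<in>?T. x t \<ge> (0::real)" "q j = (\<Sum>t\<in>?T. x t *\<^sub>R q t)"
      using bspec[OF nef[unfolded in_all_cones_def]] by metis
    let ?b = "\<lambda>\<rho>. ?a \<rho> - (if \<rho> \<in> ?T then x \<rho> else 0)"
    have "(\<Sum>\<rho>\<in>rays \<Delta>. ?a \<rho> *\<^sub>R q \<rho>) = q j"
      using j finite_rays by (simp add: if_distrib[of "\<lambda>c. c *\<^sub>R _"] cong: if_cong)
    moreover have "(\<Sum>\<rho>\<in>rays \<Delta>. (if \<rho> \<in> ?T then x \<rho> else 0) *\<^sub>R q \<rho>) = q j"
      unfolding x(2) using finite_rays by (intro sum.mono_neutral_cong_right) auto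
    ultimately have "(\<Sum>\<rho>\<in>rays \<Delta>. ?b \<rho> *\<^sub>R q \<rho>) = 0" unfolding scaleR_diff_left sum_subtractf by simp
    then obtain m where m: "\<And>\<rho>. \<rho> \<in> rays \<Delta> \<Longrightarrow> ?b \<rho> = m \<bullet> v \<rho>" by (rule relation_principal) blast
    have "m \<bullet> v \<rho> \<le> ?a \<rho>" if "\<rho> \<in> rays \<Delta>" for \<rho>
    proof -
      have "(if \<rho> \<in> ?T then x \<rho> else 0) \<ge> 0" using x(1) by simp
      then show ?thesis using m[OF that] by linarith
    qed
    moreover have "m \<bullet> v \<rho> = ?a \<rho>" if "\<rho> \<in> cone_rays \<mu>" for \<rho>
    proof -
      have "\<rho> \<in> rays \<Delta>" using that cone_rays_subset[OF maxconesD(1)[OF \<mu>]] by blast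
      from m[OF this] that show ?thesis by simp
    qed
    ultimately show "\<exists>m. (\<forall>\<rho>\<in>rays \<Delta>. m \<bullet> v \<rho> \<le> ?a \<rho>) \<and> (\<forall>\<rho>\<in>cone_rays \<mu>. m \<bullet> v \<rho> = ?a \<rho>)" by blast
  qed
  from bchoice[OF this] obtain m where
    "\<forall>\<mu>\<in>maxcones. (\<forall>\<rho>\<in>rays \<Delta>. m \<mu> \<bullet> v \<rho> \<le> ?a \<rho>) \<and> (\<forall>\<rho>\<in>cone_rays \<mu>. m \<mu> \<bullet> v \<rho> = ?a \<rho>)" ..
  then have m: "\<And>\<mu> \<rho>. \<mu> \<in> maxcones \<Longrightarrow> \<rho> \<in> rays \<Delta> \<Longrightarrow> m \<mu> \<bullet> v \<rho> \<le> ?a \<rho>"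
    "\<And>\<mu> \<rho>. \<mu> \<in> maxcones \<Longrightarrow> \<rho> \<in> cone_rays \<mu> \<Longrightarrow> m \<mu> \<bullet> v \<rho> = ?a \<rho>" by blast+
  define \<psi> where "\<psi> u = Max ((\<lambda>\<mu>. m \<mu> \<bullet> u) ` maxcones)" for u
  have fin: "finite maxcones" using finite_fan by (simp add: maxcones_def)
  have ge: "m \<mu> \<bullet> u \<le> \<psi> u" if "\<mu> \<in> maxcones" for \<mu> u
    unfolding \<psi>_def using fin that by (intro Max_ge) auto
  have attained: "\<exists>\<mu>\<in>maxcones. \<psi> u = m \<mu> \<bullet> u" for u
  proof -
    have "maxcones \<noteq> {}" using maxcones_cover by blast
    then have "\<psi> u \<in> (\<lambda>\<mu>. m \<mu> \<bullet> u) ` maxcones" unfolding \<psi>_def using fin by (intro Max_in) auto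
    then show ?thesis by blast
  qed
  have on_cone: "\<psi> u = m \<mu> \<bullet> u" if \<mu>: "\<mu> \<in> maxcones" and u: "u \<in> \<mu>" for \<mu> u
  proof (rule antisym)
    obtain \<mu>' where \<mu>': "\<mu>' \<in> maxcones" "\<psi> u = m \<mu>' \<bullet> u" using attained by blast
    obtain c where c: "\<forall>\<rho>\<in>cone_rays \<mu>. c \<rho> \<ge> 0" "u = (\<Sum>\<rho>\<in>cone_rays \<mu>. c \<rho> *\<^sub>R v \<rho>)"
      using u mem_cone[OF maxconesD(1)[OF \<mu>]] by blast
    have "m \<mu>' \<bullet> u = (\<Sum>\<rho>\<in>cone_rays \<mu>. c \<rho> * (m \<mu>' \<bullet> v \<rho>))" unfolding c(2) by (simp add: inner_sum_right)
    also have "\<dots> \<le> (\<Sum>\<rho>\<in>cone_rays \<mu>. c \<rho> * (m \<mu> \<bullet> v \<rho>))"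
      using m(1)[OF \<mu>'(1)] m(2)[OF \<mu>] c(1) cone_rays_subset[OF maxconesD(1)[OF \<mu>]]
      by (intro sum_mono mult_left_mono) (simp_all add: subset_iff)
    also have "\<dots> = m \<mu> \<bullet> u" unfolding c(2) by (simp add: inner_sum_right)
    finally show "\<psi> u \<le> m \<mu> \<bullet> u" using \<mu>'(2) by simp
    show "m \<mu> \<bullet> u \<le> \<psi> u" using ge[OF \<mu>] .
  qed
  have sub: "\<exists>\<mu>\<in>maxcones. \<sigma> \<subseteq> \<mu>" if \<sigma>: "\<sigma> \<in> \<Delta>" for \<sigma>
  proof -
    obtain \<mu> where \<mu>: "\<mu> \<in> maxcones" "cone_rays \<sigma> \<subseteq> cone_rays \<mu>" using \<sigma> by (rule in_maxcone)
    have "convex_cone hull (v ` cone_rays \<sigma>) \<subseteq> convex_cone hull (v ` cone_rays \<mu>)"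
      using \<mu>(2) by (intro hull_mono image_mono)
    then show ?thesis using cone_eq[OF \<sigma>] cone_eq[OF maxconesD(1)[OF \<mu>(1)]] \<mu>(1) by auto
  qed
  show ?thesis
    unfolding nef_divisor_def
  proof (intro exI[of _ \<psi>] conjI ballI)
    fix \<sigma> assume "\<sigma> \<in> \<Delta>"
    then obtain \<mu> where "\<mu> \<in> maxcones" "\<sigma> \<subseteq> \<mu>" using sub by blast
    then show "\<exists>m. \<forall>u\<in>\<sigma>. \<psi> u = m \<bullet> u" using on_cone by blast
  next
    fix \<rho> assume \<rho>: "\<rho> \<in> rays \<Delta>"
    then have "\<rho> \<in> \<Delta>" by (simp add: rays_def)
    then obtain \<mu> where \<mu>: "\<mu> \<in> maxcones" "\<rho> \<subseteq> \<mu>" using sub by blast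
    have "v \<rho> \<in> ray (v \<rho>)" by (simp add: hull_inc)
    then have "v \<rho> \<in> \<mu>" using ray_v(1)[OF \<rho>] \<mu>(2) by blast
    then show "\<psi> (v \<rho>) = ?a \<rho>"
      using on_cone[OF \<mu>(1)] m(2)[OF \<mu>(1)] v_in_cone[OF maxconesD(1)[OF \<mu>(1)] \<rho>] by metis
  next
    show "convex_on UNIV \<psi>"
    proof (rule convex_onI)
      fix t :: real and x y assume t: "0 < t" "t < 1"
      obtain \<mu> where \<mu>: "\<mu> \<in> maxcones" "\<psi> ((1 - t) *\<^sub>R x + t *\<^sub>R y) = m \<mu> \<bullet> ((1 - t) *\<^sub>R x + t *\<^sub>R y)" using attained by blast
      have "m \<mu> \<bullet> ((1 - t) *\<^sub>R x + t *\<^sub>R y) = (1 - t) * (m \<mu> \<bullet> x) + t * (m \<mu> \<bullet> y)" by (simp add: inner_add_right)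
      also have "\<dots> \<le> (1 - t) * \<psi> x + t * \<psi> y"
        using ge[OF \<mu>(1)] t by (intro add_mono mult_left_mono) auto
      finally show "\<psi> ((1 - t) *\<^sub>R x + t *\<^sub>R y) \<le> (1 - t) * \<psi> x + t * \<psi> y" using \<mu>(2) by simp
    qed simp
  qed
qed

section \<open>Growth of the number of sections\<close>

lemma coordinate_bound:
  "\<exists>K. \<forall>m i. \<forall>k\<ge>0. (\<forall>\<rho>\<in>rays \<Delta>. m \<bullet> v \<rho> \<ge> - k) \<longrightarrow> \<bar>m $ i\<bar> \<le> k * (K::real)"
proof -
  have "\<exists>C\<ge>0. \<forall>m. \<forall>k\<ge>0. (\<forall>\<rho>\<in>rays \<Delta>. m \<bullet> v \<rho> \<ge> - k) \<longrightarrow> - (m \<bullet> u) \<le> k * (C::real)" for u :: "real^'n"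
  proof -
    obtain \<sigma> where \<sigma>: "\<sigma> \<in> \<Delta>" "u \<in> \<sigma>" using covers by blast
    obtain c where c: "\<forall>\<rho>\<in>cone_rays \<sigma>. c \<rho> \<ge> 0" "u = (\<Sum>\<rho>\<in>cone_rays \<sigma>. c \<rho> *\<^sub>R v \<rho>)"
      using \<sigma>(2) mem_cone[OF \<sigma>(1)] by blast
    have "- (m \<bullet> u) \<le> k * (\<Sum>\<rho>\<in>cone_rays \<sigma>. c \<rho>)" if "\<forall>\<rho>\<in>rays \<Delta>. m \<bullet> v \<rho> \<ge> - k" "k \<ge> 0" for m k
    proof -
      have "- (m \<bullet> u) = (\<Sum>\<rho>\<in>cone_rays \<sigma>. c \<rho> * (- (m \<bullet> v \<rho>)))" unfolding c(2) by (simp add: inner_sum_right sum_negf)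
      also have "\<dots> \<le> (\<Sum>\<rho>\<in>cone_rays \<sigma>. c \<rho> * k)"
        using c(1) that cone_rays_subset[OF \<sigma>(1)] by (intro sum_mono mult_left_mono) force+
      also have "\<dots> = k * (\<Sum>\<rho>\<in>cone_rays \<sigma>. c \<rho>)" by (simp add: sum_distrib_left mult.commute)
      finally show ?thesis .
    qed
    moreover have "(\<Sum>\<rho>\<in>cone_rays \<sigma>. c \<rho>) \<ge> 0" using c(1) by (intro sum_nonneg) auto
    ultimately show ?thesis by blast
  qed
  then obtain C where C: "\<And>u. C u \<ge> 0"
    "\<And>u m k. k \<ge> 0 \<Longrightarrow> (\<forall>\<rho>\<in>rays \<Delta>. m \<bullet> v \<rho> \<ge> - k) \<Longrightarrow> - (m \<bullet> (u::real^'n)) \<le> k * C u" by metis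
  \<comment> \<open>A coordinate is bounded through cones containing the unit vector and its
    negative; summing over all coordinates makes the constant uniform.\<close>
  let ?K = "\<Sum>i\<in>UNIV. C (axis i 1) + C (- axis i 1)"
  have "\<bar>m $ i\<bar> \<le> k * ?K" if k: "k \<ge> 0" "\<forall>\<rho>\<in>rays \<Delta>. m \<bullet> v \<rho> \<ge> - k" for m k i
  proof -
    have "- (m $ i) \<le> k * C (axis i 1)" using C(2)[OF k, of "axis i 1"] by (simp add: inner_axis)
    moreover have "m $ i \<le> k * C (- axis i 1)" using C(2)[OF k, of "- axis i 1"] by (simp add: inner_axis)
    moreover have "k * C (axis i 1) \<ge> 0" "k * C (- axis i 1) \<ge> 0" using k(1) C(1) by auto
    ultimately have "\<bar>m $ i\<bar> \<le> k * (C (axis i 1) + C (- axis i 1))" by (simp add: distrib_left)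
    also have "C (axis i 1) + C (- axis i 1) \<le> ?K"
      by (rule member_le_sum) (use C(1) in auto)
    then have "k * (C (axis i 1) + C (- axis i 1)) \<le> k * ?K" using k(1) by (rule mult_left_mono)
    finally show ?thesis .
  qed
  then show ?thesis by blast
qed

text \<open>On \<open>P\<close> a section has nonnegative values with sum 0. A lattice point
  orthogonal to \<open>v p\<close> is determined by all coordinates but \<open>i0\<close>, and
  \<open>coordinate_bound\<close> confines these to a range linear in \<open>k\<close>, so the
  number of sections grows at most like k^(n-1).\<close>

lemma not_big:
  assumes P: "P \<subseteq> rays \<Delta>" "P \<noteq> {}" "(\<Sum>\<rho>\<in>P. v \<rho>) = 0" and D: "\<And>\<rho>. \<rho> \<in> P \<Longrightarrow> D \<rho> = 0"
    and D1: "\<And>\<rho>. \<rho> \<in> rays \<Delta> \<Longrightarrow> D \<rho> \<le> 1"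
  shows "\<not> big_divisor \<Delta> D"
proof -
  obtain K0 where K0: "\<And>m i k. k \<ge> 0 \<Longrightarrow> (\<forall>\<rho>\<in>rays \<Delta>. m \<bullet> v \<rho> \<ge> - k) \<Longrightarrow> \<bar>m $ i\<bar> \<le> k * (K0::real)"
    using coordinate_bound by blast
  obtain K :: nat where K: "K0 \<le> real K" using real_arch_simple by blast
  obtain p where p: "p \<in> P" using P(2) by blast
  then have "v p \<noteq> 0" using ray_v(2) P(1) by blast
  then obtain i0 where i0: "v p $ i0 \<noteq> 0" by (metis vec_eq_iff zero_index)
  let ?n = "CARD('n)"
  have bound: "h0 \<Delta> (\<lambda>\<rho>. int k * D \<rho>) \<le> (2 * (k * K) + 1) ^ (?n - 1)" for k :: nat
  proof -
    let ?S = "{m \<in> lattice_points. \<forall>\<rho>\<in>rays \<Delta>. m \<bullet> v \<rho> + of_int (int k * D \<rho>) \<ge> 0}"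
    let ?I = "UNIV - {i0}" and ?J = "{- int (k * K)..int (k * K)}"
    let ?g = "\<lambda>m::real^'n. \<lambda>i\<in>?I. \<lfloor>m $ i\<rfloor>"
    have ge: "m \<bullet> v \<rho> \<ge> - real k" if "m \<in> ?S" "\<rho> \<in> rays \<Delta>" for m \<rho>
    proof -
      have "real k * of_int (D \<rho>) \<le> real k * 1" using D1[OF that(2)] by (intro mult_left_mono) auto
      moreover have "m \<bullet> v \<rho> + real k * of_int (D \<rho>) \<ge> 0" using that by auto
      ultimately show ?thesis by simp
    qed
    have orth: "m \<bullet> v p = 0" if m: "m \<in> ?S" for m
    proof -
      have finP: "finite P" using P(1) finite_rays finite_subset by blast
      have nn: "m \<bullet> v \<rho> \<ge> 0" if \<rho>: "\<rho> \<in> P" for \<rho>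
      proof -
        have "m \<bullet> v \<rho> + of_int (int k * D \<rho>) \<ge> 0" using m \<rho> P(1) by blast
        then show ?thesis using D[OF \<rho>] by simp
      qed
      have "(\<Sum>\<rho>\<in>P. m \<bullet> v \<rho>) = m \<bullet> (\<Sum>\<rho>\<in>P. v \<rho>)" by (simp add: inner_sum_right)
      then have "(\<Sum>\<rho>\<in>P. m \<bullet> v \<rho>) = 0" using P(3) by simp
      then show ?thesis using sum_nonneg_eq_0_iff[OF finP, of "\<lambda>\<rho>. m \<bullet> v \<rho>"] nn p by blast
    qed
    have "?g ` ?S \<subseteq> ?I \<rightarrow>\<^sub>E ?J"
    proof (rule image_subsetI)
      fix m assume m: "m \<in> ?S"
      have "\<lfloor>m $ i\<rfloor> \<in> ?J" for i
      proof -
        have "\<bar>m $ i\<bar> \<le> real k * K0" using K0[of "real k" m i] ge[OF m] by auto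
        also have "\<dots> \<le> real (k * K)" using K by (simp add: mult_left_mono)
        finally have "m $ i \<le> real (k * K)" "- real (k * K) \<le> m $ i" by (auto simp: abs_le_iff)
        then show ?thesis by (simp add: le_floor_iff floor_le_iff)
      qed
      then show "?g m \<in> ?I \<rightarrow>\<^sub>E ?J" by auto
    qed
    moreover have "finite (?I \<rightarrow>\<^sub>E ?J)" by (intro finite_PiE) auto
    ultimately have "card (?g ` ?S) \<le> card (?I \<rightarrow>\<^sub>E ?J)" by (intro card_mono)
    also have "card ?J = 2 * (k * K) + 1"
      using card_atLeastAtMost_int[of "- int (k * K)" "int (k * K)"] by linarith
    then have "card (?I \<rightarrow>\<^sub>E ?J) = (2 * (k * K) + 1) ^ (?n - 1)" by (simp only: card_PiE[OF finite] prod_constant card_Diff_singleton[OF UNIV_I])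
    finally have "card (?g ` ?S) \<le> (2 * (k * K) + 1) ^ (?n - 1)" .
    moreover have "inj_on ?g ?S"
    proof (rule inj_onI)
      fix m m' assume m: "m \<in> ?S" "m' \<in> ?S" "?g m = ?g m'"
      have off: "m $ i = m' $ i" if "i \<noteq> i0" for i
      proof -
        have "\<lfloor>m $ i\<rfloor> = \<lfloor>m' $ i\<rfloor>" using fun_cong[OF m(3), of i] that by simp
        moreover have "m $ i \<in> \<int>" "m' $ i \<in> \<int>" using m(1,2) by (auto simp: lattice_points_def)
        ultimately show ?thesis by (auto elim!: Ints_cases)
      qed
      have "0 = (m - m') \<bullet> v p" using orth m by (simp add: inner_diff_left)
      also have "\<dots> = (\<Sum>i\<in>UNIV. (m - m') $ i * v p $ i)" by (simp add: inner_vec_def)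
      also have "\<dots> = (m - m') $ i0 * v p $ i0" 
        using off by (subst sum.remove[of UNIV i0]) (auto intro!: sum.neutral)
      finally have "m $ i0 = m' $ i0" using i0 by simp
      then show "m = m'" using off by (metis vec_eq_iff)
    qed
    ultimately have "card ?S \<le> (2 * (k * K) + 1) ^ (?n - 1)" by (simp only: card_image)
    then show ?thesis unfolding h0_def .
  qed
  let ?C = "(2 * real K + 1) ^ (?n - 1)"
  have le: "ereal (real (h0 \<Delta> (\<lambda>\<rho>. int k * D \<rho>)) / real k ^ ?n) \<le> ereal (?C / real k)" if k: "k \<ge> 1" for k
  proof -
    have "real (h0 \<Delta> (\<lambda>\<rho>. int k * D \<rho>)) \<le> real ((2 * (k * K) + 1) ^ (?n - 1))" using bound by (simp only: of_nat_le_iff)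
    also have "\<dots> = (2 * (real k * real K) + 1) ^ (?n - 1)" by (simp add: add.commute)
    also have "\<dots> \<le> ((2 * real K + 1) * real k) ^ (?n - 1)"
      by (rule power_mono) (use k in \<open>auto simp: algebra_simps\<close>)
    also have "\<dots> = ?C * real k ^ (?n - 1)" by (rule power_mult_distrib)
    finally have "real (h0 \<Delta> (\<lambda>\<rho>. int k * D \<rho>)) / real k ^ ?n \<le> ?C * real k ^ (?n - 1) / real k ^ ?n"
      by (intro divide_right_mono) auto
    also have "?C * real k ^ (?n - 1) / real k ^ ?n = ?C / real k"
    proof -
      have "real k ^ ?n = real k * real k ^ (?n - 1)" by (metis power_eq_if zero_less_card_finite less_numeral_extra(3))
      then show ?thesis using k by simp
    qed
    finally show ?thesis by simp
  qed
  have "(\<lambda>k. ?C / real k) \<longlonglongrightarrow> 0" by (rule lim_const_over_n)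
  then have "(\<lambda>k. ereal (?C / real k)) \<longlonglongrightarrow> ereal 0" by simp
  then have lim: "limsup (\<lambda>k. ereal (?C / real k)) = ereal 0" by (rule lim_imp_Limsup[OF sequentially_bot])
  have "limsup (\<lambda>k. ereal (real (h0 \<Delta> (\<lambda>\<rho>. int k * D \<rho>)) / real k ^ ?n)) \<le> limsup (\<lambda>k. ereal (?C / real k))"
    by (rule Limsup_mono, rule eventually_sequentiallyI[of 1]) (rule le)
  then show ?thesis using lim by (simp add: big_divisor_def not_less zero_ereal_def)
qed

end

text \<open>One prime divisor serves twice: its class makes the chamber bordering, and the divisor
  itself is nef and not big. It is nontrivial because a functional is strictly positive on its
  class.\<close>

theorem theorem1p13:
  fixes \<Delta> :: "(real^'n) set set" and q :: "(real^'n) set \<Rightarrow> real^'r"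
  assumes "regular_fan \<Delta>" and "complete_fan \<Delta>"
    and "class_map \<Delta> q" and "CARD('r) \<le> 3"
  shows "(\<exists>P. nef_primitive_collection \<Delta> P \<and>
            cuts_out_facet (prim_support \<Delta> q P) (Eff_cone \<Delta> q) \<and>
            (CARD('r) \<noteq> 1 \<longrightarrow>
               bordering (Nef_cone \<Delta> q) (prim_support \<Delta> q P) (Eff_cone \<Delta> q))) \<and>
         (CARD('r) \<noteq> 1 \<longrightarrow>
            (\<exists>D :: (real^'n) set \<Rightarrow> int.
               nef_divisor \<Delta> (\<lambda>\<rho>. of_int (D \<rho>)) \<and> \<not> principal_divisor \<Delta> D \<and>
               \<not> big_divisor \<Delta> D))"
proof -
  interpret smooth_fan_class \<Delta> q by unfold_locales (use assms in auto)
  obtain P f where P: "primitive P" and f: "linear f" "\<forall>\<rho>\<in>rays \<Delta>. f (q \<rho>) = (if \<rho> \<in> P then 1 else 0 :: real)"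
    and nef: "CARD('r) \<noteq> 1 \<longrightarrow> (\<exists>j\<in>rays \<Delta> - P. in_all_cones j)"
    using ex_dependent_primitive assms(4) by auto
  have PR: "P \<subseteq> rays \<Delta>" using P by (simp add: primitive_def)
  \<comment> \<open>By Gale duality the values of \<open>f\<close> are the coefficients of a
    relation among the generators; so \<open>P\<close> has sum zero, and its primitive relation has
    only the coefficients 0 and 1.\<close>
  have "(\<Sum>\<rho>\<in>P. v \<rho>) = (\<Sum>\<rho>\<in>rays \<Delta>. f (q \<rho>) *\<^sub>R v \<rho>)"
    using PR finite_rays f(2) by (intro sum.mono_neutral_cong_left) auto
  then have zero: "(\<Sum>\<rho>\<in>P. v \<rho>) = 0" using functional_relation[OF f(1)] by simp
  note coeff = prim_coeff_zero_sum[OF zero]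
  have support: "prim_support \<Delta> q P = {x. f x = 0}"
    using prim_functional_eq[OF f(1), of P] f(2) coeff by (simp add: prim_support_def)
  have facet: "cuts_out_facet (prim_support \<Delta> q P) (Eff_cone \<Delta> q)"
    unfolding support using Eff_facet[OF P f(1)] f(2) by blast
  have npc: "nef_primitive_collection \<Delta> P"
    using primitive_collection_of_primitive[OF P] coeff by (simp add: nef_primitive_collection_def)
  show ?thesis
  proof (cases "CARD('r) = 1")
    case True
    then show ?thesis using npc facet by blast
  next
    case False
    then obtain j where j: "j \<in> rays \<Delta>" "j \<notin> P" "in_all_cones j" using nef by blast
    let ?D = "\<lambda>\<rho>. if \<rho> = j then 1 else 0 :: int"
    have real_D: "(\<lambda>\<rho>. real_of_int (?D \<rho>)) = (\<lambda>\<rho>. if \<rho> = j then 1 else 0)" by auto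
    have nefD: "nef_divisor \<Delta> (\<lambda>\<rho>. real_of_int (?D \<rho>))" unfolding real_D by (rule nef_prime_divisor[OF j(1,3)])
    have cls: "divisor_class \<Delta> q (\<lambda>\<rho>. real_of_int (?D \<rho>)) = q j"
      using j(1) finite_rays unfolding divisor_class_def real_D
      by (simp add: if_distrib[of "\<lambda>c. c *\<^sub>R _"] cong: if_cong)
    obtain h where h: "linear h" "\<forall>\<rho>\<in>rays \<Delta>. h (q \<rho>) > (0::real)" using positive_functional by blast
    have q0: "q j \<noteq> 0" using h j(1) linear_0[OF h(1)] by force
    have "q j \<in> Nef_cone \<Delta> q" unfolding Nef_cone_def using nefD cls by (intro image_eqI[of _ _ "\<lambda>\<rho>. real_of_int (?D \<rho>)"]) auto
    moreover have "q j \<in> prim_support \<Delta> q P" unfolding support using f(2) j by simp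
    ultimately have "dim {q j} \<le> dim (Nef_cone \<Delta> q \<inter> prim_support \<Delta> q P)" by (intro dim_subset) auto
    then have bord: "bordering (Nef_cone \<Delta> q) (prim_support \<Delta> q P) (Eff_cone \<Delta> q)"
      using q0 facet by (simp add: bordering_def dim_singleton)
    have "\<not> principal_divisor \<Delta> ?D"
    proof
      assume "principal_divisor \<Delta> ?D"
      then obtain m where "\<forall>\<rho>\<in>rays \<Delta>. real_of_int (?D \<rho>) = m \<bullet> v \<rho>" unfolding principal_divisor_def by blast
      then have "divisor_class \<Delta> q (\<lambda>\<rho>. real_of_int (?D \<rho>)) = (\<Sum>\<rho>\<in>rays \<Delta>. (m \<bullet> v \<rho>) *\<^sub>R q \<rho>)"
        unfolding divisor_class_def by (intro sum.cong) auto
      then show False using cls q0 principal_relation by simp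
    qed
    moreover have "\<not> big_divisor \<Delta> ?D"
      by (rule not_big[OF PR primitive_nonempty[OF P] zero]) (use j in auto)
    ultimately have "\<exists>D :: (real^'n) set \<Rightarrow> int.
        nef_divisor \<Delta> (\<lambda>\<rho>. of_int (D \<rho>)) \<and> \<not> principal_divisor \<Delta> D \<and> \<not> big_divisor \<Delta> D"
      using nefD by (intro exI[of _ ?D] conjI)
    then show ?thesis using npc facet bord by blast
  qed
qed

end
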